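(* Let $\nu,d\in\mathbb{N}$, let $\Psi$ be a real symmetric positive definite $\nu\times\nu$ matrix, $\Sigma$ a real symmetric positive definite $d\times d$ matrix, and $\mathfrak{Z}\sim\mathcal{N}_{\nu\times d}(0_{\nu\times d},I_\nu\otimes I_d)$. For a test function $h:\mathbb{R}^{\nu\times d}\to\mathbb{R}$ in the classes below, let $$f_h(X)=-\int_0^\infty\Big\{\mathsf{E}\big[h\big(e^{-t}X+\sqrt{1-e^{-2t}}\,\Psi^{1/2}\mathfrak{Z}\Sigma^{1/2}\big)\big]-\mathsf{E}\big[h(\Psi^{1/2}\mathfrak{Z}\Sigma^{1/2})\big]\Big\}\,\mathrm{d}t .$$ In the following, indices $i,i_1,\dots,i_m$ range over $\{1,\dots,\nu\}$ and $j,j_1,\dots,j_m$ over $\{1,\dots,d\}$, arbitrarily. (1) If $h\in\mathrm{Lip}_{m-1}(\mathbb{R}^{\nu\times d})$ for some $m\in\mathbb{N}$, then $$\Big\|\Big(\prod_{\ell=1}^m\nabla_{i_\ell j_\ell}\Big)f_h\Big\|_\infty\le\frac1m\Big\|\Big(\prod_{\ell=1}^m\nabla_{i_\ell j_\ell}\Big)h\Big\|_\infty.$$ (2) If $h\in C^{0,\alpha}(\mathbb{R}^{\nu\times d})$ is bounded, for some $\alpha\in(0,1]$, then $$\|\nabla_{ij}f_h\|_\infty\le\sqrt{\frac{\pi}{2}}\,\sqrt{(\Psi^{-1})_{ii}(\Sigma^{-1})_{jj}}\ \big\|h-\mathsf{E}[h(\Psi^{1/2}\mathfrak{Z}\Sigma^{1/2})]\big\|_\infty.$$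 (3) If $h\in\mathrm{Lip}_{m-2}(\mathbb{R}^{\nu\times d})$ with $m\in\mathbb{N}$, $m\ge2$, then $$\Big\|\Big(\prod_{\ell=1}^m\nabla_{i_\ell j_\ell}\Big)f_h\Big\|_\infty\le\frac{\Gamma(m/2)}{\sqrt2\,\Gamma(m/2+1/2)}\min_{1\le k\le m}\Big\{\sqrt{(\Psi^{-1})_{i_ki_k}(\Sigma^{-1})_{j_kj_k}}\ \Big\|\Big(\prod_{\ell=1,\,\ell\ne k}^m\nabla_{i_\ell j_\ell}\Big)h\Big\|_\infty\Big\}.$$ (4) If $h\in C_b^m(\mathbb{R}^{\nu\times d})$ for some $m\in\mathbb{N}$, then $\mathcal{M}_m(f_h)\le\frac1m\mathcal{M}_m(h)$. (5) If $h\in C^{0,\alpha}(\mathbb{R}^{\nu\times d})$ is bounded, for some $\alpha\in(0,1]$, then $$\mathcal{M}_1(f_h)\le\sqrt{\frac{\pi}{2}}\,\|\Psi^{-1/2}\|_2\,\|\Sigma^{-1/2}\|_2\,\big\|h-\mathsf{E}[h(\Psi^{1/2}\mathfrak{Z}\Sigma^{1/2})]\big\|_\infty.$$ (6) If $h\in C_b^{m-1}(\mathbb{R}^{\nu\times d})$ with $m\in\mathbb{N}$, $m\ge2$, then $$\mathcal{M}_m(f_h)\le\frac{\Gamma(m/2)}{\sqrt2\,\Gamma(m/2+1/2)}\,\|\Psi^{-1/2}\|_2\,\|\Sigma^{-1/2}\|_2\,\mathcal{M}_{m-1}(h).$$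
   Context: $\nabla_{ij}=\partial/\partial X_{ij}$ for $X\in\mathbb{R}^{\nu\times d}$. $\|A\|_F=\sqrt{\mathrm{tr}(A^\top A)}$ is the Frobenius norm, $\|S\|_2$ the spectral norm, $S^{1/2}$ the symmetric square root and $S^{-1/2}$ its inverse. $\mathfrak{Z}\sim\mathcal{N}_{\nu\times d}(0_{\nu\times d},I_\nu\otimes I_d)$ means that $\mathfrak{Z}$ is a $\nu\times d$ matrix with iid standard normal entries. For $\alpha\in(0,1]$, $[h]_\alpha=\sup_{X\ne Y}|h(X)-h(Y)|/\|X-Y\|_F^\alpha$ and $C^{0,\alpha}(\mathbb{R}^{\nu\times d})=\{h:[h]_\alpha<\infty\}$. For $p\in\mathbb{N}\cup\{0\}$, $\mathrm{Lip}_p(\mathbb{R}^{\nu\times d})$ is the class of functions whose partial derivatives up to order $p$ exist (zeroth-order derivative being the function itself) and whose partial derivatives of order $p$ belong to $C^{0,1}(\mathbb{R}^{\nu\times d})$. For $h\in\mathrm{Lip}_p(\mathbb{R}^{\nu\times d})$ the partial derivatives of order $p+1$ of $h$ are understood to exist almost everywhere, and the corresponding $\|\cdot\|_\infty$ norms are interpreted as essential supremum norms. $C_b^m(\mathbb{R}^{\nu\times d})$ is the class of $m$ times continuously differentiable real functions whose partial derivatives up to total order $m$ are bounded. For $k\in\mathbb{N}$ and $g:\mathbb{R}^{\nu\times d}\to\mathbb{R}$, $$\mathcal{M}_k(g)=\sup_{X\in\mathbb{R}^{\nu\times d}}\ \sup_{\|U_1\|_F=\dots=\|U_k\|_F=1}\big|D^kg(X)[U_1,\dots,U_k]\big|,$$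 where $D^kg$ is the $k$th Fr\'echet derivative. The function $f_h$ is the semigroup solution of the matrix normal Stein equation $-\mathrm{tr}\{X^\top\nabla f(X)\}+\mathrm{tr}\{\Sigma\nabla^\top\Psi\nabla f(X)\}=h(X)-\mathsf{E}[h(\Psi^{1/2}\mathfrak{Z}\Sigma^{1/2})]$; the defining integral converges for all test functions in the classes considered. *)

theory Defs
  imports "HOL-Probability.Probability"
begin

text \<open>A real \<open>\<nu> \<times> d\<close> matrix has type \<open>real ^ 'd ^ 'n\<close>, with \<open>\<nu> = CARD('n)\<close> and \<open>d = CARD('d)\<close>.
  The library norm of this type is the Frobenius norm:\<close>

lemma norm_eq_frobenius:
  fixes A :: "real ^ 'd ^ 'n"
  shows "norm A = sqrt (trace (transpose A ** A))"
proof -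
  have "trace (transpose A ** A) = (\<Sum>j\<in>UNIV. \<Sum>i\<in>UNIV. (A $ i $ j)\<^sup>2)"
    by (simp add: trace_def matrix_matrix_mult_def transpose_def power2_eq_square)
  also have "\<dots> = (\<Sum>i\<in>UNIV. \<Sum>j\<in>UNIV. (A $ i $ j)\<^sup>2)"
    by (rule sum.swap)
  also have "\<dots> = (\<Sum>i\<in>UNIV. (norm (A $ i))\<^sup>2)"
    by (simp add: norm_vec_def L2_set_def sum_nonneg)
  finally show ?thesis
    by (simp add: norm_vec_def[of A] L2_set_def)
qed

definition sym_pos_def :: "real ^ 'k ^ 'k \<Rightarrow> bool" where
  "sym_pos_def A \<longleftrightarrow> transpose A = A \<and> (\<forall>x. x \<noteq> 0 \<longrightarrow> 0 < x \<bullet> (A *v x))"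

definition mat_sqrt :: "real ^ 'k ^ 'k \<Rightarrow> real ^ 'k ^ 'k" where
  "mat_sqrt A = (THE B. transpose B = B \<and> (\<forall>x. 0 \<le> x \<bullet> (B *v x)) \<and> B ** B = A)"

definition spectral_norm :: "real ^ 'd ^ 'n \<Rightarrow> real" where
  "spectral_norm A = onorm (\<lambda>x. A *v x)"

definition std_normal_matrix :: "'w measure \<Rightarrow> ('w \<Rightarrow> real ^ 'd ^ 'n) \<Rightarrow> bool" where
  "std_normal_matrix M Z \<longleftrightarrow>
     prob_space M \<and>
     prob_space.indep_vars M (\<lambda>_. borel) (\<lambda>(i, j) \<omega>. Z \<omega> $ i $ j) UNIV \<and>
     (\<forall>i j. distributed M lborel (\<lambda>\<omega>. Z \<omega> $ i $ j) std_normal_density)"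

text \<open>Norms and seminorms take values in \<open>ereal\<close>, so that suprema are meaningful without
  a boundedness side condition.\<close>

definition sup_norm :: "('a \<Rightarrow> real) \<Rightarrow> ereal" where
  "sup_norm g = (SUP X. ereal \<bar>g X\<bar>)"

definition ess_sup_norm :: "('a::euclidean_space \<Rightarrow> real) \<Rightarrow> ereal" where
  "ess_sup_norm g = esssup lebesgue (\<lambda>X. ereal \<bar>g X\<bar>)"

definition holder_seminorm :: "real \<Rightarrow> ('a::real_normed_vector \<Rightarrow> real) \<Rightarrow> ereal" where
  "holder_seminorm \<alpha> h =
     (SUP (X, Y) \<in> {(X, Y). X \<noteq> Y}. ereal (\<bar>h X - h Y\<bar> / norm (X - Y) powr \<alpha>))"

definition holder_class :: "real \<Rightarrow> ('a::real_normed_vector \<Rightarrow> real) set" where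
  "holder_class \<alpha> = {h. holder_seminorm \<alpha> h < \<infinity>}"

definition unit_mat :: "'n \<Rightarrow> 'd \<Rightarrow> real ^ 'd ^ 'n" where
  "unit_mat i j = axis i (axis j 1)"

text \<open>Where the partial derivative does not exist, \<open>nabla i j f\<close> has a fixed unspecified value;
  for a Lipschitz \<open>f\<close> this concerns only a null set, which \<open>ess_sup_norm\<close> ignores.\<close>

definition nabla :: "'n \<Rightarrow> 'd \<Rightarrow> (real ^ 'd ^ 'n \<Rightarrow> real) \<Rightarrow> real ^ 'd ^ 'n \<Rightarrow> real" where
  "nabla i j f X = deriv (\<lambda>t. f (X + t *\<^sub>R unit_mat i j)) 0"

definition has_nabla :: "'n \<Rightarrow> 'd \<Rightarrow> (real ^ 'd ^ 'n \<Rightarrow> real) \<Rightarrow> real ^ 'd ^ 'n \<Rightarrow> bool" where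
  "has_nabla i j f X \<longleftrightarrow> (\<lambda>t. f (X + t *\<^sub>R unit_mat i j)) differentiable (at 0)"

definition nablas :: "('n \<times> 'd) list \<Rightarrow> (real ^ 'd ^ 'n \<Rightarrow> real) \<Rightarrow> real ^ 'd ^ 'n \<Rightarrow> real" where
  "nablas ps f = foldr (\<lambda>(i, j) g. nabla i j g) ps f"

text \<open>All iterated partial derivatives up to order \<open>p\<close>, in every order of differentiation,
  exist at every point.\<close>

definition partials_exist :: "nat \<Rightarrow> (real ^ 'd ^ 'n \<Rightarrow> real) \<Rightarrow> bool" where
  "partials_exist p f \<longleftrightarrow>
     (\<forall>ps i j X. length ps < p \<longrightarrow> has_nabla i j (nablas ps f) X)"

definition Lip_class :: "nat \<Rightarrow> (real ^ 'd ^ 'n \<Rightarrow> real) set" where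
  "Lip_class p =
     {h. partials_exist p h \<and> (\<forall>ps. length ps = p \<longrightarrow> nablas ps h \<in> holder_class 1)}"

text \<open>\<open>frechet_D [U\<^sub>1, \<dots>, U\<^sub>k] g X\<close> is the value \<open>D\<^sup>k g(X)[U\<^sub>1, \<dots>, U\<^sub>k]\<close> of the \<open>k\<close>-th Frechet
  derivative. As \<open>k\<close> varies, the spaces of \<open>k\<close>-linear forms have no common type, so the iteration
  differentiates the evaluations \<open>X \<mapsto> D\<^sup>k g(X)[U\<^sub>1, \<dots>, U\<^sub>k]\<close>; in finite dimension, differentiability
  (continuity) of all evaluations is the same as that of \<open>D\<^sup>k g\<close> itself.\<close>

fun frechet_D :: "'a list \<Rightarrow> ('a::euclidean_space \<Rightarrow> real) \<Rightarrow> 'a \<Rightarrow> real" where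
  "frechet_D [] g X = g X"
| "frechet_D (U # Us) g X = frechet_derivative (frechet_D Us g) (at X) U"

definition frechet_differentiable :: "nat \<Rightarrow> ('a::euclidean_space \<Rightarrow> real) \<Rightarrow> bool" where
  "frechet_differentiable m g \<longleftrightarrow>
     (\<forall>Us X. length Us < m \<longrightarrow> frechet_D Us g differentiable (at X))"

definition deriv_norm :: "nat \<Rightarrow> ('a::euclidean_space \<Rightarrow> real) \<Rightarrow> ereal" where
  "deriv_norm k g =
     (SUP X. SUP Us \<in> {Us. length Us = k \<and> (\<forall>U \<in> set Us. norm U = 1)}. ereal \<bar>frechet_D Us g X\<bar>)"

definition Cb_class :: "nat \<Rightarrow> (real ^ 'd ^ 'n \<Rightarrow> real) set" where
  "Cb_class m =
     {h. frechet_differentiable m h \<and>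
         (\<forall>Us. length Us \<le> m \<longrightarrow> continuous_on UNIV (frechet_D Us h)) \<and>
         (\<forall>ps. length ps \<le> m \<longrightarrow> bounded (range (nablas ps h)))}"

definition normal_mean ::
  "'w measure \<Rightarrow> ('w \<Rightarrow> real ^ 'd ^ 'n) \<Rightarrow> real ^ 'n ^ 'n \<Rightarrow> real ^ 'd ^ 'd
    \<Rightarrow> (real ^ 'd ^ 'n \<Rightarrow> real) \<Rightarrow> real" where
  "normal_mean M Z \<Psi> \<Sigma> h = (\<integral>\<omega>. h (mat_sqrt \<Psi> ** Z \<omega> ** mat_sqrt \<Sigma>) \<partial>M)"

definition stein_solution ::
  "'w measure \<Rightarrow> ('w \<Rightarrow> real ^ 'd ^ 'n) \<Rightarrow> real ^ 'n ^ 'n \<Rightarrow> real ^ 'd ^ 'd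
    \<Rightarrow> (real ^ 'd ^ 'n \<Rightarrow> real) \<Rightarrow> real ^ 'd ^ 'n \<Rightarrow> real" where
  "stein_solution M Z \<Psi> \<Sigma> h X =
     - (LINT t:{0..}|lborel.
          (\<integral>\<omega>. h (exp (- t) *\<^sub>R X
                  + sqrt (1 - exp (- 2 * t)) *\<^sub>R (mat_sqrt \<Psi> ** Z \<omega> ** mat_sqrt \<Sigma>)) \<partial>M)
          - normal_mean M Z \<Psi> \<Sigma> h)"

end

theory Submission imports Defs begin

text \<open>
  With \<open>P\<^sub>t g(X) = E g(e\<^sup>-\<^sup>t X + (1 - e\<^sup>-\<^sup>2\<^sup>t)\<^sup>1\<^sup>/\<^sup>2 S Z)\<close> and \<open>S U = \<Psi>\<^sup>1\<^sup>/\<^sup>2 U \<Sigma>\<^sup>1\<^sup>/\<^sup>2\<close>, the solution is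
  \<open>f\<^sub>h = - \<integral> (P\<^sub>t h - E h(S Z)) dt\<close>. A derivative in direction \<open>U\<close> passes through \<open>P\<^sub>t\<close> in two ways. It can
  fall on \<open>g\<close>, at the price of a factor \<open>e\<^sup>-\<^sup>t\<close>. It can also be moved to the Gaussian density,
  which gives the factor \<open>e\<^sup>-\<^sup>t (1 - e\<^sup>-\<^sup>2\<^sup>t)\<^sup>-\<^sup>1\<^sup>/\<^sup>2\<close> and the weight \<open>\<langle>S\<^sup>-\<^sup>1 U, Z\<rangle>\<close>, whose absolute mean is
  \<open>(2 / \<pi>)\<^sup>1\<^sup>/\<^sup>2 \<parallel>S\<^sup>-\<^sup>1 U\<parallel>\<close>. The constants \<open>1 / m\<close> and \<open>\<Gamma>(m/2) / (2\<^sup>1\<^sup>/\<^sup>2 \<Gamma>(m/2 + 1/2))\<close> are, up to the factor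
  \<open>(2 / \<pi>)\<^sup>1\<^sup>/\<^sup>2\<close> in the second case, the integrals of \<open>e\<^sup>-\<^sup>m\<^sup>t\<close> and \<open>e\<^sup>-\<^sup>m\<^sup>t (1 - e\<^sup>-\<^sup>2\<^sup>t)\<^sup>-\<^sup>1\<^sup>/\<^sup>2\<close> over the half line.

  The last derivative of a Lipschitz class exists only almost everywhere. It enters only through
  Lipschitz constants in a fixed direction: a Lipschitz function whose directional derivative is
  essentially bounded by \<open>C\<close> is \<open>C\<close>-Lipschitz in that direction. This reduces by Fubini to functions of one
  real variable, where it follows from Lebesgue's differentiation theorem.
\<close>

section \<open>Lipschitz functions of one variable\<close>

text \<open>The weight exp(-t) / sqrt(1 - exp(-2t)) behaves like (2t)^(-1/2) near 0 and is
  integrable, whereas moving two derivatives to the density would produce a multiple of 1/t, which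
  is not. So at most one derivative is moved. If h has p derivatives and those of order p are
  Lipschitz, the solution must still be differentiated p + 2 times: p derivatives fall on h, one
  falls on the density, and the outermost one is estimated by increments. A shift of the argument by
  s U shifts the point at which h is evaluated by exp(-t) s U, so a Lipschitz constant in the single
  direction U contracts by exp(-t). Existence of the outermost derivative comes from the density,
  its size from the increments. Keeping the constant directional is what allows a single partial
  derivative of h on the right-hand side. Mixed derivatives of the solution commute, so any
  direction may be the one moved to the density; hence the minimum over \<open>k\<close>. Functions
  in these classes may grow, so integrals are controlled in the class of continuous functions of at
  most exponential growth, which is closed under products and affine substitutions.\<close>

lemma vitali_covering_intervals:
  fixes S U :: "real set" and P :: "real \<Rightarrow> real \<Rightarrow> bool"
  assumes U: "open U" "S \<subseteq> U"
    and cov: "\<And>x d. x \<in> S \<Longrightarrow> 0 < d \<Longrightarrow> \<exists>a b. a < b \<and> a \<le> x \<and> x \<le> b \<and> b - a < d \<and> P a b"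
  obtains C where "countable C" "\<forall>(a, b)\<in>C. a < b \<and> P a b \<and> {a..b} \<subseteq> U"
    "disjoint_family_on (\<lambda>(a, b). {a..b}) C" "negligible (S - (\<Union>(a, b)\<in>C. {a..b}))"
proof -
  \<comment> \<open>Containment in \<open>U\<close> is built into the index set, so every selected
    interval stays inside \<open>U\<close>. Midpoint and half-length turn the intervals into the
    balls of the covering theorem.\<close>
  define K where "K = {(a, b). a < b \<and> P a b \<and> {a..b} \<subseteq> U}"
  define m where "m = (\<lambda>(a::real, b). (a + b) / 2)"
  define r where "r = (\<lambda>(a::real, b). (b - a) / 2)"
  have cb: "cball (m i) (r i) = (case i of (a, b) \<Rightarrow> {a..b})" for i
    by (cases i) (auto simp: m_def r_def cball_eq_atLeastAtMost field_simps)
  have cov': "\<exists>i. i \<in> K \<and> x \<in> cball (m i) (r i) \<and> r i < d" if xd: "x \<in> S" "0 < d" for x d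
  proof -
    obtain e where e: "e > 0" "cball x e \<subseteq> U"
      using U \<open>x \<in> S\<close> by (meson open_contains_cball subsetD)
    obtain a b where ab: "a < b" "a \<le> x" "x \<le> b" "b - a < d" "b - a < e" "P a b"
      using cov[OF xd(1), of "min d e"] \<open>0 < d\<close> e(1) by (metis min_less_iff_conj)
    have "{a..b} \<subseteq> cball x e" using ab by (auto simp: dist_real_def)
    then have "(a, b) \<in> K" using ab e by (auto simp: K_def)
    moreover have "r (a, b) < d" using ab by (auto simp: r_def)
    moreover have "x \<in> cball (m (a, b)) (r (a, b))" using ab by (simp add: cb)
    ultimately show ?thesis by blast
  qed
  have pos: "0 < r i" if "i \<in> K" for i using that by (auto simp: K_def r_def)
  obtain C where C: "countable C" "C \<subseteq> K"
      "pairwise (\<lambda>i j. disjnt (cball (m i) (r i)) (cball (m j) (r j))) C"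
      "negligible (S - (\<Union>i \<in> C. cball (m i) (r i)))"
    by (rule Vitali_covering_theorem_cballs[of K r S m, OF pos cov'])
  show ?thesis
  proof (rule that[OF C(1)])
    show "\<forall>(a, b)\<in>C. a < b \<and> P a b \<and> {a..b} \<subseteq> U"
      using C(2) by (auto simp: K_def)
    show "disjoint_family_on (\<lambda>(a, b). {a..b}) C"
      using C(3) unfolding cb pairwise_def disjoint_family_on_def disjnt_def by blast
    show "negligible (S - (\<Union>(a, b)\<in>C. {a..b}))"
      using C(4) unfolding cb .
  qed
qed

text \<open>Inequalities on the single members of a disjoint countable family add up. A coefficient
  on either side lets the same statement serve lower and upper slope estimates.\<close>

lemma emeasure_UN_mono_countable:
  assumes "countable C" "disjoint_family_on X C" "\<And>i. i \<in> C \<Longrightarrow> X i \<in> sets M"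
    "\<And>i. i \<in> C \<Longrightarrow> X i \<in> sets N"
    "\<And>i. i \<in> C \<Longrightarrow> c * emeasure M (X i) \<le> d * emeasure N (X i)"
  shows "c * emeasure M (\<Union>i\<in>C. X i) \<le> d * emeasure N (\<Union>i\<in>C. X i)"
  using assms
  by (simp add: emeasure_UN_countable nn_integral_cmult[symmetric]) (rule nn_integral_mono, simp)

text \<open>The image of Lebesgue measure under the inverse of \<open>\<psi>\<close> is the Stieltjes measure of \<open>\<psi>\<close>; it is
  absolutely continuous because \<open>\<psi>\<close> maps null sets to null sets.\<close>

lemma slope_bounded_density:
  fixes \<psi> :: "real \<Rightarrow> real"
  assumes lo: "\<And>x y. x \<le> y \<Longrightarrow> y - x \<le> \<psi> y - \<psi> x"
    and hi: "\<And>x y. x \<le> y \<Longrightarrow> \<psi> y - \<psi> x \<le> K * (y - x)"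
  obtains g :: "real \<Rightarrow> ennreal" where "g \<in> borel_measurable borel"
    "\<And>a b. a \<le> b \<Longrightarrow> emeasure (density lborel g) {a..b} = ennreal (\<psi> b - \<psi> a)"
proof -
  have K: "K \<ge> 0" using lo[of 0 1] hi[of 0 1] by simp
  have lip: "\<bar>\<psi> y - \<psi> x\<bar> \<le> K * \<bar>y - x\<bar>" for x y
    using hi[of x y] hi[of y x] lo[of x y] lo[of y x] by (cases "x \<le> y") auto
  have "K-lipschitz_on UNIV \<psi>"
    using lip K by (auto simp: lipschitz_on_def dist_real_def abs_minus_commute)
  then have cont: "continuous_on UNIV \<psi>" by (rule lipschitz_on_continuous_on)
  have less: "\<psi> x < \<psi> y" if "x < y" for x y using lo[of x y] that by simp
  have inj: "inj \<psi>" by (metis injI less linorder_neqE less_irrefl)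
  \<comment> \<open>Slopes of at least 1 make \<open>\<psi>\<close> unbounded in both directions,
    hence onto, so that the inverse is defined on the whole line.\<close>
  have "\<exists>x. \<psi> x = y" for y
  proof -
    define t where "t = \<bar>y - \<psi> 0\<bar>"
    have "\<psi> (- t) \<le> y" "y \<le> \<psi> t" using lo[of 0 t] lo[of "-t" 0] by (auto simp: t_def)
    then show ?thesis
      using IVT'[of \<psi> "-t" y t] continuous_on_subset[OF cont] by (auto simp: t_def)
  qed
  then have bij: "bij \<psi>" using inj by (metis bij_def surjI surj_def)
  define \<theta> where "\<theta> = inv \<psi>"
  have \<theta>: "\<theta> (\<psi> x) = x" "\<psi> (\<theta> y) = y" for x y
    using bij by (auto simp: \<theta>_def bij_def surj_f_inv_f)
  have le_iff: "a \<le> \<theta> y \<longleftrightarrow> \<psi> a \<le> y" "\<theta> y \<le> b \<longleftrightarrow> y \<le> \<psi> b" for a b y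
    using less \<theta> by (metis linorder_not_le order_le_less)+
  have \<theta>m[measurable]: "\<theta> \<in> borel_measurable borel"
    by (rule borel_measurableI_ge) (simp add: le_iff space_borel flip: atLeast_def)
  define N where "N = distr lborel borel \<theta>"
  have "absolutely_continuous lborel N"
    unfolding absolutely_continuous_def
  proof safe
    fix A :: "real set" assume A: "A \<in> null_sets lborel"
    have "\<theta> -` A = \<psi> ` A" by (auto simp: image_iff \<theta>) (metis \<theta>(2))
    moreover have "negligible (\<psi> ` A)"
    proof (rule negligible_locally_Lipschitz_image)
      show "negligible A" using A by (simp add: negligible_iff_null_sets null_sets_completionI)
      show "\<exists>T B. open T \<and> x \<in> T \<and> (\<forall>y\<in>A \<inter> T. norm (\<psi> y - \<psi> x) \<le> B * norm (y - x))" for x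
        using lip by (intro exI[of _ UNIV] exI[of _ K]) auto
    qed simp
    moreover have "\<theta> -` A \<in> sets borel" using A measurable_sets[OF \<theta>m, of A] by auto
    ultimately have "\<theta> -` A \<in> null_sets lborel"
      by (metis negligible_iff_null_sets null_sets_completion_iff sets_lborel)
    then show "A \<in> null_sets N"
      using A by (auto simp: N_def null_sets_def emeasure_distr space_borel)
  qed
  then obtain g where g: "g \<in> borel_measurable lborel" "density lborel g = N"
    using sigma_finite_measure.Radon_Nikodym[OF sigma_finite_lborel, of N] by (auto simp: N_def)
  show ?thesis
  proof (rule that)
    show "g \<in> borel_measurable borel" using g by simp
    show "emeasure (density lborel g) {a..b} = ennreal (\<psi> b - \<psi> a)" if "a \<le> b" for a b
    proof -
      have "\<theta> -` {a..b} = {\<psi> a..\<psi> b}" by (auto simp: le_iff)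
      moreover have "\<psi> a \<le> \<psi> b" using lo[OF that] that by simp
      ultimately show ?thesis by (simp add: g N_def emeasure_distr)
    qed
  qed
qed

text \<open>The two one-sided halves of Lebesgue's differentiation theorem below have this common end: the
  covering inequality forces \<open>(q - p) |V| \<le> c |U - G|\<close>, which is arbitrarily small.\<close>

lemma negligible_from_covering:
  fixes S :: "real set"
  assumes G: "G \<in> sets borel" "S \<subseteq> G" "G \<subseteq> {-R<..<R}" and "p < q" "0 \<le> c"
    and cov: "\<And>U. open U \<Longrightarrow> G \<subseteq> U \<Longrightarrow> U \<subseteq> {-R<..<R} \<Longrightarrow>
      \<exists>V. V \<in> sets borel \<and> V \<subseteq> U \<and> negligible (S - V) \<and>
        ennreal q * emeasure lborel V \<le> ennreal p * emeasure lborel V + ennreal c * emeasure lborel (U - G)"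
    and "0 \<le> p"
  shows "negligible S"
  unfolding negligible_outer_le
proof safe
  fix e :: real assume "e > 0"
  \<comment> \<open>Chosen so that \<open>c * \<epsilon>\<close> is at most
    \<open>e * (q - p)\<close>; the summand 1 keeps the denominator positive when
    \<open>c = 0\<close>.\<close>
  define \<epsilon> where "\<epsilon> = e * (q - p) / (c + 1)"
  have \<epsilon>: "\<epsilon> > 0" using \<open>e > 0\<close> \<open>p < q\<close> \<open>0 \<le> c\<close> by (simp add: \<epsilon>_def)
  obtain U0 where U0: "open U0" "G \<subseteq> U0" "emeasure lborel (U0 - G) < \<epsilon>"
    using outer_regular_lborel[OF G(1) \<epsilon>] by auto
  define U where "U = U0 \<inter> {-R<..<R}"
  have U: "open U" "G \<subseteq> U" "U \<subseteq> {-R<..<R}" using U0 G by (auto simp: U_def)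
  have "emeasure lborel (U - G) \<le> emeasure lborel (U0 - G)"
    using U0 G by (intro emeasure_mono) (auto simp: U_def)
  then have small: "emeasure lborel (U - G) \<le> ennreal \<epsilon>" using U0 by simp
  obtain V where V: "V \<in> sets borel" "V \<subseteq> U" "negligible (S - V)"
    "ennreal q * emeasure lborel V \<le> ennreal p * emeasure lborel V + ennreal c * emeasure lborel (U - G)"
    using cov[OF U] by blast
  \<comment> \<open>Confinement to a bounded interval makes the measure of \<open>V\<close> finite,
    so that \<open>p\<close> times it can be subtracted in the reals.\<close>
  have "emeasure lborel V \<le> emeasure lborel (cbox (-R) R)"
    using V U by (intro emeasure_mono) auto
  also have "\<dots> < \<infinity>" using emeasure_lborel_cbox_finite[of "-R" R] by (simp add: less_top)
  finally have fin: "emeasure lborel V < \<infinity>" .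
  define v where "v = measure lborel V"
  have v: "emeasure lborel V = ennreal v" "v \<ge> 0"
    using fin by (auto simp: v_def emeasure_eq_ennreal_measure)
  have "ennreal q * ennreal v \<le> ennreal p * ennreal v + ennreal c * ennreal \<epsilon>"
    using V(4) small v by (metis add_left_mono mult_left_mono order_trans zero_le)
  then have "ennreal (q * v) \<le> ennreal (p * v + c * \<epsilon>)"
    using v \<open>0 \<le> p\<close> \<open>p < q\<close> \<open>0 \<le> c\<close> \<epsilon> by (simp add: ennreal_mult ennreal_plus)
  then have "q * v \<le> p * v + c * \<epsilon>"
    using v \<open>0 \<le> p\<close> \<open>0 \<le> c\<close> \<epsilon> by (subst (asm) ennreal_le_iff) auto
  also have "c * \<epsilon> \<le> e * (q - p)"
    using \<open>0 \<le> c\<close> \<open>e > 0\<close> \<open>p < q\<close> by (auto simp: \<epsilon>_def field_simps)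
  finally have "(q - p) * v \<le> (q - p) * e" by (simp add: algebra_simps)
  then have "v \<le> e" using \<open>p < q\<close> by simp
  show "\<exists>T. S \<subseteq> T \<and> T \<in> lmeasurable \<and> measure lebesgue T \<le> e"
  proof (intro exI conjI)
    show "S \<subseteq> V \<union> (S - V)" by auto
    have Vm: "V \<in> lmeasurable" using fin V(1) by (intro fmeasurableI) auto
    then show "V \<union> (S - V) \<in> lmeasurable"
      using V(3) negligible_imp_measurable by blast
    have "measure lebesgue (V \<union> (S - V)) = measure lebesgue V"
      using V(3) Vm by (metis measure_Un3 negligible_imp_measurable negligible_imp_measure0 add_0_right
        Diff_disjoint measure_empty diff_zero)
    also have "\<dots> = v" using V(1) by (simp add: v_def)
    finally show "measure lebesgue (V \<union> (S - V)) \<le> e" using \<open>v \<le> e\<close> by simp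
  qed
qed

text \<open>\<open>Lo p q R\<close> consists of the points where the density exceeds \<open>q\<close> although arbitrarily short
  intervals around the point have slope at most \<open>p < q\<close>; \<open>Up p q R\<close> is the opposite situation. Both are
  null by Vitali's covering theorem, and off all of them the derivative is the density.\<close>

lemma slope_bounded_AE_derivative:
  fixes \<psi> :: "real \<Rightarrow> real"
  assumes lo: "\<And>x y. x \<le> y \<Longrightarrow> y - x \<le> \<psi> y - \<psi> x"
    and hi: "\<And>x y. x \<le> y \<Longrightarrow> \<psi> y - \<psi> x \<le> K * (y - x)"
  obtains g :: "real \<Rightarrow> ennreal" where "g \<in> borel_measurable borel"
    "\<And>a b. a \<le> b \<Longrightarrow> emeasure (density lborel g) {a..b} = ennreal (\<psi> b - \<psi> a)"
    "AE x in lebesgue. \<exists>l\<ge>0. g x = ennreal l \<and> (\<psi> has_real_derivative l) (at x)"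
proof -
  obtain g :: "real \<Rightarrow> ennreal" where g[measurable]: "g \<in> borel_measurable borel"
    and gI: "\<And>a b. a \<le> b \<Longrightarrow> emeasure (density lborel g) {a..b} = ennreal (\<psi> b - \<psi> a)"
    using slope_bounded_density[OF lo hi] by metis
  have K: "K \<ge> 0" using lo[of 0 1] hi[of 0 1] by simp
  define N where "N = density lborel g"
  have NI: "emeasure N {a..b} = ennreal (\<psi> b - \<psi> a)" if "a < b" for a b
    using gI that by (simp add: N_def)
  have emN: "emeasure N A = (\<integral>\<^sup>+x\<in>A. g x \<partial>lborel)" if "A \<in> sets borel" for A
    unfolding N_def using that by (intro emeasure_density) auto
  have setsN[simp]: "sets N = sets borel" by (simp add: N_def)
  define Lo where "Lo = (\<lambda>p q R. {x\<in>{-R<..<R}. ennreal q < g x \<and>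
     (\<forall>d>0. \<exists>a b. a < b \<and> a \<le> x \<and> x \<le> b \<and> b - a < d \<and> \<psi> b - \<psi> a \<le> p * (b - a))})"
  have Lo: "negligible (Lo p q R)" if pq: "0 \<le> p" "p < q" for p q R :: real
  proof (rule negligible_from_covering[of "{x\<in>{-R<..<R}. ennreal q < g x}" _ R p q q])
    fix U :: "real set" assume U: "open U" "{x\<in>{-R<..<R}. ennreal q < g x} \<subseteq> U" (is "?G \<subseteq> U") "U \<subseteq> {-R<..<R}"
    have sub: "Lo p q R \<subseteq> U" using U by (auto simp: Lo_def)
    have cov: "\<exists>a b. a < b \<and> a \<le> x \<and> x \<le> b \<and> b - a < d \<and> \<psi> b - \<psi> a \<le> p * (b - a)" if "x \<in> Lo p q R" "0 < d" for x d
      using that by (simp add: Lo_def)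
    obtain C where C: "countable C"
      "\<forall>(a, b)\<in>C. a < b \<and> \<psi> b - \<psi> a \<le> p * (b - a) \<and> {a..b} \<subseteq> U"
      "disjoint_family_on (\<lambda>(a, b). {a..b}) C" "negligible (Lo p q R - (\<Union>(a, b)\<in>C. {a..b}))"
      by (rule vitali_covering_intervals[of U "Lo p q R" "\<lambda>a b. \<psi> b - \<psi> a \<le> p * (b - a)", OF U(1) sub cov])
    define V where "V = (\<Union>(a, b)\<in>C. {a..b})"
    have Vm: "V \<in> sets borel" unfolding V_def using C(1) by (intro sets.countable_UN') auto
    have Gm: "?G \<in> sets borel" by measurable
    \<comment> \<open>The selected intervals have slope at most \<open>p\<close>, so the Stieltjes
      mass of \<open>V\<close> is at most \<open>p\<close> times its length. On the part of
      \<open>V\<close> inside the set where the density exceeds \<open>q\<close> the mass is at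
      least \<open>q\<close> times the length, and the rest of \<open>V\<close> lies in the small
      difference set.\<close>
    have "1 * emeasure N V \<le> ennreal p * emeasure lborel V"
      unfolding V_def
    proof (rule emeasure_UN_mono_countable[OF C(1,3)])
      fix i assume "i \<in> C"
      then show "1 * emeasure N (case i of (a, b) \<Rightarrow> {a..b}) \<le> ennreal p * emeasure lborel (case i of (a, b) \<Rightarrow> {a..b})"
        using C(2) pq by (cases i) (force simp: NI ennreal_mult[symmetric] intro!: ennreal_leI)
    qed auto
    moreover have "ennreal q * emeasure lborel (V \<inter> ?G) \<le> emeasure N V"
    proof -
      have "ennreal q * emeasure lborel (V \<inter> ?G) = (\<integral>\<^sup>+x\<in>V \<inter> ?G. ennreal q \<partial>lborel)"
        using Vm Gm by (simp add: nn_integral_cmult_indicator)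
      also have "\<dots> \<le> (\<integral>\<^sup>+x\<in>V. g x \<partial>lborel)"
        by (intro nn_integral_mono) (auto simp: indicator_def)
      finally show ?thesis using Vm by (simp add: emN)
    qed
    moreover have "emeasure lborel V \<le> emeasure lborel (V \<inter> ?G) + emeasure lborel (U - ?G)"
    proof -
      have "emeasure lborel V \<le> emeasure lborel ((V \<inter> ?G) \<union> (U - ?G))"
        using C(2) Vm Gm U(1) by (intro emeasure_mono) (fastforce simp: V_def)+
      also have "\<dots> \<le> emeasure lborel (V \<inter> ?G) + emeasure lborel (U - ?G)"
        using Vm Gm U(1) by (intro emeasure_subadditive) auto
      finally show ?thesis .
    qed
    ultimately have "ennreal q * emeasure lborel V \<le> ennreal p * emeasure lborel V + ennreal q * emeasure lborel (U - ?G)"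
      by (smt (verit) add_mono distrib_left dual_order.trans mult_1 mult_left_mono order_refl zero_le)
    moreover have "V \<subseteq> U" using C(2) by (fastforce simp: V_def)
    ultimately show "\<exists>V. V \<in> sets borel \<and> V \<subseteq> U \<and> negligible (Lo p q R - V) \<and>
        ennreal q * emeasure lborel V \<le> ennreal p * emeasure lborel V + ennreal q * emeasure lborel (U - ?G)"
      using Vm C(4) by (intro exI[of _ V]) (auto simp: V_def)
  qed (use pq in \<open>auto simp: Lo_def\<close>)
  define Up where "Up = (\<lambda>p q R. {x\<in>{-R<..<R}. g x < ennreal p \<and>
     (\<forall>d>0. \<exists>a b. a < b \<and> a \<le> x \<and> x \<le> b \<and> b - a < d \<and> q * (b - a) \<le> \<psi> b - \<psi> a)})"
  \<comment> \<open>The intervals from \<open>x\<close> to \<open>x + d/2\<close> have slope at most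
    \<open>K\<close>, so a point with density above \<open>K + 1\<close> lies in some
    \<open>Lo K (K+1) n\<close>; the gap between \<open>K\<close> and \<open>K + 1\<close> meets the
    condition \<open>p < q\<close>. The bound controls the mass outside the set \<open>?G\<close> in
    the estimate of \<open>Up\<close>.\<close>
  have gK: "AE x in lborel. g x \<le> ennreal (K + 1)"
  proof -
    have "x \<in> Lo K (K+1) (of_nat (nat \<lceil>\<bar>x\<bar> + 1\<rceil>))" if x: "ennreal (K+1) < g x" for x
    proof -
      have "\<exists>a b. a < b \<and> a \<le> x \<and> x \<le> b \<and> b - a < d \<and> \<psi> b - \<psi> a \<le> K * (b - a)" if "d > 0" for d
        using hi[of x "x + d/2"] that by (intro exI[of _ x] exI[of _ "x + d/2"]) auto
      moreover have "\<bar>x\<bar> < real (nat \<lceil>\<bar>x\<bar> + 1\<rceil>)" by linarith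
      ultimately show ?thesis using x by (auto simp: Lo_def abs_less_iff)
    qed
    then have "{x. ennreal (K+1) < g x} \<subseteq> (\<Union>n::nat. Lo K (K+1) (of_nat n))" by blast
    moreover have "negligible (\<Union>n::nat. Lo K (K+1) (of_nat n))"
      using Lo K by (intro negligible_countable_Union) auto
    ultimately have "negligible {x. ennreal (K+1) < g x}" by (rule negligible_subset[rotated])
    moreover have "{x. ennreal (K+1) < g x} \<in> sets borel" by measurable
    ultimately have "{x. ennreal (K+1) < g x} \<in> null_sets lborel"
      by (simp add: negligible_iff_null_sets null_sets_completion_iff)
    then show ?thesis by (rule AE_I') auto
  qed
  have Up: "negligible (Up p q R)" if pq: "0 \<le> p" "p < q" for p q R :: real
  proof (rule negligible_from_covering[of "{x\<in>{-R<..<R}. g x < ennreal p}" _ R p q "K+1"])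
    fix U :: "real set" assume U: "open U" "{x\<in>{-R<..<R}. g x < ennreal p} \<subseteq> U" (is "?G \<subseteq> U") "U \<subseteq> {-R<..<R}"
    have sub: "Up p q R \<subseteq> U" using U by (auto simp: Up_def)
    have cov: "\<exists>a b. a < b \<and> a \<le> x \<and> x \<le> b \<and> b - a < d \<and> q * (b - a) \<le> \<psi> b - \<psi> a" if "x \<in> Up p q R" "0 < d" for x d
      using that by (simp add: Up_def)
    obtain C where C: "countable C"
      "\<forall>(a, b)\<in>C. a < b \<and> q * (b - a) \<le> \<psi> b - \<psi> a \<and> {a..b} \<subseteq> U"
      "disjoint_family_on (\<lambda>(a, b). {a..b}) C" "negligible (Up p q R - (\<Union>(a, b)\<in>C. {a..b}))"
      by (rule vitali_covering_intervals[of U "Up p q R" "\<lambda>a b. q * (b - a) \<le> \<psi> b - \<psi> a", OF U(1) sub cov])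
    define V where "V = (\<Union>(a, b)\<in>C. {a..b})"
    have Vm[measurable]: "V \<in> sets borel" unfolding V_def using C(1) by (intro sets.countable_UN') auto
    have Gm[measurable]: "?G \<in> sets borel" by measurable
    have Um[measurable]: "U \<in> sets borel" using U by simp
    have VU: "V \<subseteq> U" using C(2) by (fastforce simp: V_def)
    have "ennreal q * emeasure lborel V \<le> 1 * emeasure N V"
      unfolding V_def
    proof (rule emeasure_UN_mono_countable[OF C(1,3)])
      fix i assume "i \<in> C"
      then show "ennreal q * emeasure lborel (case i of (a, b) \<Rightarrow> {a..b}) \<le> 1 * emeasure N (case i of (a, b) \<Rightarrow> {a..b})"
        using C(2) pq by (cases i) (force simp: NI ennreal_mult[symmetric] intro!: ennreal_leI)
    qed auto
    also have "1 * emeasure N V = (\<integral>\<^sup>+x\<in>V. g x \<partial>lborel)" by (simp add: emN)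
    also have "\<dots> \<le> (\<integral>\<^sup>+x. ennreal p * indicator V x + ennreal (K+1) * indicator (U - ?G) x \<partial>lborel)"
    proof (rule nn_integral_mono_AE)
      show "AE x in lborel. g x * indicator V x \<le> ennreal p * indicator V x + ennreal (K+1) * indicator (U - ?G) x"
        using gK
      proof eventually_elim
        case (elim x)
        then show ?case using VU U(3) by (cases "g x < ennreal p"; cases "x \<in> V") (auto simp: indicator_def intro: add_increasing less_imp_le)
      qed
    qed
    also have "\<dots> = ennreal p * emeasure lborel V + ennreal (K+1) * emeasure lborel (U - ?G)"
      by (subst nn_integral_add) (auto simp: nn_integral_cmult_indicator)
    finally show "\<exists>V. V \<in> sets borel \<and> V \<subseteq> U \<and> negligible (Up p q R - V) \<and>
        ennreal q * emeasure lborel V \<le> ennreal p * emeasure lborel V + ennreal (K+1) * emeasure lborel (U - ?G)"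
      using Vm C(4) VU by (intro exI[of _ V]) (auto simp: V_def)
  qed (use pq K in \<open>auto simp: Up_def\<close>)
  \<comment> \<open>Rational slopes and integer radii keep the union countable, and any interval
    next to \<open>l\<close> has room for two rationals \<open>p < q\<close>.\<close>
  define bad where "bad = (\<Union>p\<in>\<rat>\<inter>{0..}. \<Union>q\<in>\<rat>\<inter>{p<..}. \<Union>n::nat. Lo p q (of_nat n) \<union> Up p q (of_nat n))"
  have bad: "negligible bad"
    unfolding bad_def
    by (intro negligible_countable_Union countable_image negligible_Un Lo Up countable_Int1 countable_rat)
      (auto intro!: negligible_countable_Union countable_image negligible_Un Lo Up countable_Int1 countable_rat)
  have "\<exists>l\<ge>0. g x = ennreal l \<and> (\<psi> has_real_derivative l) (at x)"
    if nb: "x \<notin> bad" and gx: "g x \<le> ennreal (K+1)" for x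
  proof -
    define l where "l = enn2real (g x)"
    have l: "g x = ennreal l" "l \<ge> 0"
      using gx by (auto simp: l_def intro!: ennreal_enn2real[symmetric] le_less_trans[OF gx])
    define n where "n = nat \<lceil>\<bar>x\<bar> + 1\<rceil>"
    have n: "x \<in> {- real n<..<real n}" by (simp add: n_def) linarith
    have nLo: "x \<notin> Lo p q n" and nUp: "x \<notin> Up p q n" if "p \<in> \<rat>" "q \<in> \<rat>" "0 \<le> p" "p < q" for p q
      using nb that by (auto simp: bad_def)
    have up: "\<exists>d>0. \<forall>a b. a < b \<and> a \<le> x \<and> x \<le> b \<and> b - a < d \<longrightarrow> \<psi> b - \<psi> a \<le> (l + e) * (b - a)" if e: "e > 0" for e
    proof -
      obtain p where p: "p \<in> \<rat>" "l < p" "p < l + e" using Rats_dense_in_real[of l "l+e"] e by auto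
      obtain q where q: "q \<in> \<rat>" "p < q" "q < l + e" using Rats_dense_in_real[of p "l+e"] p by auto
      have "g x < ennreal p" using l p by (simp add: ennreal_less_iff)
      with nUp[of p q] p q l n obtain d where d: "d > 0"
        "\<And>a b. a < b \<Longrightarrow> a \<le> x \<Longrightarrow> x \<le> b \<Longrightarrow> b - a < d \<Longrightarrow> \<psi> b - \<psi> a < q * (b - a)"
        unfolding Up_def by (fastforce simp: not_le)
      have "\<psi> b - \<psi> a \<le> (l + e) * (b - a)" if ab: "a < b" "a \<le> x" "x \<le> b" "b - a < d" for a b
      proof -
        have "\<psi> b - \<psi> a < q * (b - a)" using d(2) ab by blast
        also have "\<dots> \<le> (l + e) * (b - a)" using q ab by (intro mult_right_mono) auto
        finally show ?thesis by simp
      qed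
      then show ?thesis using d by blast
    qed
    have low: "\<exists>d>0. \<forall>a b. a < b \<and> a \<le> x \<and> x \<le> b \<and> b - a < d \<longrightarrow> (l - e) * (b - a) \<le> \<psi> b - \<psi> a" if e: "e > 0" for e
    \<comment> \<open>The exceptional sets involve only \<open>p \<ge> 0\<close>; a negative lower
      bound on the slope holds because \<open>\<psi>\<close> is increasing.\<close>
    proof (cases "l - e < 0")
      case True
      have "(l - e) * (b - a) \<le> \<psi> b - \<psi> a" if "a < b" for a b
      proof -
        have "(l - e) * (b - a) \<le> 0" using True that by (simp add: mult_nonpos_nonneg)
        then show ?thesis using lo[of a b] that by simp
      qed
      then show ?thesis by (intro exI[of _ 1]) auto
    next
      case False
      obtain p where p: "p \<in> \<rat>" "l - e < p" "p < l" using Rats_dense_in_real[of "l-e" l] e by auto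
      obtain q where q: "q \<in> \<rat>" "p < q" "q < l" using Rats_dense_in_real[of p l] p by auto
      have "ennreal q < g x" using l p q False by (simp add: ennreal_less_iff)
      with nLo[of p q] p q False n obtain d where d: "d > 0"
        "\<And>a b. a < b \<Longrightarrow> a \<le> x \<Longrightarrow> x \<le> b \<Longrightarrow> b - a < d \<Longrightarrow> p * (b - a) < \<psi> b - \<psi> a"
        unfolding Lo_def by (fastforce simp: not_le)
      have "(l - e) * (b - a) \<le> \<psi> b - \<psi> a" if ab: "a < b" "a \<le> x" "x \<le> b" "b - a < d" for a b
      proof -
        have "(l - e) * (b - a) \<le> p * (b - a)" using p ab by (intro mult_right_mono) auto
        also have "\<dots> < \<psi> b - \<psi> a" using d(2) ab by blast
        finally show ?thesis by simp
      qed
      then show ?thesis using d by blast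
    qed
    have "(\<psi> has_derivative (*) l) (at x)"
      unfolding has_derivative_at_alt
    proof (intro conjI allI impI)
      show "bounded_linear ((*) l)" by (rule bounded_linear_mult_right)
      fix e :: real assume "e > 0"
      obtain d1 where d1: "d1 > 0" "\<And>a b. a < b \<Longrightarrow> a \<le> x \<Longrightarrow> x \<le> b \<Longrightarrow> b - a < d1 \<Longrightarrow> \<psi> b - \<psi> a \<le> (l + e) * (b - a)"
        using up[OF \<open>e > 0\<close>] by blast
      obtain d2 where d2: "d2 > 0" "\<And>a b. a < b \<Longrightarrow> a \<le> x \<Longrightarrow> x \<le> b \<Longrightarrow> b - a < d2 \<Longrightarrow> (l - e) * (b - a) \<le> \<psi> b - \<psi> a"
        using low[OF \<open>e > 0\<close>] by blast
      show "\<exists>d>0. \<forall>y. norm (y - x) < d \<longrightarrow> norm (\<psi> y - \<psi> x - l * (y - x)) \<le> e * norm (y - x)"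
      proof (intro exI conjI allI impI)
        show "min d1 d2 > 0" using d1 d2 by simp
        fix y assume y: "norm (y - x) < min d1 d2"
        consider "y = x" | "x < y" | "y < x" by linarith
        then show "norm (\<psi> y - \<psi> x - l * (y - x)) \<le> e * norm (y - x)"
        proof cases
          case 2
          then show ?thesis using d1(2)[of x y] d2(2)[of x y] y by (simp add: algebra_simps abs_le_iff)
        next
          case 3
          then show ?thesis using d1(2)[of y x] d2(2)[of y x] y by (simp add: algebra_simps abs_le_iff)
        qed simp
      qed
    qed
    then show ?thesis using l by (auto simp: has_field_derivative_def)
  qed
  moreover have "AE x in lebesgue. x \<notin> bad"
    using bad by (intro AE_not_in) (simp add: negligible_iff_null_sets)
  moreover have "AE x in lebesgue. g x \<le> ennreal (K+1)" using gK by (rule AE_completion)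
  ultimately have "AE x in lebesgue. \<exists>l\<ge>0. g x = ennreal l \<and> (\<psi> has_real_derivative l) (at x)" by auto
  then show ?thesis using that[OF g gI] by blast
qed

text \<open>Adding \<open>(L + 1) * x\<close> places all slopes between 1 and
  \<open>2 * L + 1\<close>, so that the derivative exists almost everywhere and equals a density
  whose integral recovers the increments. The density is then at most \<open>C + L + 1\<close>;
  integrating it and removing the added linear term gives the claim. The hypothesis speaks only
  about points at which a derivative exists.\<close>

lemma lipschitz_deriv_bound_le:
  fixes \<phi> :: "real \<Rightarrow> real"
  assumes L: "L-lipschitz_on UNIV \<phi>" and "a \<le> b"
    and C: "AE x in lebesgue. \<forall>D. (\<phi> has_real_derivative D) (at x) \<longrightarrow> D \<le> C"
  shows "\<phi> b - \<phi> a \<le> C * (b - a)"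
proof -
  have "L \<ge> 0" using L lipschitz_on_nonneg by blast
  define \<psi> where "\<psi> = (\<lambda>x. \<phi> x + (L + 1) * x)"
  have lip: "\<bar>\<phi> y - \<phi> x\<bar> \<le> L * (y - x)" if "x \<le> y" for x y
    using lipschitz_onD[OF L, of y x] that by (auto simp: dist_real_def)
  have lo: "y - x \<le> \<psi> y - \<psi> x" if "x \<le> y" for x y
    using lip[OF that] by (auto simp: \<psi>_def algebra_simps abs_le_iff)
  have hi: "\<psi> y - \<psi> x \<le> (2 * L + 1) * (y - x)" if "x \<le> y" for x y
    using lip[OF that] by (auto simp: \<psi>_def algebra_simps abs_le_iff)
  obtain g :: "real \<Rightarrow> ennreal" where g: "g \<in> borel_measurable borel"
    "emeasure (density lborel g) {a..b} = ennreal (\<psi> b - \<psi> a)"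
    "AE x in lebesgue. \<exists>l\<ge>0. g x = ennreal l \<and> (\<psi> has_real_derivative l) (at x)"
    by (rule slope_bounded_AE_derivative[of \<psi> "2*L+1", OF lo hi])
      (assumption | rule that | simp add: \<open>a \<le> b\<close>)+
  \<comment> \<open>The sign of \<open>C + L + 1\<close> is carried along because it follows only at
    points of differentiability. An almost everywhere true statement that does not involve
    \<open>x\<close> is true, and the sign is needed to return from \<open>ennreal\<close> to the
    reals.\<close>
  have "AE x in lebesgue. g x \<le> ennreal (C + L + 1) \<and> 0 \<le> C + L + 1"
    using g(3) C
  proof eventually_elim
    case (elim x)
    then obtain l where l: "l \<ge> 0" "g x = ennreal l" "(\<psi> has_real_derivative l) (at x)" by auto
    have "((\<lambda>x. \<psi> x - (L + 1) * x) has_real_derivative (l - (L + 1))) (at x)"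
      by (auto intro!: derivative_eq_intros l)
    then have "(\<phi> has_real_derivative (l - (L + 1))) (at x)" by (simp add: \<psi>_def)
    then have "l - (L + 1) \<le> C" using elim by blast
    then have "l \<le> C + L + 1" by linarith
    then show ?case using l by (auto intro!: ennreal_leI)
  qed
  then have gC: "AE x in lebesgue. g x \<le> ennreal (C + L + 1)" and "AE x::real in lebesgue. 0 \<le> C + L + 1"
    by auto
  then have nn: "0 \<le> C + L + 1" by (simp add: eventually_const_iff ae_filter_eq_bot_iff)
  have "AE x in lborel. g x \<le> ennreal (C + L + 1)"
    using gC by (simp add: AE_completion_iff)
  then have "(\<integral>\<^sup>+x\<in>{a..b}. g x \<partial>lborel) \<le> (\<integral>\<^sup>+x. ennreal (C + L + 1) * indicator {a..b} x \<partial>lborel)"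
    by (intro nn_integral_mono_AE) (auto simp: indicator_def)
  also have "\<dots> = ennreal (C + L + 1) * ennreal (b - a)"
    using \<open>a \<le> b\<close> by (simp add: nn_integral_cmult_indicator)
  finally have "ennreal (\<psi> b - \<psi> a) \<le> ennreal ((C + L + 1) * (b - a))"
    using g nn \<open>a \<le> b\<close> by (simp add: emeasure_density ennreal_mult)
  then have "\<psi> b - \<psi> a \<le> (C + L + 1) * (b - a)"
    using nn \<open>a \<le> b\<close> by (subst (asm) ennreal_le_iff) auto
  then show ?thesis by (simp add: \<psi>_def algebra_simps)
qed

text \<open>The one-sided bound is applied to \<open>\<phi>\<close> and to its negative. Values of
  \<open>deriv\<close> at points without a derivative do no harm, since only genuine derivatives are
  passed on.\<close>

lemma lipschitz_deriv_bound:
  fixes \<phi> :: "real \<Rightarrow> real"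
  assumes L: "L-lipschitz_on UNIV \<phi>" and C: "AE x in lebesgue. \<bar>deriv \<phi> x\<bar> \<le> C"
  shows "\<bar>\<phi> b - \<phi> a\<bar> \<le> C * \<bar>b - a\<bar>"
proof -
  have *: "\<bar>\<phi> b - \<phi> a\<bar> \<le> C * (b - a)" if "a \<le> b" for a b
  proof (rule abs_leI)
    have "AE x in lebesgue. \<forall>D. (\<phi> has_real_derivative D) (at x) \<longrightarrow> D \<le> C"
      using C by eventually_elim (auto dest: DERIV_imp_deriv)
    then show "\<phi> b - \<phi> a \<le> C * (b - a)" by (rule lipschitz_deriv_bound_le[OF L that])
    have "AE x in lebesgue. \<forall>D. ((\<lambda>x. - \<phi> x) has_real_derivative D) (at x) \<longrightarrow> D \<le> C"
      using C
    proof eventually_elim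
      case (elim x)
      have "D \<le> C" if "((\<lambda>x. - \<phi> x) has_real_derivative D) (at x)" for D
        using DERIV_imp_deriv[of \<phi> "-D" x] DERIV_minus[OF that] elim by simp
      then show ?case by blast
    qed
    moreover have "L-lipschitz_on UNIV (\<lambda>x. - \<phi> x)" using L by (simp add: lipschitz_on_def dist_minus)
    ultimately have "(- \<phi> b) - (- \<phi> a) \<le> C * (b - a)"
      using lipschitz_deriv_bound_le[of L "\<lambda>x. - \<phi> x"] that by blast
    then show "- (\<phi> b - \<phi> a) \<le> C * (b - a)" by simp
  qed
  show ?thesis using *[of a b] *[of b a] by (cases "a \<le> b") (auto simp: abs_minus_commute)
qed

section \<open>Essential bounds of directional derivatives\<close>

lemma lborel_translate_null:
  fixes A :: "'a::euclidean_space set"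
  assumes "A \<in> null_sets lborel"
  shows "{x. x + c \<in> A} \<in> null_sets lborel"
proof -
  have A: "A \<in> sets borel" "emeasure lborel A = 0" using assms by auto
  have m: "{x. x + c \<in> A} \<in> sets borel"
    using measurable_sets[of "\<lambda>x. x + c" borel borel A] A by (auto simp: vimage_def)
  have "emeasure lborel A = emeasure (distr lborel borel ((+) c)) A"
    by (simp add: lborel_distr_plus)
  also have "\<dots> = emeasure lborel {x. x + c \<in> A}"
    using A by (subst emeasure_distr) (auto simp: vimage_def add.commute)
  finally show ?thesis using A m by auto
qed

text \<open>For every fixed \<open>t\<close> a translate of a null set is null, and Fubini exchanges
  the two quantifiers. A Borel null superset provides the measurability on the product.\<close>

lemma AE_line_notin_null:
  fixes A :: "'a::euclidean_space set"
  assumes A: "A \<in> null_sets lebesgue"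
  shows "AE x in lborel. AE t in lebesgue. x + t *\<^sub>R u \<notin> A"
proof -
  obtain B where B: "B \<in> null_sets lborel" "A \<subseteq> B"
    using A by (auto simp: null_sets_completion_iff2)
  have Bm[measurable]: "B \<in> sets borel" using B by auto
  have m: "{p \<in> space (lborel \<Otimes>\<^sub>M lborel). fst p + snd p *\<^sub>R u \<notin> B} \<in> sets (lborel \<Otimes>\<^sub>M (lborel :: real measure))"
    by measurable
  have "AE t in (lborel :: real measure). AE x in lborel. x + t *\<^sub>R u \<notin> B"
  proof (rule AE_I2)
    fix t :: real
    show "AE x in lborel. x + t *\<^sub>R u \<notin> B"
      using AE_not_in[OF lborel_translate_null[OF B(1), of "t *\<^sub>R u"]] by simp
  qed
  then have "AE x in lborel. AE t in (lborel :: real measure). x + t *\<^sub>R u \<notin> B"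
    using lborel_pair.AE_commute[of "\<lambda>x t. x + t *\<^sub>R u \<notin> B"] m
    by (simp add: case_prod_unfold)
  then show ?thesis
  proof eventually_elim
    case (elim x)
    have "AE t in lebesgue. x + t *\<^sub>R u \<notin> B" using elim by (rule AE_completion)
    then show ?case using B by (auto elim!: eventually_mono)
  qed
qed

text \<open>No ball is a null set, so a set of full measure is dense. This upgrades almost
  everywhere inequalities between continuous functions to all points.\<close>

lemma AE_lborel_dense:
  fixes P :: "'a::euclidean_space \<Rightarrow> bool"
  assumes "AE x in lborel. P x" "e > 0"
  obtains y where "P y" "dist x y < e"
proof -
  have "\<not> (AE y in lborel. y \<notin> ball x e)"
  proof
    assume "AE y in lborel. y \<notin> ball x e"
    then have "ball x e \<in> null_sets lborel"
      using AE_iff_null_sets[of "ball x e" lborel] by simp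
    then have "negligible (ball x e)" by (simp add: negligible_iff_null_sets null_sets_completionI)
    then show False using open_not_negligible[of "ball x e"] \<open>e > 0\<close> by simp
  qed
  then have "\<exists>y. P y \<and> y \<in> ball x e" using assms(1) by (metis (mono_tags, lifting) eventually_mono)
  then show ?thesis using that by auto
qed

text \<open>On almost every line in the coordinate direction the bound holds at almost every point,
  and the one-variable result gives the increment there. Lipschitz continuity then carries the
  inequality from these lines to every base point.\<close>

lemma nabla_ess_bound_imp_lipschitz:
  fixes g :: "real ^ 'd ^ 'n \<Rightarrow> real"
  assumes L: "L-lipschitz_on UNIV g" and C: "ess_sup_norm (nabla i j g) \<le> ereal C"
  shows "\<bar>g (X + s *\<^sub>R unit_mat i j) - g X\<bar> \<le> C * \<bar>s\<bar>"
proof -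
  let ?u = "unit_mat i j :: real ^ 'd ^ 'n"
  have L0: "L \<ge> 0" using L lipschitz_on_nonneg by blast
  have "AE x in lebesgue. \<bar>nabla i j g x\<bar> \<le> C"
    using esssup_AE[of "\<lambda>X. ereal \<bar>nabla i j g X\<bar>" lebesgue] 
  proof eventually_elim
    case (elim x)
    then have "ereal \<bar>nabla i j g x\<bar> \<le> ereal C" using C unfolding ess_sup_norm_def by (rule order_trans)
    then show ?case by simp
  qed
  then obtain A where A: "A \<in> null_sets lebesgue" "{x. \<not> \<bar>nabla i j g x\<bar> \<le> C} \<subseteq> A"
    by (auto simp: eventually_ae_filter)
  have "AE x in lborel. \<bar>g (x + s *\<^sub>R ?u) - g x\<bar> \<le> C * \<bar>s\<bar>"
    using AE_line_notin_null[OF A(1), of ?u]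
  proof eventually_elim
    case (elim x)
    define \<phi> where "\<phi> = (\<lambda>t. g (x + t *\<^sub>R ?u))"
    have "deriv \<phi> t = nabla i j g (x + t *\<^sub>R ?u)" for t
    proof -
      have "(\<phi> has_field_derivative D) (at t) \<longleftrightarrow> ((\<lambda>r. g (x + t *\<^sub>R ?u + r *\<^sub>R ?u)) has_field_derivative D) (at 0)" for D
        using DERIV_shift[of \<phi> D 0 t] by (simp add: \<phi>_def algebra_simps)
      then show ?thesis unfolding nabla_def deriv_def by simp
    qed
    then have "AE t in lebesgue. \<bar>deriv \<phi> t\<bar> \<le> C"
      using elim A(2) by (auto elim!: eventually_mono)
    moreover have "(L * norm ?u)-lipschitz_on UNIV \<phi>"
    proof (rule lipschitz_onI)
      fix a b :: real
      have "dist (\<phi> a) (\<phi> b) \<le> L * dist (x + a *\<^sub>R ?u) (x + b *\<^sub>R ?u)"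
        unfolding \<phi>_def using L by (rule lipschitz_onD) auto
      also have "dist (x + a *\<^sub>R ?u) (x + b *\<^sub>R ?u) = norm ?u * dist a b"
        by (simp add: dist_norm flip: scaleR_left_diff_distrib)
      finally show "dist (\<phi> a) (\<phi> b) \<le> L * norm ?u * dist a b" by (simp add: mult.assoc)
    qed (use L0 in simp)
    ultimately have "\<bar>\<phi> s - \<phi> 0\<bar> \<le> C * \<bar>s - 0\<bar>"
      using lipschitz_deriv_bound by blast
    then show ?case by (simp add: \<phi>_def)
  qed
  show ?thesis
  proof (rule field_le_epsilon)
    fix e :: real assume e: "e > 0"
    \<comment> \<open>Both values of \<open>g\<close> are moved to nearby points; each costs at most
      \<open>L * \<delta>\<close>, together at most \<open>e\<close>.\<close>
    define \<delta> where "\<delta> = e / (2 * L + 1)"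
    have \<delta>: "\<delta> > 0" using e L0 by (simp add: \<delta>_def)
    obtain y where y: "\<bar>g (y + s *\<^sub>R ?u) - g y\<bar> \<le> C * \<bar>s\<bar>" "dist X y < \<delta>"
      using AE_lborel_dense[OF \<open>AE x in lborel. \<bar>g (x + s *\<^sub>R ?u) - g x\<bar> \<le> C * \<bar>s\<bar>\<close> \<delta>] by metis
    have "\<bar>g (X + s *\<^sub>R ?u) - g (y + s *\<^sub>R ?u)\<bar> \<le> L * dist X y" "\<bar>g X - g y\<bar> \<le> L * dist X y"
      using lipschitz_onD[OF L, of "X + s *\<^sub>R ?u" "y + s *\<^sub>R ?u"] lipschitz_onD[OF L, of X y]
      by (auto simp: dist_real_def)
    moreover have "L * dist X y \<le> L * \<delta>" using y L0 by (intro mult_left_mono) auto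
    moreover have "2 * (L * \<delta>) \<le> e" using e L0 by (simp add: \<delta>_def field_simps)
    ultimately show "\<bar>g (X + s *\<^sub>R ?u) - g X\<bar> \<le> C * \<bar>s\<bar> + e" using y(1) by linarith
  qed
qed

section \<open>Square roots of positive definite matrices\<close>

lemma nonneg_quadratic_vanishing:
  fixes b c :: real
  assumes "\<And>t. 0 \<le> 2 * t * b + t\<^sup>2 * c"
  shows "b = 0"
proof (rule ccontr)
  assume "b \<noteq> 0"
  \<comment> \<open>For this \<open>t\<close> the linear term is
    \<open>-2 * t^2 * (abs c + 1)\<close>, which outweighs \<open>t^2 * c\<close>.\<close>
  define t where "t = - b / (\<bar>c\<bar> + 1)"
  have b: "b = - (t * (\<bar>c\<bar> + 1))" by (simp add: t_def)
  have "2 * t * b + t\<^sup>2 * c = - 2 * t\<^sup>2 * (\<bar>c\<bar> + 1) + t\<^sup>2 * c"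
    unfolding b by (simp add: power2_eq_square)
  also have "\<dots> < 0"
  proof -
    have "t\<^sup>2 > 0" using \<open>b \<noteq> 0\<close> by (simp add: t_def)
    moreover have "t\<^sup>2 * c \<le> t\<^sup>2 * (\<bar>c\<bar> + 1)" by (intro mult_left_mono) auto
    moreover have "0 < t\<^sup>2 * (\<bar>c\<bar> + 1)" using \<open>t\<^sup>2 > 0\<close> by (intro mult_pos_pos) auto
    ultimately show ?thesis by linarith
  qed
  finally show False using assms[of t] by simp
qed

text \<open>A zero \<open>v\<close> of a nonnegative quadratic form on \<open>S\<close> is a
  minimiser, so the first variation at \<open>v\<close> in every direction of \<open>S\<close>
  vanishes.\<close>

lemma semidefinite_form_zero:
  fixes f :: "'a::euclidean_space \<Rightarrow> 'a"
  assumes f: "linear f" "\<And>x y. f x \<bullet> y = x \<bullet> f y" and S: "subspace S"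
    and nn: "\<And>x. x \<in> S \<Longrightarrow> 0 \<le> x \<bullet> f x" and v: "v \<in> S" "v \<bullet> f v = 0" and w: "w \<in> S"
  shows "f v \<bullet> w = 0"
proof (rule nonneg_quadratic_vanishing[of _ "w \<bullet> f w"])
  fix t :: real
  have "0 \<le> (v + t *\<^sub>R w) \<bullet> f (v + t *\<^sub>R w)"
    using S v w by (intro nn subspace_add subspace_scale) auto
  also have "\<dots> = 2 * t * (f v \<bullet> w) + t\<^sup>2 * (w \<bullet> f w)"
    using v(2) f(2)[of v w] f(2)[of w v]
    by (simp add: linear_add[OF f(1)] linear_cmul[OF f(1)] inner_add_left inner_add_right
        inner_commute power2_eq_square algebra_simps)
  finally show "0 \<le> 2 * t * (f v \<bullet> w) + t\<^sup>2 * (w \<bullet> f w)" .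
qed

text \<open>Take \<open>v\<close> to maximise the Rayleigh quotient on the unit sphere of
  \<open>S\<close>, with maximum \<open>l\<close>. The form of \<open>l id - f\<close> is then
  nonnegative on \<open>S\<close> and zero at \<open>v\<close>, so \<open>l v - f v\<close> is
  orthogonal to \<open>S\<close>; as it also lies in \<open>S\<close>, it is zero.\<close>

lemma selfadjoint_eigenvector:
  fixes f :: "'a::euclidean_space \<Rightarrow> 'a"
  assumes f: "linear f" "\<And>x y. f x \<bullet> y = x \<bullet> f y" and S: "subspace S" "f ` S \<subseteq> S" "S \<noteq> {0}"
  obtains v l where "v \<in> S" "norm v = 1" "f v = l *\<^sub>R v"
proof -
  obtain x where x: "x \<in> S" "x \<noteq> 0" using S subspace_0 by blast
  have "x /\<^sub>R norm x \<in> S \<inter> sphere 0 1" using x S by (auto intro: subspace_scale)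
  then have "S \<inter> sphere 0 1 \<noteq> {}" by blast
  moreover have "compact (S \<inter> sphere 0 1)" using S closed_subspace by (intro closed_Int_compact) auto
  moreover have "continuous_on (S \<inter> sphere 0 1) (\<lambda>x. x \<bullet> f x)"
    by (intro continuous_on_inner continuous_on_id linear_continuous_on linear_conv_bounded_linear[THEN iffD1, OF f(1)])
  ultimately obtain v where "v \<in> S \<inter> sphere 0 1" "\<forall>y\<in>S \<inter> sphere 0 1. y \<bullet> f y \<le> v \<bullet> f v"
    using continuous_attains_sup[of "S \<inter> sphere 0 1" "\<lambda>x. x \<bullet> f x"] by blast
  then have v: "v \<in> S" "norm v = 1" "\<And>y. y \<in> S \<Longrightarrow> norm y = 1 \<Longrightarrow> y \<bullet> f y \<le> v \<bullet> f v"
    by auto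
  define l where "l = v \<bullet> f v"
  define h where "h = (\<lambda>x. l *\<^sub>R x - f x)"
  have h: "linear h" using f(1) unfolding h_def
    by (intro linear_compose_sub linear_compose_scale_right) (auto simp: linear_iff)
  have hs: "h x \<bullet> y = x \<bullet> h y" for x y by (simp add: h_def inner_diff_left inner_diff_right f(2))
  have nn: "0 \<le> x \<bullet> h x" if "x \<in> S" for x
  proof (cases "x = 0")
    case False
    define y where "y = x /\<^sub>R norm x"
    have "y \<in> S" "norm y = 1" using that S False by (auto simp: y_def intro: subspace_scale)
    then have "y \<bullet> f y \<le> l" using v by (simp add: l_def)
    have "x = norm x *\<^sub>R y" using False by (simp add: y_def)
    then have "x \<bullet> f x = (norm x)\<^sup>2 * (y \<bullet> f y)"
      by (metis (no_types, lifting) f(1) inner_scaleR_left inner_scaleR_right linear_cmul mult.assoc power2_eq_square)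
    also have "\<dots> \<le> (norm x)\<^sup>2 * l" using \<open>y \<bullet> f y \<le> l\<close> by (intro mult_left_mono) auto
    finally show ?thesis by (simp add: h_def inner_diff_right power2_norm_eq_inner mult.commute)
  qed simp
  have "v \<bullet> h v = 0" using v(2) by (simp add: h_def inner_diff_right l_def norm_eq_1)
  moreover have "h v \<in> S" using v(1) S by (auto simp: h_def intro!: subspace_diff subspace_scale)
  ultimately have "h v \<bullet> h v = 0" using semidefinite_form_zero[OF h hs S(1) nn v(1)] by blast
  then have "f v = l *\<^sub>R v" by (simp add: h_def)
  then show ?thesis using that v by blast
qed

text \<open>Induction on the dimension: self-adjointness makes the orthogonal complement of an
  eigenvector inside \<open>S\<close> invariant, and it has smaller dimension.\<close>

lemma selfadjoint_eigenbasis: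
  fixes f :: "'a::euclidean_space \<Rightarrow> 'a"
  assumes f: "linear f" "\<And>x y. f x \<bullet> y = x \<bullet> f y" and S: "subspace S" "f ` S \<subseteq> S"
  shows "\<exists>B l. finite B \<and> B \<subseteq> S \<and> (\<forall>a\<in>B. \<forall>b\<in>B. a \<bullet> b = (if a = b then 1 else 0)) \<and>
    span B = S \<and> (\<forall>b\<in>B. f b = l b *\<^sub>R b)"
  using S
proof (induction "dim S" arbitrary: S rule: less_induct)
  case less
  show ?case
  proof (cases "S = {0}")
    case True
    then show ?thesis by (intro exI[of _ "{}"]) auto
  next
    case False
    then obtain v c where v: "v \<in> S" "norm v = 1" "f v = c *\<^sub>R v"
      using selfadjoint_eigenvector[OF f less.prems] by blast
    define T where "T = {x\<in>S. x \<bullet> v = 0}"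
    have T: "subspace T" using less.prems(1)
      by (auto simp: T_def subspace_def inner_add_left)
    have "f ` T \<subseteq> T" using less.prems(2) by (auto simp: T_def f(2) v(3))
    moreover have "dim T < dim S"
    proof (rule dim_psubset)
      have "v \<notin> T" using v by (auto simp: T_def norm_eq_1)
      moreover have "T \<subseteq> S" by (auto simp: T_def)
      ultimately have "T \<subset> S" using v by blast
      then show "span T \<subset> span S" using T less.prems(1) by (simp add: span_eq_iff[THEN iffD2])
    qed
    ultimately obtain B l where B: "finite B" "B \<subseteq> T" "\<forall>a\<in>B. \<forall>b\<in>B. a \<bullet> b = (if a = b then 1 else 0)"
      "span B = T" "\<forall>b\<in>B. f b = l b *\<^sub>R b"
      using less.hyps[of T] T by blast
    have vB: "v \<notin> B" using B(2) v by (auto simp: T_def norm_eq_1)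
    show ?thesis
    proof (intro exI[of _ "insert v B"] exI[of _ "l(v := c)"] conjI)
      show "insert v B \<subseteq> S" using B v by (auto simp: T_def)
      show "\<forall>a\<in>insert v B. \<forall>b\<in>insert v B. a \<bullet> b = (if a = b then 1 else 0)"
        using B v by (auto simp: T_def norm_eq_1 inner_commute)
      show "span (insert v B) = S"
      proof
        show "span (insert v B) \<subseteq> S"
          using \<open>insert v B \<subseteq> S\<close> less.prems(1) by (rule span_minimal)
        show "S \<subseteq> span (insert v B)"
        proof
          fix x assume "x \<in> S"
          then have "x - (x \<bullet> v) *\<^sub>R v \<in> T"
            using v less.prems(1) by (auto simp: T_def norm_eq_1 inner_diff_left intro!: subspace_diff subspace_scale)
          then show "x \<in> span (insert v B)" using B(4) by (auto simp: span_insert)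
        qed
      qed
    qed (use B v vB in auto)
  qed
qed

section \<open>Existence and uniqueness of the symmetric square root\<close>

lemma symmetric_matrix_inner:
  fixes A :: "real ^ 'k ^ 'k"
  assumes "transpose A = A"
  shows "(A *v x) \<bullet> y = x \<bullet> (A *v y)"
  by (metis assms dot_lmul_matrix transpose_matrix_vector)

lemma symmetric_matrixI:
  fixes A :: "real ^ 'k ^ 'k"
  assumes "\<And>x y. (A *v x) \<bullet> y = x \<bullet> (A *v y)"
  shows "transpose A = A"
proof -
  have "transpose A *v x = A *v x" for x
  proof (rule vector_eq_rdot[THEN iffD1], intro allI)
    fix z show "(transpose A *v x) \<bullet> z = (A *v x) \<bullet> z"
      by (simp add: assms transpose_matrix_vector dot_lmul_matrix)
  qed
  then show ?thesis by (simp add: matrix_eq)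
qed

lemma psd_sqrt_exists:
  fixes A :: "real ^ 'k ^ 'k"
  assumes A: "transpose A = A" "\<And>x. 0 \<le> x \<bullet> (A *v x)"
  shows "\<exists>B. transpose B = B \<and> (\<forall>x. 0 \<le> x \<bullet> (B *v x)) \<and> B ** B = A"
proof -
  obtain N l where N: "finite N" "\<forall>a\<in>N. \<forall>b\<in>N. a \<bullet> b = (if a = b then 1 else 0)"
    "span N = UNIV" "\<forall>b\<in>N. A *v b = l b *\<^sub>R b"
    using selfadjoint_eigenbasis[of "(*v) A" UNIV] symmetric_matrix_inner[OF A(1)] by auto
  have l0: "0 \<le> l b" if "b \<in> N" for b
    using A(2)[of b] N(2,4) that by simp
  \<comment> \<open>In the orthonormal eigenbasis the root multiplies each eigenvector by the square
    root of its eigenvalue.\<close>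
  define f where "f = (\<lambda>x. \<Sum>b\<in>N. (sqrt (l b) * (b \<bullet> x)) *\<^sub>R b)"
  have lin: "linear f" unfolding f_def
    by (rule linearI) (simp_all add: inner_add_right algebra_simps sum.distrib scaleR_sum_right)
  have inn: "y \<bullet> f x = (\<Sum>b\<in>N. sqrt (l b) * (b \<bullet> x) * (b \<bullet> y))" for x y
    by (simp add: f_def inner_sum_right inner_commute)
  have fb: "f b = sqrt (l b) *\<^sub>R b" if "b \<in> N" for b
  proof -
    have "f b = (\<Sum>c\<in>N. if c = b then sqrt (l b) *\<^sub>R b else 0)"
      unfolding f_def using N(2) that by (intro sum.cong) auto
    then show ?thesis using that N(1) by simp
  qed
  define B where "B = matrix f"
  have B: "B *v x = f x" for x using lin by (simp add: B_def matrix_works)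
  have "f (f x) = A *v x" for x
  proof (rule linear_eq_on[of "\<lambda>x. f (f x)" "(*v) A" x N])
    show "linear (\<lambda>x. f (f x))" using linear_compose[OF lin lin] by (simp add: o_def)
    show "f (f b) = A *v b" if "b \<in> N" for b
      using that N(4) l0 by (simp add: fb linear_cmul[OF lin])
  qed (use N in auto)
  then have "B ** B = A" by (simp add: matrix_eq B flip: matrix_vector_mul_assoc)
  moreover have "transpose B = B"
    by (rule symmetric_matrixI) (simp add: B inn inner_commute[of "f _"] ac_simps)
  moreover have "0 \<le> x \<bullet> (B *v x)" for x
    unfolding B inn using l0 by (intro sum_nonneg) (simp add: mult.assoc)
  ultimately show ?thesis by blast
qed

text \<open>If the form of \<open>B\<close> vanishes at \<open>x\<close>, then \<open>B *v x\<close>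
  is zero, and so the form of the square vanishes at \<open>x\<close> as well.\<close>

lemma psd_sqrt_pos:
  fixes B :: "real ^ 'k ^ 'k"
  assumes B: "transpose B = B" "\<And>x. 0 \<le> x \<bullet> (B *v x)"
    and pd: "\<And>x. x \<noteq> 0 \<Longrightarrow> 0 < x \<bullet> ((B ** B) *v x)" and "x \<noteq> 0"
  shows "0 < x \<bullet> (B *v x)"
proof (rule ccontr)
  assume "\<not> 0 < x \<bullet> (B *v x)"
  then have "x \<bullet> (B *v x) = 0" using B(2)[of x] by simp
  then have "(B *v x) \<bullet> (B *v x) = 0"
    using semidefinite_form_zero[of "(*v) B" UNIV x] symmetric_matrix_inner[OF B(1)] B(2) by auto
  then have "x \<bullet> ((B ** B) *v x) = 0" by (simp flip: matrix_vector_mul_assoc)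
  then show False using pd[OF \<open>x \<noteq> 0\<close>] by simp
qed

text \<open>An eigenvector \<open>b\<close> of \<open>D = B - C\<close> with eigenvalue \<open>l\<close> satisfies
  \<open>0 = b \<bullet> (B\<^sup>2 - C\<^sup>2) b = l (b \<bullet> B b + b \<bullet> C b)\<close>, so \<open>l = 0\<close>.\<close>

lemma psd_sqrt_unique:
  fixes B C :: "real ^ 'k ^ 'k"
  assumes B: "transpose B = B" "\<And>x. 0 \<le> x \<bullet> (B *v x)"
    and C: "transpose C = C" "\<And>x. 0 \<le> x \<bullet> (C *v x)" and eq: "B ** B = C ** C"
    and pd: "\<And>x. x \<noteq> 0 \<Longrightarrow> 0 < x \<bullet> ((B ** B) *v x)"
  shows "B = C"
proof -
  define D where "D = B - C"
  have Ds: "(D *v x) \<bullet> y = x \<bullet> (D *v y)" for x y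
    using symmetric_matrix_inner[OF B(1)] symmetric_matrix_inner[OF C(1)]
    by (simp add: D_def matrix_vector_mult_diff_rdistrib inner_diff_left inner_diff_right)
  obtain N l where N: "finite N" "\<forall>a\<in>N. \<forall>b\<in>N. a \<bullet> b = (if a = b then 1 else 0)"
    "span N = UNIV" "\<forall>b\<in>N. D *v b = l b *\<^sub>R b"
    using selfadjoint_eigenbasis[of "(*v) D" UNIV] Ds by auto
  have "D *v b = 0" if b: "b \<in> N" for b
  proof -
    have nz: "b \<noteq> 0" using N(2) b by fastforce
    have "D *v x = B *v x - C *v x" for x by (simp add: D_def matrix_vector_mult_diff_rdistrib)
    \<comment> \<open>The factors \<open>B\<close> and \<open>C\<close> are not known to commute, so
      the difference of squares is split as B(B - C) + (B - C)C.\<close>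
    then have "B *v (D *v b) + D *v (C *v b) = (B ** B) *v b - (C ** C) *v b"
      by (simp add: matrix_vector_mult_diff_distrib flip: matrix_vector_mul_assoc)
    then have "0 = b \<bullet> (B *v (D *v b)) + b \<bullet> (D *v (C *v b))"
      by (simp add: eq flip: inner_add_right)
    also have "\<dots> = l b * (b \<bullet> (B *v b)) + l b * (b \<bullet> (C *v b))"
      using N(4) b by (simp add: matrix_vector_mult_scaleR flip: Ds)
    finally have "l b * (b \<bullet> (B *v b) + b \<bullet> (C *v b)) = 0" by (simp add: algebra_simps)
    moreover have "0 < b \<bullet> (B *v b)" using psd_sqrt_pos[OF B pd nz] .
    moreover have "0 \<le> b \<bullet> (C *v b)" using C(2) .
    ultimately have "l b = 0" by simp
    then show ?thesis using N(4) b by simp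
  qed
  then have "D *v x = 0 *v x" for x
    using linear_eq_on[of "(*v) D" "(*v) 0" x N] N(3) by simp
  then have "D = 0" by (simp only: matrix_eq) simp
  then show ?thesis by (simp add: D_def)
qed

text \<open>Existence and uniqueness of the root give the definite description behind
  \<open>mat_sqrt\<close> its meaning; a positive definite root has trivial kernel and is therefore
  invertible.\<close>

lemma mat_sqrt_spd:
  fixes A :: "real ^ 'k ^ 'k"
  assumes A: "sym_pos_def A"
  shows "transpose (mat_sqrt A) = mat_sqrt A" "mat_sqrt A ** mat_sqrt A = A" "invertible (mat_sqrt A)"
proof -
  have pd: "0 < x \<bullet> (A *v x)" if "x \<noteq> 0" for x using A that by (auto simp: sym_pos_def_def)
  have nn: "0 \<le> x \<bullet> (A *v x)" for x using pd[of x] by (cases "x = 0") auto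
  have "\<exists>!B. transpose B = B \<and> (\<forall>x. 0 \<le> x \<bullet> (B *v x)) \<and> B ** B = A"
    using psd_sqrt_exists[of A] A nn psd_sqrt_unique pd by (smt (verit) sym_pos_def_def)
  from theI'[OF this] have *: "transpose (mat_sqrt A) = mat_sqrt A \<and> (\<forall>x. 0 \<le> x \<bullet> (mat_sqrt A *v x)) \<and>
    mat_sqrt A ** mat_sqrt A = A"
    unfolding mat_sqrt_def .
  then show "transpose (mat_sqrt A) = mat_sqrt A" "mat_sqrt A ** mat_sqrt A = A" by auto
  have "x = 0" if "mat_sqrt A *v x = 0" for x
    using psd_sqrt_pos[of "mat_sqrt A" x] * pd that by force
  then show "invertible (mat_sqrt A)"
    by (simp add: invertible_left_inverse matrix_left_invertible_ker)
qed

section \<open>Frobenius norms of products and of whitened directions\<close>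

lemma norm_transpose: "norm (transpose A) = norm (A :: real ^ 'd ^ 'n)"
proof -
  have "(\<Sum>i\<in>UNIV. \<Sum>j\<in>UNIV. (A $ j $ i)\<^sup>2) = (\<Sum>i\<in>UNIV. \<Sum>j\<in>UNIV. (A $ i $ j)\<^sup>2)"
    by (rule sum.swap)
  then show ?thesis by (simp add: norm_vec_def L2_set_def transpose_def sum_nonneg)
qed

text \<open>The squared Frobenius norm is the sum of the squared column norms, and left
  multiplication acts on each column separately.\<close>

lemma norm_matrix_mult_le:
  fixes A :: "real ^ 'n ^ 'm" and U :: "real ^ 'd ^ 'n"
  shows "norm (A ** U) \<le> spectral_norm A * norm U"
proof -
  have bl: "bounded_linear ((*v) A)" by simp
  have nn: "0 \<le> spectral_norm A" unfolding spectral_norm_def by (rule onorm_pos_le[OF bl])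
  have sq: "(norm V)\<^sup>2 = (\<Sum>j\<in>UNIV. (norm (column j V))\<^sup>2)" for V :: "real ^ 'd ^ 'k"
  proof -
    have "(norm V)\<^sup>2 = (norm (transpose V))\<^sup>2" by (simp add: norm_transpose)
    also have "\<dots> = (\<Sum>j\<in>UNIV. (norm (transpose V $ j))\<^sup>2)"
      by (simp add: norm_vec_def[of "transpose V"] L2_set_def sum_nonneg)
    also have "\<dots> = (\<Sum>j\<in>UNIV. (norm (column j V))\<^sup>2)"
      by (simp add: transpose_def column_def)
    finally show ?thesis .
  qed
  have "column j (A ** U) = A *v column j U" for j
    by (simp add: column_def matrix_matrix_mult_def matrix_vector_mult_def vec_eq_iff)
  then have "(norm (A ** U))\<^sup>2 = (\<Sum>j\<in>UNIV. (norm (A *v column j U))\<^sup>2)" by (simp add: sq)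
  also have "\<dots> \<le> (\<Sum>j\<in>UNIV. (spectral_norm A * norm (column j U))\<^sup>2)"
    unfolding spectral_norm_def by (intro sum_mono power_mono onorm[OF bl]) auto
  also have "\<dots> = (spectral_norm A * norm U)\<^sup>2"
    by (simp add: power_mult_distrib sq sum_distrib_left)
  finally show ?thesis by (rule power2_le_imp_le) (simp add: nn)
qed

lemma matrix_inv_inverse:
  fixes A :: "real ^ 'k ^ 'k"
  assumes "invertible A"
  shows "A ** matrix_inv A = mat 1" "matrix_inv A ** A = mat 1"
proof -
  have "A ** matrix_inv A = mat 1 \<and> matrix_inv A ** A = mat 1"
    unfolding matrix_inv_def using assms unfolding invertible_def by (rule someI_ex)
  then show "A ** matrix_inv A = mat 1" "matrix_inv A ** A = mat 1" by auto
qed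

lemma matrix_inv_unique:
  fixes A B :: "real ^ 'k ^ 'k"
  assumes "A ** B = mat 1"
  shows "matrix_inv A = B"
proof -
  have "invertible A" using assms by (auto simp: invertible_right_inverse)
  then have "matrix_inv A ** A = mat 1" by (rule matrix_inv_inverse)
  then show ?thesis by (metis assms matrix_mul_assoc matrix_mul_lid matrix_mul_rid)
qed

lemma mat_sqrt_inv:
  fixes A :: "real ^ 'k ^ 'k"
  assumes A: "sym_pos_def A"
  defines "R \<equiv> matrix_inv (mat_sqrt A)"
  shows "transpose R = R" "R ** R = matrix_inv A" "R ** mat_sqrt A = mat 1" "mat_sqrt A ** R = mat 1"
proof -
  note q = mat_sqrt_spd[OF A]
  show 1: "R ** mat_sqrt A = mat 1" and 2: "mat_sqrt A ** R = mat 1"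
    unfolding R_def using q(3) by (simp_all add: matrix_inv_inverse)
  have "transpose (R ** mat_sqrt A) = mat 1" by (simp add: 1 transpose_mat)
  then have "mat_sqrt A ** transpose R = mat 1" by (simp add: matrix_transpose_mul q)
  then show "transpose R = R" using matrix_inv_unique R_def by metis
  have "A ** (R ** R) = mat_sqrt A ** (mat_sqrt A ** R) ** R" by (metis q(2) matrix_mul_assoc)
  then have "A ** (R ** R) = mat 1" by (simp add: 2)
  then show "R ** R = matrix_inv A" by (simp add: matrix_inv_unique)
qed

text \<open>The product has rank one: its norm is that of column \<open>i\<close> of the first root
  times that of row \<open>j\<close> of the second. By symmetry of the roots the squared norms are
  diagonal entries of the inverse matrices. This is the origin of the diagonal factors in the
  coordinate bounds.\<close>

lemma norm_sandwich_unit_mat: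
  fixes \<Psi> :: "real ^ 'n ^ 'n" and \<Sigma> :: "real ^ 'd ^ 'd"
  assumes "sym_pos_def \<Psi>" "sym_pos_def \<Sigma>"
  shows "norm (matrix_inv (mat_sqrt \<Psi>) ** unit_mat i j ** matrix_inv (mat_sqrt \<Sigma>))
    = sqrt (matrix_inv \<Psi> $ i $ i * matrix_inv \<Sigma> $ j $ j)"
proof -
  define R where "R = matrix_inv (mat_sqrt \<Psi>)"
  define Q where "Q = matrix_inv (mat_sqrt \<Sigma>)"
  have R: "transpose R = R" "R ** R = matrix_inv \<Psi>" using mat_sqrt_inv[OF assms(1)] by (auto simp: R_def)
  have Q: "transpose Q = Q" "Q ** Q = matrix_inv \<Sigma>" using mat_sqrt_inv[OF assms(2)] by (auto simp: Q_def)
  have Rs: "R $ a $ b = R $ b $ a" for a b using R(1) by (simp add: transpose_def vec_eq_iff)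
  have Qs: "Q $ a $ b = Q $ b $ a" for a b using Q(1) by (simp add: transpose_def vec_eq_iff)
  have un: "unit_mat i j $ k $ l = (if k = i \<and> l = j then 1 else 0)" for k l
    by (simp add: unit_mat_def axis_def)
  have Ri: "(R ** unit_mat i j) $ a $ l = (if l = j then R $ a $ i else 0)" for a l
    by (simp add: matrix_matrix_mult_def un if_distrib cong: if_cong)
  have e: "(R ** unit_mat i j ** Q) $ a $ b = R $ a $ i * Q $ j $ b" for a b
    by (simp add: matrix_matrix_mult_def[of "R ** unit_mat i j"] Ri if_distrib[of "\<lambda>x. x * _"] cong: if_cong)
  have "(norm (R ** unit_mat i j ** Q))\<^sup>2 = (\<Sum>a\<in>UNIV. \<Sum>b\<in>UNIV. (R $ a $ i * Q $ j $ b)\<^sup>2)"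
    by (simp add: norm_vec_def L2_set_def e sum_nonneg)
  also have "\<dots> = (\<Sum>a\<in>UNIV. (R $ a $ i)\<^sup>2) * (\<Sum>b\<in>UNIV. (Q $ j $ b)\<^sup>2)"
    by (simp add: sum_product power_mult_distrib)
  also have "(\<Sum>a\<in>UNIV. (R $ a $ i)\<^sup>2) = matrix_inv \<Psi> $ i $ i"
    by (simp add: matrix_matrix_mult_def power2_eq_square Rs flip: R(2))
  also have "(\<Sum>b\<in>UNIV. (Q $ j $ b)\<^sup>2) = matrix_inv \<Sigma> $ j $ j"
    by (simp add: matrix_matrix_mult_def power2_eq_square Qs flip: Q(2))
  finally show ?thesis unfolding R_def Q_def by (metis norm_ge_zero real_sqrt_abs abs_of_nonneg)
qed

text \<open>Transposition turns the right factor into a left factor, to which the bound for left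
  multiplication applies again.\<close>

lemma norm_sandwich_le:
  fixes U :: "real ^ 'd ^ 'n" and Q :: "real ^ 'd ^ 'd" and R :: "real ^ 'n ^ 'n"
  assumes "transpose Q = Q"
  shows "norm (R ** U ** Q) \<le> spectral_norm R * spectral_norm Q * norm U"
proof -
  have "norm (R ** U ** Q) = norm (Q ** transpose (R ** U))"
    by (metis assms matrix_transpose_mul norm_transpose)
  also have "\<dots> \<le> spectral_norm Q * norm (R ** U)"
    using norm_matrix_mult_le[of Q "transpose (R ** U)"] by (simp add: norm_transpose)
  also have "\<dots> \<le> spectral_norm Q * (spectral_norm R * norm U)"
  proof (intro mult_left_mono norm_matrix_mult_le)
    show "0 \<le> spectral_norm Q" unfolding spectral_norm_def by (rule onorm_pos_le) simp
  qed
  finally show ?thesis by (simp add: mult_ac)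
qed

section \<open>The standard Gaussian measure\<close>

text \<open>An explicit product density on an arbitrary Euclidean space lets the semigroup argument
  run without coordinates; the law of the random matrix is identified with it once.\<close>

definition std_gauss :: "'a::euclidean_space measure" where
  "std_gauss = density lborel (\<lambda>z. ennreal (\<Prod>b\<in>Basis. std_normal_density (z \<bullet> b)))"

lemma sets_std_gauss[simp, measurable_cong]: "sets std_gauss = sets borel"
  by (simp add: std_gauss_def)

lemma space_std_gauss[simp]: "space std_gauss = UNIV"
  by (simp add: std_gauss_def)

text \<open>Tonelli for integrands that factor over the coordinates. It yields the total mass, the
  measure of boxes and the exponential moments.\<close>

lemma nn_integral_std_gauss_prod:
  assumes [measurable]: "\<And>b. b \<in> Basis \<Longrightarrow> f b \<in> borel_measurable borel"
  shows "(\<integral>\<^sup>+z. (\<Prod>b\<in>Basis. f b (z \<bullet> b)) \<partial>(std_gauss :: 'a::euclidean_space measure))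
    = (\<Prod>b\<in>(Basis :: 'a set). \<integral>\<^sup>+x. ennreal (std_normal_density x) * f b x \<partial>lborel)"
proof -
  have "(\<integral>\<^sup>+z. (\<Prod>b\<in>Basis. f b (z \<bullet> b)) \<partial>(std_gauss :: 'a measure))
    = (\<integral>\<^sup>+z. ennreal (\<Prod>b\<in>Basis. std_normal_density (z \<bullet> b)) * (\<Prod>b\<in>Basis. f b (z \<bullet> b)) \<partial>(lborel :: 'a measure))"
    unfolding std_gauss_def by (rule nn_integral_density) measurable
  also have "\<dots> = (\<integral>\<^sup>+z. (\<Prod>b\<in>Basis. ennreal (std_normal_density (z \<bullet> b)) * f b (z \<bullet> b)) \<partial>(lborel :: 'a measure))"
    by (simp add: prod_ennreal[symmetric] prod.distrib)
  also have "\<dots> = (\<Prod>b\<in>(Basis :: 'a set). \<integral>\<^sup>+x. ennreal (std_normal_density x) * f b x \<partial>lborel)"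
    by (rule nn_integral_lborel_prod) auto
  finally show ?thesis .
qed

lemma nn_integral_std_normal_density: "(\<integral>\<^sup>+x. ennreal (std_normal_density x) \<partial>lborel) = 1"
proof -
  interpret prob_space "density lborel std_normal_density" by (rule prob_space_normal_density) simp
  show ?thesis using emeasure_space_1 by (simp add: emeasure_density)
qed

lemma prob_space_std_gauss: "prob_space (std_gauss :: 'a::euclidean_space measure)"
proof (rule prob_spaceI)
  show "emeasure (std_gauss :: 'a measure) (space std_gauss) = 1"
    using nn_integral_std_gauss_prod[of "\<lambda>_::'a. \<lambda>_. 1"]
    by (simp add: nn_integral_std_normal_density)
qed

lemma unit_mat_bij_Basis:
  "bij_betw (\<lambda>(i, j). unit_mat i j) UNIV (Basis :: (real ^ 'd ^ 'n) set)"
  unfolding bij_betw_def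
proof
  show "inj (\<lambda>(i, j). unit_mat i j :: real ^ 'd ^ 'n)"
    by (auto simp: inj_def unit_mat_def axis_eq_axis)
  show "range (\<lambda>(i, j). unit_mat i j) = (Basis :: (real ^ 'd ^ 'n) set)"
    by (auto simp: unit_mat_def Basis_vec_def image_iff)
qed

lemma inner_unit_mat: "(X :: real ^ 'd ^ 'n) \<bullet> unit_mat i j = X $ i $ j"
  by (simp add: unit_mat_def inner_axis)

text \<open>Open boxes form an intersection-stable generator on which both measures factor over the
  entries: the law of \<open>Z\<close> by independence, \<open>std_gauss\<close> by Tonelli.\<close>

lemma std_normal_matrix_distr:
  fixes Z :: "'w \<Rightarrow> real ^ 'd ^ 'n"
  assumes Z: "std_normal_matrix M Z"
  shows "Z \<in> borel_measurable M" "distr M borel Z = std_gauss"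
proof -
  interpret prob_space M using Z by (simp add: std_normal_matrix_def)
  define X where "X = (\<lambda>p \<omega>. Z \<omega> $ fst p $ snd p)"
  have ind: "indep_vars (\<lambda>_. borel) X UNIV"
    using Z by (simp add: std_normal_matrix_def X_def case_prod_unfold)
  have dX: "distributed M lborel (X p) std_normal_density" for p
    using Z by (simp add: std_normal_matrix_def X_def)
  have Xm[measurable]: "X p \<in> borel_measurable M" for p
    using distributed_measurable[OF dX] by simp
  have Zb: "Z \<omega> \<bullet> (case p of (i, j) \<Rightarrow> unit_mat i j) = X p \<omega>" for p \<omega>
    by (cases p) (simp add: inner_unit_mat X_def)
  show Zm[measurable]: "Z \<in> borel_measurable M"
  proof (subst borel_measurable_euclidean_space, intro ballI)
    fix b :: "real ^ 'd ^ 'n" assume "b \<in> Basis"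
    then obtain p where "b = (case p of (i, j) \<Rightarrow> unit_mat i j)"
      using unit_mat_bij_Basis by (metis (no_types) bij_betw_imp_surj_on imageE)
    then show "(\<lambda>x. Z x \<bullet> b) \<in> borel_measurable M" by (simp only: Zb Xm)
  qed
  show "distr M borel Z = std_gauss"
  proof (rule measure_eqI_generator_eq)
    let ?E = "range (\<lambda>(a, b). box a b::(real ^ 'd ^ 'n) set)"
    show "Int_stable ?E" by (auto simp: Int_stable_def box_Int_box)
    show "?E \<subseteq> Pow UNIV" "sets (distr M borel Z) = sigma_sets UNIV ?E"
      "sets (std_gauss :: (real ^ 'd ^ 'n) measure) = sigma_sets UNIV ?E"
      by (simp_all add: borel_eq_box)
    let ?A = "\<lambda>n::nat. box (- (real n *\<^sub>R One)) (real n *\<^sub>R One) :: (real ^ 'd ^ 'n) set"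
    show "range ?A \<subseteq> ?E" "(\<Union>i. ?A i) = UNIV" unfolding UN_box_eq_UNIV by auto
    show "emeasure (distr M borel Z) (?A i) \<noteq> \<infinity>" for i
      by (simp add: emeasure_distr emeasure_eq_measure)
    fix B assume "B \<in> ?E"
    then obtain l u where B: "B = box l u" by auto
    define J where "J = (\<lambda>b::real ^ 'd ^ 'n. {l \<bullet> b<..<u \<bullet> b})"
    let ?\<eta> = "\<lambda>p::'n \<times> 'd. case p of (i, j) \<Rightarrow> (unit_mat i j :: real ^ 'd ^ 'n)"
    have "emeasure (std_gauss :: (real ^ 'd ^ 'n) measure) B = (\<integral>\<^sup>+z. indicator B z \<partial>std_gauss)"
      using B by simp
    also have "\<dots> = (\<integral>\<^sup>+z. (\<Prod>b\<in>Basis. indicator (J b) (z \<bullet> b)) \<partial>std_gauss)"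
      by (intro nn_integral_cong) (auto simp: B J_def box_def indicator_def)
    also have "\<dots> = (\<Prod>b\<in>Basis. \<integral>\<^sup>+x. ennreal (std_normal_density x) * indicator (J b) x \<partial>lborel)"
      by (rule nn_integral_std_gauss_prod) (simp add: J_def)
    also have "\<dots> = (\<Prod>p\<in>UNIV. \<integral>\<^sup>+x. ennreal (std_normal_density x) * indicator (J (?\<eta> p)) x \<partial>lborel)"
      by (rule prod.reindex_bij_betw[OF unit_mat_bij_Basis, symmetric])
    also have "\<dots> = (\<Prod>p\<in>UNIV. ennreal (prob (X p -` J (?\<eta> p) \<inter> space M)))"
      by (intro prod.cong refl) (simp add: distributed_emeasure[OF dX] J_def flip: emeasure_eq_measure)
    also have "\<dots> = ennreal (\<Prod>p\<in>UNIV. prob (X p -` J (?\<eta> p) \<inter> space M))"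
      by (rule prod_ennreal) simp
    also have "(\<Prod>p\<in>UNIV. prob (X p -` J (?\<eta> p) \<inter> space M)) = prob (\<Inter>p\<in>UNIV. X p -` J (?\<eta> p) \<inter> space M)"
      by (rule indep_varsD_finite[OF ind, symmetric]) (auto simp: J_def)
    also have "(\<Inter>p\<in>UNIV. X p -` J (?\<eta> p) \<inter> space M) = Z -` B \<inter> space M"
    proof -
      have "z \<in> B \<longleftrightarrow> (\<forall>p. z \<bullet> ?\<eta> p \<in> J (?\<eta> p))" for z
      proof -
        have "range ?\<eta> = Basis" using unit_mat_bij_Basis by (rule bij_betw_imp_surj_on)
        then have "z \<in> B \<longleftrightarrow> (\<forall>b\<in>range ?\<eta>. z \<bullet> b \<in> J b)"
          by (simp add: B box_def J_def)
        then show ?thesis by blast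
      qed
      then have "Z \<omega> \<in> B \<longleftrightarrow> (\<forall>p. X p \<omega> \<in> J (?\<eta> p))" for \<omega> by (simp only: Zb)
      then show ?thesis by auto
    qed
    also have "ennreal (prob (Z -` B \<inter> space M)) = emeasure (distr M borel Z) B"
      using B by (simp add: emeasure_distr emeasure_eq_measure)
    finally show "emeasure (distr M borel Z) B = emeasure std_gauss B" by simp
  qed
qed

text \<open>The inner product with \<open>Z\<close> is a sum of independent centred normals, hence
  normal with standard deviation \<open>norm v\<close>, and its first absolute moment is known. The
  random matrix serves here only as a source of independent coordinates for a statement about
  \<open>std_gauss\<close>.\<close>

lemma std_normal_matrix_abs_inner:
  fixes Z :: "'w \<Rightarrow> real ^ 'd ^ 'n"
  assumes Z: "std_normal_matrix M Z"
  shows "(\<integral>z. \<bar>v \<bullet> z\<bar> \<partial>std_gauss) = sqrt (2 / pi) * norm (v :: real ^ 'd ^ 'n)"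
proof (cases "v = 0")
  case False
  interpret prob_space M using Z by (simp add: std_normal_matrix_def)
  note Zm[measurable] = std_normal_matrix_distr(1)[OF Z]
  define X where "X = (\<lambda>p \<omega>. Z \<omega> $ fst p $ snd p)"
  define c where "c = (\<lambda>p. v $ fst p $ snd p)"
  \<comment> \<open>Entries with zero coefficient are left out, since the sum rule for normals
    requires positive standard deviations.\<close>
  define I where "I = {p. c p \<noteq> 0}"
  have ind: "indep_vars (\<lambda>_. borel) X UNIV"
    using Z by (simp add: std_normal_matrix_def X_def case_prod_unfold)
  have "indep_vars (\<lambda>_. borel) (\<lambda>p \<omega>. c p * X p \<omega>) I"
    by (rule indep_vars_subset[OF indep_vars_compose2[OF ind]]) auto
  moreover have "distributed M lborel (\<lambda>\<omega>. c p * X p \<omega>) (normal_density 0 \<bar>c p\<bar>)" if "p \<in> I" for p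
    using normal_density_affine[of "X p" 0 1 "c p" 0] Z that
    by (simp add: std_normal_matrix_def X_def I_def)
  moreover have "I \<noteq> {}"
    using False by (auto simp: I_def c_def vec_eq_iff)
  ultimately have "distributed M lborel (\<lambda>\<omega>. \<Sum>p\<in>I. c p * X p \<omega>) (normal_density (\<Sum>p\<in>I. 0) (sqrt (\<Sum>p\<in>I. \<bar>c p\<bar>\<^sup>2)))"
    by (intro sum_indep_normal) (auto simp: I_def)
  moreover have sumI: "(\<Sum>p\<in>I. c p * w p) = (\<Sum>i\<in>UNIV. \<Sum>j\<in>UNIV. v $ i $ j * w (i, j))" for w :: "'n \<times> 'd \<Rightarrow> real"
  proof -
    have "(\<Sum>p\<in>I. c p * w p) = (\<Sum>p\<in>UNIV. c p * w p)"
      by (rule sum.mono_neutral_left) (auto simp: I_def)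
    then show ?thesis by (simp add: c_def sum.cartesian_product case_prod_unfold)
  qed
  have "(\<Sum>p\<in>I. c p * X p \<omega>) = v \<bullet> Z \<omega>" for \<omega>
    by (simp add: sumI inner_vec_def X_def)
  moreover have "sqrt (\<Sum>p\<in>I. \<bar>c p\<bar>\<^sup>2) = norm v"
    using sumI[of c] by (simp add: norm_eq_sqrt_inner inner_vec_def c_def power2_eq_square)
  ultimately have d: "distributed M lborel (\<lambda>\<omega>. v \<bullet> Z \<omega>) (normal_density 0 (norm v))" by simp
  have "(\<integral>z. \<bar>v \<bullet> z\<bar> \<partial>std_gauss) = (\<integral>\<omega>. \<bar>v \<bullet> Z \<omega>\<bar> \<partial>M)"
    by (subst std_normal_matrix_distr(2)[OF Z, symmetric]) (simp add: integral_distr)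
  also have "\<dots> = (\<integral>x. normal_density 0 (norm v) x * \<bar>x\<bar> \<partial>lborel)"
    by (rule distributed_integral[OF d, symmetric]) auto
  also have "\<dots> = sqrt (2 / pi) * norm v"
    using integral_normal_moment_abs_odd[of "norm v" 0 0] False by simp
  finally show ?thesis .
qed simp

section \<open>Shifts, exponential moments and symmetry of the Gaussian measure\<close>

lemma std_gauss_density_eq:
  "(\<Prod>b\<in>Basis. std_normal_density ((z :: 'a::euclidean_space) \<bullet> b))
    = (1 / sqrt (2 * pi)) ^ DIM('a) * exp (- (z \<bullet> z) / 2)"
proof -
  have "(\<Prod>b\<in>Basis. std_normal_density (z \<bullet> b))
      = (\<Prod>b\<in>(Basis::'a set). (1 / sqrt (2 * pi)) * exp (- (z \<bullet> b)\<^sup>2 / 2))"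
    by (simp add: std_normal_density_def)
  also have "\<dots> = (1 / sqrt (2 * pi)) ^ DIM('a) * exp (\<Sum>b\<in>Basis. - (z \<bullet> b)\<^sup>2 / 2)"
    by (simp only: prod.distrib prod_constant exp_sum finite_Basis)
  also have "(\<Sum>b\<in>Basis. - (z \<bullet> b)\<^sup>2 / 2) = - (z \<bullet> z) / 2"
    by (simp add: euclidean_inner[of z z] sum_negf power2_eq_square flip: sum_divide_distrib)
  finally show ?thesis .
qed

lemma integral_std_gauss:
  assumes [measurable]: "f \<in> borel_measurable borel"
  shows "(\<integral>z. f z \<partial>std_gauss) =
    (\<integral>z. (1 / sqrt (2 * pi)) ^ DIM('a) * exp (- (z \<bullet> z) / 2) * f z \<partial>(lborel :: 'a::euclidean_space measure))"
  unfolding std_gauss_def std_gauss_density_eq by (subst integral_density) auto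

text \<open>Translation invariance of Lebesgue measure moves the shift into the density, and
  expanding the square there leaves the exponential factor.\<close>

lemma cameron_martin:
  fixes f :: "'a::euclidean_space \<Rightarrow> real"
  assumes [measurable]: "f \<in> borel_measurable borel"
  shows "(\<integral>z. f (d + z) \<partial>std_gauss) = (\<integral>y. f y * exp (d \<bullet> y - d \<bullet> d / 2) \<partial>std_gauss)"
proof -
  let ?c = "(1 / sqrt (2 * pi)) ^ DIM('a)"
  have "(\<integral>y. f y * exp (d \<bullet> y - d \<bullet> d / 2) \<partial>std_gauss)
    = (\<integral>y. ?c * exp (- (y \<bullet> y) / 2) * (f y * exp (d \<bullet> y - d \<bullet> d / 2)) \<partial>distr lborel borel ((+) d))"
    by (subst integral_std_gauss) (auto simp: lborel_distr_plus)
  also have "\<dots> = (\<integral>z. ?c * exp (- ((d + z) \<bullet> (d + z)) / 2) * (f (d + z) * exp (d \<bullet> (d + z) - d \<bullet> d / 2)) \<partial>lborel)"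
    by (rule integral_distr) auto
  also have "\<dots> = (\<integral>z. ?c * exp (- (z \<bullet> z) / 2) * f (d + z) \<partial>lborel)"
  proof (rule Bochner_Integration.integral_cong[OF refl])
    fix z
    have "- ((d + z) \<bullet> (d + z)) / 2 + (d \<bullet> (d + z) - d \<bullet> d / 2) = - (z \<bullet> z) / 2"
      by (simp add: inner_add_left inner_add_right inner_commute field_simps)
    then have e: "exp (- ((d + z) \<bullet> (d + z)) / 2) * exp (d \<bullet> (d + z) - d \<bullet> d / 2) = exp (- (z \<bullet> z) / 2)"
      by (simp only: flip: exp_add)
    have "?c * exp (- ((d + z) \<bullet> (d + z)) / 2) * (f (d + z) * exp (d \<bullet> (d + z) - d \<bullet> d / 2))
      = ?c * (exp (- ((d + z) \<bullet> (d + z)) / 2) * exp (d \<bullet> (d + z) - d \<bullet> d / 2)) * f (d + z)"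
      by (simp only: mult_ac)
    then show "?c * exp (- ((d + z) \<bullet> (d + z)) / 2) * (f (d + z) * exp (d \<bullet> (d + z) - d \<bullet> d / 2))
      = ?c * exp (- (z \<bullet> z) / 2) * f (d + z)"
      by (simp only: e)
  qed
  also have "\<dots> = (\<integral>z. f (d + z) \<partial>std_gauss)" by (subst integral_std_gauss) auto
  finally show ?thesis by simp
qed

text \<open>By completing the square, the density times exp(s x) is exp(s^2/2) times the normal
  density with mean \<open>s\<close>. The absolute value is handled by adding the cases
  \<open>s = k\<close> and \<open>s = -k\<close>.\<close>

lemma nn_integral_normal_exp_abs_finite:
  "(\<integral>\<^sup>+x. ennreal (std_normal_density x) * ennreal (exp (k * \<bar>x\<bar>)) \<partial>lborel) < \<infinity>"
proof -
  have eq: "std_normal_density x * exp (s * x) = exp (s\<^sup>2 / 2) * normal_density s 1 x" for s x :: real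
    by (simp add: std_normal_density_def normal_density_def mult_exp_exp power2_eq_square field_simps)
  have int: "integrable lborel (\<lambda>x. std_normal_density x * exp (s * x))" for s
    unfolding eq by (intro integrable_mult_right integrable_normal_density) auto
  have "(\<integral>\<^sup>+x. ennreal (std_normal_density x) * ennreal (exp (k * \<bar>x\<bar>)) \<partial>lborel)
    \<le> (\<integral>\<^sup>+x. ennreal (std_normal_density x * exp (k * x) + std_normal_density x * exp (- k * x)) \<partial>lborel)"
  proof (rule nn_integral_mono)
    fix x :: real
    have "std_normal_density x * exp (k * \<bar>x\<bar>) \<le> std_normal_density x * (exp (k * x) + exp (- k * x))"
      by (intro mult_left_mono) (auto simp: abs_if)
    then show "ennreal (std_normal_density x) * ennreal (exp (k * \<bar>x\<bar>))
      \<le> ennreal (std_normal_density x * exp (k * x) + std_normal_density x * exp (- k * x))"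
      by (simp add: ennreal_mult[symmetric] distrib_left ennreal_leI del: ennreal_plus)
  qed
  also have "\<dots> < \<infinity>"
  proof -
    have "integrable lborel (\<lambda>x. std_normal_density x * exp (k * x) + std_normal_density x * exp (- k * x))"
      by (intro Bochner_Integration.integrable_add int)
    then show ?thesis by (subst nn_integral_eq_integral) auto
  qed
  finally show ?thesis .
qed

text \<open>Bounding the Euclidean norm by the sum of the absolute coordinates makes the integrand a
  product over coordinates.\<close>

lemma integrable_std_gauss_exp:
  "integrable (std_gauss :: 'a::euclidean_space measure) (\<lambda>z. exp (k * norm z))"
proof (rule integrableI_bounded)
  have "(\<integral>\<^sup>+z. ennreal (norm (exp (k * norm z))) \<partial>(std_gauss :: 'a measure))
    \<le> (\<integral>\<^sup>+z. (\<Prod>b\<in>Basis. ennreal (exp (\<bar>k\<bar> * \<bar>z \<bullet> b\<bar>))) \<partial>(std_gauss :: 'a measure))"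
  proof (rule nn_integral_mono)
    fix z :: 'a
    have "k * norm z \<le> \<bar>k\<bar> * (\<Sum>b\<in>Basis. \<bar>z \<bullet> b\<bar>)"
      by (intro mult_mono norm_le_l1) auto
    then have "exp (k * norm z) \<le> (\<Prod>b\<in>Basis. exp (\<bar>k\<bar> * \<bar>z \<bullet> b\<bar>))"
      by (simp add: exp_sum[symmetric] sum_distrib_left)
    then show "ennreal (norm (exp (k * norm z))) \<le> (\<Prod>b\<in>Basis. ennreal (exp (\<bar>k\<bar> * \<bar>z \<bullet> b\<bar>)))"
      by (simp add: prod_ennreal ennreal_leI)
  qed
  also have "\<dots> = (\<Prod>b\<in>(Basis :: 'a set). \<integral>\<^sup>+x. ennreal (std_normal_density x) * ennreal (exp (\<bar>k\<bar> * \<bar>x\<bar>)) \<partial>lborel)"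
    by (rule nn_integral_std_gauss_prod) measurable
  also have "\<dots> < \<infinity>"
    using nn_integral_normal_exp_abs_finite[of "\<bar>k\<bar>"] by (simp add: less_top power_less_top_ennreal)
  finally show "(\<integral>\<^sup>+z. ennreal (norm (exp (k * norm z))) \<partial>(std_gauss :: 'a measure)) < \<infinity>" .
qed simp

text \<open>The density is even and the integrand odd, so reflection changes only the sign of the
  integral.\<close>

lemma integral_std_gauss_inner: "(\<integral>z. v \<bullet> z \<partial>std_gauss) = 0"
proof -
  have um: "distr lborel borel uminus = (lborel :: 'a measure)"
    by (subst lborel_affine[of "-1" 0]) (auto simp: density_1)
  have "(\<integral>z. v \<bullet> z \<partial>std_gauss) = (\<integral>z. (1 / sqrt (2 * pi)) ^ DIM('a) * exp (- (z \<bullet> z) / 2) * (v \<bullet> z) \<partial>(lborel :: 'a measure))"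
    by (rule integral_std_gauss) auto
  also have "\<dots> = (\<integral>z. (1 / sqrt (2 * pi)) ^ DIM('a) * exp (- (z \<bullet> z) / 2) * (v \<bullet> z) \<partial>(distr lborel borel uminus :: 'a measure))"
    by (simp only: um)
  also have "\<dots> = - (\<integral>z. v \<bullet> z \<partial>std_gauss)"
    by (subst integral_distr) (auto simp: integral_std_gauss)
  finally show ?thesis by simp
qed

section \<open>Differential calculus\<close>

lemma directional_quotient_tendsto:
  fixes f :: "'a::real_normed_vector \<Rightarrow> real"
  assumes f: "(f has_derivative f') (at x)"
  shows "(\<lambda>s. (f (x + s *\<^sub>R u) - f x) / s) \<midarrow>0\<rightarrow> f' u"
proof -
  have "((\<lambda>s. x + s *\<^sub>R u) has_derivative (\<lambda>s. s *\<^sub>R u)) (at 0)"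
    by (auto intro!: derivative_eq_intros)
  moreover have "(f has_derivative f') (at (x + 0 *\<^sub>R u))" using f by simp
  ultimately have "((\<lambda>s. f (x + s *\<^sub>R u)) has_derivative (\<lambda>s. f' (s *\<^sub>R u))) (at 0)"
    by (rule has_derivative_compose)
  then have "((\<lambda>s. f (x + s *\<^sub>R u)) has_derivative (*) (f' u)) (at 0)"
    by (rule has_derivative_eq_rhs) (simp add: fun_eq_iff linear_cmul[OF has_derivative_linear[OF f]] mult.commute)
  then have "((\<lambda>s. f (x + s *\<^sub>R u)) has_real_derivative f' u) (at 0)"
    by (simp add: has_field_derivative_def)
  then show ?thesis by (simp add: DERIV_def)
qed

text \<open>Passage from increments to derivatives in a fixed direction: the solution's outermost
  derivative is estimated this way, without a formula for it.\<close>

lemma derivative_le_of_increment_le: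
  fixes f :: "'a::real_normed_vector \<Rightarrow> real"
  assumes f: "(f has_derivative f') (at x)" and "\<delta> > 0"
    and K: "\<And>s. \<bar>s\<bar> < \<delta> \<Longrightarrow> \<bar>f (x + s *\<^sub>R u) - f x\<bar> \<le> K * \<bar>s\<bar>"
  shows "\<bar>f' u\<bar> \<le> K"
proof -
  have "(\<lambda>s. \<bar>(f (x + s *\<^sub>R u) - f x) / s\<bar>) \<midarrow>0\<rightarrow> \<bar>f' u\<bar>"
    using directional_quotient_tendsto[OF f] by (rule tendsto_rabs)
  moreover have "\<forall>\<^sub>F s in at 0. \<bar>(f (x + s *\<^sub>R u) - f x) / s\<bar> \<le> K"
    using K \<open>\<delta> > 0\<close> by (auto simp: eventually_at abs_divide divide_le_eq intro!: exI[of _ \<delta>])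
  ultimately show ?thesis by (rule tendsto_upperbound) simp
qed

text \<open>Differentiability is assumed only at the point \<open>x\<close> and the increments are
  dominated relative to \<open>x\<close>, so dominated convergence is applied to the normalised
  remainder itself. This suits integrands whose derivatives are controlled through increments rather
  than by an explicit formula.\<close>

lemma has_derivative_integral:
  fixes F :: "'a::euclidean_space \<Rightarrow> 'b \<Rightarrow> real"
  assumes r: "r > 0"
    and int: "\<And>y. y \<in> ball x r \<Longrightarrow> integrable M (F y)"
    and der: "\<And>w. w \<in> space M \<Longrightarrow> ((\<lambda>y. F y w) has_derivative F' w) (at x)"
    and B: "integrable M B"
    and lip: "\<And>w y. w \<in> space M \<Longrightarrow> y \<in> ball x r \<Longrightarrow> \<bar>F y w - F x w\<bar> \<le> B w * norm (y - x)"
  shows "((\<lambda>y. \<integral>w. F y w \<partial>M) has_derivative (\<lambda>u. \<integral>w. F' w u \<partial>M)) (at x)"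
    and "integrable M (\<lambda>w. F' w u)"
proof -
  have nu: "norm u + 1 > 0" for u :: 'a by (simp add: add_nonneg_pos)
  have inball: "x + s *\<^sub>R u \<in> ball x r" if s: "\<bar>s\<bar> < r / (norm u + 1)" for s u
  proof -
    have "\<bar>s\<bar> * (norm u + 1) < r" using s nu by (simp add: pos_less_divide_eq)
    then have "\<bar>s\<bar> * norm u + \<bar>s\<bar> < r" by (simp add: distrib_left)
    then have "\<bar>s\<bar> * norm u < r" by simp
    then show ?thesis by (simp add: dist_norm)
  qed
  have F'B: "\<bar>F' w u\<bar> \<le> B w * norm u" if w: "w \<in> space M" for w u
  proof (rule derivative_le_of_increment_le[OF der[OF w]])
    show "r / (norm u + 1) > 0" using r nu by simp
    show "\<bar>F (x + s *\<^sub>R u) w - F x w\<bar> \<le> B w * norm u * \<bar>s\<bar>" if "\<bar>s\<bar> < r / (norm u + 1)" for s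
      using lip[OF w inball[OF that]] by (simp add: mult_ac)
  qed
  \<comment> \<open>The derivative is a pointwise limit of difference quotients and thus measurable;
    \<open>N\<close> discards the steps that would leave the ball.\<close>
  have meas: "(\<lambda>w. F' w u) \<in> borel_measurable M" for u
  proof -
    obtain N where N: "inverse (real (Suc N)) < r / (norm u + 1)"
      using reals_Archimedean[of "r / (norm u + 1)"] r nu by auto
    define s where "s = (\<lambda>n. inverse (real (Suc (n + N))))"
    have s: "s n \<noteq> 0" "\<bar>s n\<bar> < r / (norm u + 1)" for n
    proof -
      have "s n \<le> inverse (real (Suc N))" unfolding s_def by (intro le_imp_inverse_le) auto
      then have "s n < r / (norm u + 1)" using N by linarith
      moreover have "s n > 0" by (simp add: s_def)
      ultimately show "\<bar>s n\<bar> < r / (norm u + 1)" by simp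
    qed (simp add: s_def)
    have "s \<longlonglongrightarrow> 0"
      unfolding s_def by (rule LIMSEQ_ignore_initial_segment[OF LIMSEQ_inverse_real_of_nat])
    show ?thesis
    proof (rule borel_measurable_LIMSEQ_real)
      show "(\<lambda>n. (F (x + s n *\<^sub>R u) w - F x w) / s n) \<longlonglongrightarrow> F' w u" if "w \<in> space M" for w
        using directional_quotient_tendsto[OF der[OF that], of u] \<open>s \<longlonglongrightarrow> 0\<close> s(1)
        unfolding tendsto_at_iff_sequentially by (auto simp: o_def)
      show "(\<lambda>w. (F (x + s n *\<^sub>R u) w - F x w) / s n) \<in> borel_measurable M" for n
        using int[OF inball[OF s(2)[of n]]] int[of x] r by (intro borel_measurable_divide borel_measurable_diff) auto
    qed
  qed
  show F'int: "integrable M (\<lambda>w. F' w u)" for u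
  proof (rule Bochner_Integration.integrable_bound)
    show "integrable M (\<lambda>w. B w * norm u)" using B by simp
    show "AE w in M. norm (F' w u) \<le> norm (B w * norm u)"
      using F'B by (intro AE_I2) (metis abs_ge_self order_trans real_norm_def)
  qed (rule meas)
  show "((\<lambda>y. \<integral>w. F y w \<partial>M) has_derivative (\<lambda>u. \<integral>w. F' w u \<partial>M)) (at x)"
    unfolding has_derivative_iff_norm
  proof
    show "bounded_linear (\<lambda>u. \<integral>w. F' w u \<partial>M)"
    proof (rule bounded_linear_intro)
      have lin: "linear (F' w)" if "w \<in> space M" for w using der[OF that] by (rule has_derivative_linear)
      show "(\<integral>w. F' w (u + v) \<partial>M) = (\<integral>w. F' w u \<partial>M) + (\<integral>w. F' w v \<partial>M)" for u v
      proof -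
        have "(\<integral>w. F' w (u + v) \<partial>M) = (\<integral>w. F' w u + F' w v \<partial>M)"
          using lin by (intro Bochner_Integration.integral_cong refl) (simp add: linear_add)
        then show ?thesis by (simp add: F'int)
      qed
      show "(\<integral>w. F' w (c *\<^sub>R u) \<partial>M) = c *\<^sub>R (\<integral>w. F' w u \<partial>M)" for c u
      proof -
        have "(\<integral>w. F' w (c *\<^sub>R u) \<partial>M) = (\<integral>w. c * F' w u \<partial>M)"
          using lin by (intro Bochner_Integration.integral_cong refl) (simp add: linear_cmul)
        then show ?thesis by simp
      qed
      show "norm (\<integral>w. F' w u \<partial>M) \<le> norm u * (\<integral>w. B w \<partial>M)" for u
      proof -
        have "norm (\<integral>w. F' w u \<partial>M) \<le> (\<integral>w. norm (F' w u) \<partial>M)" by (rule integral_norm_bound)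
        also have "\<dots> \<le> (\<integral>w. B w * norm u \<partial>M)"
          using F'int B F'B by (intro integral_mono) auto
        finally show ?thesis by (simp add: mult.commute)
      qed
    qed
    show "((\<lambda>y. norm ((\<integral>w. F y w \<partial>M) - (\<integral>w. F x w \<partial>M) - (\<integral>w. F' w (y - x) \<partial>M)) / norm (y - x)) \<longlongrightarrow> 0) (at x)"
      unfolding tendsto_at_iff_sequentially
    proof (intro allI impI)
      fix X assume X: "\<forall>i. X i \<in> UNIV - {x}" "X \<longlonglongrightarrow> x"
      then obtain N where N: "\<And>n. n \<ge> N \<Longrightarrow> X n \<in> ball x r"
        using r by (metis dist_commute lim_sequentially mem_ball)
      \<comment> \<open>The increment and the linear term are each at most \<open>B w\<close> times
        the distance, which makes \<open>2 * B\<close> a majorant of the normalised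
        remainder.\<close>
      define q where "q = (\<lambda>n w. (F (X (n + N)) w - F x w - F' w (X (n + N) - x)) / norm (X (n + N) - x))"
      have Xi: "X (n + N) \<in> ball x r" "X (n + N) \<noteq> x" for n using N X by auto
      have int_x: "integrable M (F x)" using int r by simp
      have "(\<lambda>n. \<integral>w. q n w \<partial>M) \<longlonglongrightarrow> (\<integral>w. 0 \<partial>M)"
      proof (rule integral_dominated_convergence)
        show "integrable M (\<lambda>w. 2 * B w)" using B by simp
        show "q n \<in> borel_measurable M" for n
          unfolding q_def using int[OF Xi(1)] int_x meas by (intro borel_measurable_divide borel_measurable_diff) auto
        show "AE w in M. (\<lambda>n. q n w) \<longlonglongrightarrow> 0"
        proof (rule AE_I2)
          fix w assume "w \<in> space M"
          from der[OF this] have "((\<lambda>y. (F y w - F x w - F' w (y - x)) / norm (y - x)) \<longlongrightarrow> 0) (at x)"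
            unfolding has_derivative_iff_norm by (subst tendsto_norm_zero_iff[symmetric]) simp
          then have "((\<lambda>y. (F y w - F x w - F' w (y - x)) / norm (y - x)) \<circ> X) \<longlonglongrightarrow> 0"
            using X unfolding tendsto_at_iff_sequentially by blast
          then show "(\<lambda>n. q n w) \<longlonglongrightarrow> 0" unfolding q_def by (auto simp: o_def dest: LIMSEQ_ignore_initial_segment[of _ _ N])
        qed
        show "AE w in M. norm (q n w) \<le> 2 * B w" for n
        proof (rule AE_I2)
          fix w assume w: "w \<in> space M"
          have "\<bar>F (X (n + N)) w - F x w - F' w (X (n + N) - x)\<bar> \<le> B w * norm (X (n + N) - x) + B w * norm (X (n + N) - x)"
          proof -
            have "\<bar>F (X (n + N)) w - F x w\<bar> \<le> B w * norm (X (n + N) - x)"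
              "\<bar>F' w (X (n + N) - x)\<bar> \<le> B w * norm (X (n + N) - x)"
              using lip[OF w Xi(1)] F'B[OF w] by auto
            then show ?thesis by linarith
          qed
          then have "\<bar>F (X (n + N)) w - F x w - F' w (X (n + N) - x)\<bar> / norm (X (n + N) - x) \<le> 2 * B w"
            using Xi(2)[of n] by (subst pos_divide_le_eq) auto
          then show "norm (q n w) \<le> 2 * B w" by (simp add: q_def abs_divide)
        qed
      qed simp
      moreover have "(\<integral>w. q n w \<partial>M) =
          ((\<integral>w. F (X (n + N)) w \<partial>M) - (\<integral>w. F x w \<partial>M) - (\<integral>w. F' w (X (n + N) - x) \<partial>M)) / norm (X (n + N) - x)" for n
        unfolding q_def using int[OF Xi(1)] int_x F'int by simp
      ultimately have "(\<lambda>n. ((\<integral>w. F (X (n + N)) w \<partial>M) - (\<integral>w. F x w \<partial>M) - (\<integral>w. F' w (X (n + N) - x) \<partial>M)) / norm (X (n + N) - x)) \<longlonglongrightarrow> 0"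
        by simp
      then have "(\<lambda>n. norm (((\<integral>w. F (X (n + N)) w \<partial>M) - (\<integral>w. F x w \<partial>M) - (\<integral>w. F' w (X (n + N) - x) \<partial>M)) / norm (X (n + N) - x))) \<longlonglongrightarrow> 0"
        by (rule tendsto_norm_zero)
      then show "((\<lambda>y. norm ((\<integral>w. F y w \<partial>M) - (\<integral>w. F x w \<partial>M) - (\<integral>w. F' w (y - x) \<partial>M)) / norm (y - x)) \<circ> X) \<longlonglongrightarrow> 0"
        by - (rule LIMSEQ_offset[where k=N], simp add: o_def)
    qed
  qed
qed

text \<open>The mean value theorem is applied on the parameter interval from 0 to 1 instead of
  between 0 and \<open>t\<close>, so the sign of \<open>t\<close> is irrelevant.\<close>

lemma directional_difference:
  fixes f :: "'a::real_normed_vector \<Rightarrow> real"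
  assumes f: "\<And>y. f differentiable (at y)"
  obtains r where "0 < r" "r < 1" "f (y + t *\<^sub>R u) - f y = t * frechet_derivative f (at (y + (r * t) *\<^sub>R u)) u"
proof -
  define \<phi> where "\<phi> = (\<lambda>s. f (y + (s * t) *\<^sub>R u))"
  define d where "d = (\<lambda>s. t * frechet_derivative f (at (y + (s * t) *\<^sub>R u)) u)"
  have "(\<phi> has_real_derivative d s) (at s)" for s
  proof -
    have D: "(f has_derivative frechet_derivative f (at z)) (at z)" for z
      using f by (simp add: frechet_derivative_works[symmetric])
    have "((\<lambda>s. y + (s * t) *\<^sub>R u) has_derivative (\<lambda>h. (h * t) *\<^sub>R u)) (at s)"
      by (auto intro!: derivative_eq_intros)
    then have "(\<phi> has_derivative (\<lambda>h. frechet_derivative f (at (y + (s * t) *\<^sub>R u)) ((h * t) *\<^sub>R u))) (at s)"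
      unfolding \<phi>_def by (rule has_derivative_compose) (rule D)
    then have "(\<phi> has_derivative (*) (d s)) (at s)"
      by (rule has_derivative_eq_rhs) (simp add: fun_eq_iff d_def linear_cmul[OF has_derivative_linear[OF D]] mult_ac)
    then show ?thesis by (simp add: has_field_derivative_def)
  qed
  then obtain r where "0 < r" "r < 1" "\<phi> 1 - \<phi> 0 = (1 - 0) * d r"
    using MVT2[of 0 1 \<phi> d] by auto
  then show ?thesis using that by (simp add: \<phi>_def d_def)
qed

lemma directional_lipschitz:
  fixes f :: "'a::real_normed_vector \<Rightarrow> real"
  assumes f: "\<And>y. f differentiable (at y)" and L: "\<And>y. \<bar>frechet_derivative f (at y) u\<bar> \<le> L"
  shows "\<bar>f (y + t *\<^sub>R u) - f y\<bar> \<le> L * \<bar>t\<bar>"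
proof -
  obtain r where "f (y + t *\<^sub>R u) - f y = t * frechet_derivative f (at (y + (r * t) *\<^sub>R u)) u"
    using directional_difference[OF f] by metis
  then have "\<bar>f (y + t *\<^sub>R u) - f y\<bar> = \<bar>frechet_derivative f (at (y + (r * t) *\<^sub>R u)) u\<bar> * \<bar>t\<bar>"
    by (simp add: abs_mult mult.commute)
  also have "\<dots> \<le> L * \<bar>t\<bar>" using L by (intro mult_right_mono) auto
  finally show ?thesis .
qed

text \<open>The mean value theorem in direction \<open>u\<close>, applied to the increment of
  \<open>f\<close> by \<open>t v\<close>, leaves a difference of the first derivative at two points
  close to \<open>x\<close>. Its expansion at \<open>x\<close> then gives the limit.\<close>

lemma second_difference_limit:
  fixes f :: "'a::real_normed_vector \<Rightarrow> real"
  assumes f: "\<And>y. f differentiable (at y)" and fu: "(\<lambda>y. frechet_derivative f (at y) u) differentiable (at x)"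
  shows "((\<lambda>t. (f (x + t *\<^sub>R u + t *\<^sub>R v) - f (x + t *\<^sub>R u) - f (x + t *\<^sub>R v) + f x) / t\<^sup>2) \<longlongrightarrow>
    frechet_derivative (\<lambda>y. frechet_derivative f (at y) u) (at x) v) (at_right 0)"
proof -
  define g where "g = (\<lambda>y. frechet_derivative f (at y) u)"
  define g' where "g' = frechet_derivative g (at x)"
  define \<Delta> where "\<Delta> = (\<lambda>t. f (x + t *\<^sub>R u + t *\<^sub>R v) - f (x + t *\<^sub>R u) - f (x + t *\<^sub>R v) + f x)"
  have g': "(g has_derivative g') (at x)"
    using fu by (simp add: g_def g'_def frechet_derivative_works[symmetric])
  interpret g': linear g' using has_derivative_linear[OF g'] .
  have "((\<lambda>t. \<Delta> t / t\<^sup>2) \<longlongrightarrow> g' v) (at_right 0)"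
  proof (rule tendstoI)
    fix e :: real assume "e > 0"
    \<comment> \<open>The two expansion errors add up to at most \<open>\<epsilon> * t * c\<close>,
      and \<open>\<epsilon>\<close> is chosen so that \<open>\<epsilon> * c\<close> is half of
      \<open>e\<close>.\<close>
    define c where "c = 2 * (norm u + norm v) + 1"
    have c: "c > 0" by (simp add: c_def add_nonneg_pos)
    define \<epsilon> where "\<epsilon> = e / (2 * c)"
    have \<epsilon>: "\<epsilon> > 0" using \<open>e > 0\<close> c by (simp add: \<epsilon>_def)
    obtain d where d: "d > 0" "\<And>y. norm (y - x) < d \<Longrightarrow> \<bar>g y - g x - g' (y - x)\<bar> \<le> \<epsilon> * norm (y - x)"
      using g' \<epsilon> unfolding has_derivative_at_alt by (metis real_norm_def)
    have "dist (\<Delta> t / t\<^sup>2) (g' v) < e" if t: "0 < t" "t < d / c" for t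
    proof -
      define k where "k = (\<lambda>y. f (y + t *\<^sub>R v) - f y)"
      have D: "(f has_derivative frechet_derivative f (at z)) (at z)" for z
        using f by (simp add: frechet_derivative_works[symmetric])
      have kd: "(k has_derivative (\<lambda>h. frechet_derivative f (at (y + t *\<^sub>R v)) h - frechet_derivative f (at y) h)) (at y)" for y
        unfolding k_def
        by (intro has_derivative_diff D has_derivative_compose[of "\<lambda>y. y + t *\<^sub>R v" "\<lambda>h. h" y UNIV f, simplified])
          (auto intro!: derivative_eq_intros D)
      then have "k differentiable (at y)" for y by (auto simp: differentiable_def)
      then obtain r where r: "0 < r" "r < 1"
        "k (x + t *\<^sub>R u) - k x = t * frechet_derivative k (at (x + (r * t) *\<^sub>R u)) u"
        using directional_difference[of k x t u] by metis
      define y1 where "y1 = x + (r * t) *\<^sub>R u + t *\<^sub>R v"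
      define y2 where "y2 = x + (r * t) *\<^sub>R u"
      have "frechet_derivative k (at y2) u = g y1 - g y2"
        using frechet_derivative_at[OF kd[of y2]] by (simp add: y1_def y2_def g_def fun_eq_iff)
      moreover have "\<Delta> t = k (x + t *\<^sub>R u) - k x" by (simp add: \<Delta>_def k_def)
      ultimately have \<Delta>: "\<Delta> t = t * (g y1 - g y2)" using r(3) by (simp add: y2_def)
      have "norm (y2 - x) = r * t * norm u" using r t by (simp add: y2_def)
      also have "\<dots> \<le> 1 * t * norm u" using r t by (intro mult_right_mono) auto
      finally have n2: "norm (y2 - x) \<le> t * norm u" by simp
      have "norm (y1 - x) \<le> norm (y2 - x) + t * norm v"
        using norm_triangle_ineq[of "y2 - x" "t *\<^sub>R v"] t by (simp add: y1_def y2_def)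
      then have n1: "norm (y1 - x) \<le> t * norm u + t * norm v" using n2 by simp
      have tc: "t * c < d" using t c by (simp add: field_simps)
      have "t * (norm u + norm v) \<le> t * c" using t by (intro mult_left_mono) (auto simp: c_def)
      then have "t * norm u + t * norm v \<le> t * c" by (simp add: distrib_left)
      moreover have "t * norm u \<le> t * norm u + t * norm v" using t by simp
      ultimately have small: "norm (y1 - x) < d" "norm (y2 - x) < d" using n1 n2 tc by linarith+
      have b1: "\<bar>g y1 - g x - g' (y1 - x)\<bar> \<le> \<epsilon> * (t * norm u + t * norm v)"
        using d(2)[OF small(1)] n1 \<epsilon> by (meson mult_left_mono less_imp_le order_trans)
      have b2: "\<bar>g y2 - g x - g' (y2 - x)\<bar> \<le> \<epsilon> * (t * norm u)"
        using d(2)[OF small(2)] n2 \<epsilon> by (meson mult_left_mono less_imp_le order_trans)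
      have "g' (y1 - x) - g' (y2 - x) = t * g' v"
        by (simp add: y1_def y2_def g'.add g'.scaleR)
      then have "\<bar>g y1 - g y2 - t * g' v\<bar> \<le> \<epsilon> * (t * norm u + t * norm v) + \<epsilon> * (t * norm u)"
        using b1 b2 by linarith
      also have "\<dots> = \<epsilon> * (t * c) - \<epsilon> * t * (norm v + 1)"
        by (simp add: c_def algebra_simps)
      also have "\<dots> \<le> \<epsilon> * (t * c)" using \<epsilon> t by simp
      finally have "\<bar>g y1 - g y2 - t * g' v\<bar> \<le> \<epsilon> * c * t" by (simp add: mult_ac)
      then have "\<bar>(g y1 - g y2 - t * g' v) / t\<bar> \<le> \<epsilon> * c"
        using t by (simp add: abs_divide divide_le_eq)
      moreover have "\<Delta> t / t\<^sup>2 - g' v = (g y1 - g y2 - t * g' v) / t"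
        using t by (simp add: \<Delta> field_simps power2_eq_square)
      moreover have "\<epsilon> * c < e" using c \<open>e > 0\<close> by (simp add: \<epsilon>_def)
      ultimately show ?thesis by (simp add: dist_real_def)
    qed
    then show "\<forall>\<^sub>F t in at_right 0. dist (\<Delta> t / t\<^sup>2) (g' v) < e"
      using d(1) c by (auto simp: eventually_at_right intro!: exI[of _ "d / c"])
  qed
  then show ?thesis unfolding \<Delta>_def g'_def g_def .
qed

text \<open>The second difference is symmetric in \<open>u\<close> and \<open>v\<close>, so both
  mixed derivatives are limits of the same quotient.\<close>

lemma frechet_derivative_commute:
  fixes f :: "'a::real_normed_vector \<Rightarrow> real"
  assumes f: "\<And>y. f differentiable (at y)"
    and fu: "(\<lambda>y. frechet_derivative f (at y) u) differentiable (at x)"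
    and fv: "(\<lambda>y. frechet_derivative f (at y) v) differentiable (at x)"
  shows "frechet_derivative (\<lambda>y. frechet_derivative f (at y) u) (at x) v
    = frechet_derivative (\<lambda>y. frechet_derivative f (at y) v) (at x) u"
proof (rule tendsto_unique[OF _ second_difference_limit[OF f fu]])
  show "((\<lambda>t. (f (x + t *\<^sub>R u + t *\<^sub>R v) - f (x + t *\<^sub>R u) - f (x + t *\<^sub>R v) + f x) / t\<^sup>2)
      \<longlongrightarrow> frechet_derivative (\<lambda>y. frechet_derivative f (at y) v) (at x) u) (at_right 0)"
    using second_difference_limit[OF f fv, of u] by (simp add: algebra_simps)
qed simp

lemma frechet_D_swap:
  assumes f: "frechet_differentiable m f" and m: "length Us + 2 \<le> m"
  shows "frechet_D (u # v # Us) f = frechet_D (v # u # Us) f"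
proof
  fix x
  have 1: "frechet_D Us f differentiable (at y)" for y
    using f m by (auto simp: frechet_differentiable_def)
  have 2: "(\<lambda>y. frechet_derivative (frechet_D Us f) (at y) w) differentiable (at x)" for w
  proof -
    have "frechet_D (w # Us) f differentiable (at x)"
      using f m unfolding frechet_differentiable_def by (metis One_nat_def Suc_le_lessD add_2_eq_Suc' length_Cons)
    moreover have "frechet_D (w # Us) f = (\<lambda>y. frechet_derivative (frechet_D Us f) (at y) w)" by auto
    ultimately show ?thesis by simp
  qed
  have "frechet_derivative (\<lambda>y. frechet_derivative (frechet_D Us f) (at y) v) (at x) u
    = frechet_derivative (\<lambda>y. frechet_derivative (frechet_D Us f) (at y) u) (at x) v"
    by (rule frechet_derivative_commute[OF 1 2 2])
  moreover have "frechet_D (w # Us) f = (\<lambda>y. frechet_derivative (frechet_D Us f) (at y) w)" for w by auto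
  ultimately show "frechet_D (u # v # Us) f x = frechet_D (v # u # Us) f x" by simp
qed

lemma frechet_D_Cons_cong: "frechet_D Us f = frechet_D Vs g \<Longrightarrow> frechet_D (u # Us) f = frechet_D (u # Vs) g"
  by (rule ext) simp

text \<open>Adjacent swaps carry a chosen direction to the front. This freedom is behind the minimum
  over the directions.\<close>

lemma frechet_D_move:
  assumes f: "frechet_differentiable m f" and "length (As @ u # Bs) \<le> m"
  shows "frechet_D (As @ u # Bs) f = frechet_D (u # As @ Bs) f"
  using assms(2)
proof (induction As)
  case (Cons a As)
  from Cons.prems have "frechet_D (a # As @ u # Bs) f = frechet_D (a # u # As @ Bs) f"
    by (intro frechet_D_Cons_cong Cons.IH) simp
  also have "\<dots> = frechet_D (u # a # As @ Bs) f"
    using Cons.prems by (intro frechet_D_swap[OF f]) simp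
  finally show ?case by simp
qed simp

text \<open>The head of the list is differentiated last, so recursion on the smoothness of \<open>f\<close> peels off the
  last list element.\<close>

lemma frechet_D_snoc: "frechet_D (Us @ [u]) f = frechet_D Us (\<lambda>y. frechet_derivative f (at y) u)"
proof (induction Us)
  case Nil
  have "frechet_D [] f = f" by (rule ext) simp
  then show ?case by (intro ext) simp
next
  case (Cons a Us)
  show ?case unfolding append_Cons by (rule frechet_D_Cons_cong[OF Cons.IH])
qed

text \<open>Peeling off the innermost direction gives the shape on which the inductions over
  smoothness run; the definition itself extends lists at the outer end.\<close>

lemma frechet_differentiable_Suc:
  "frechet_differentiable (Suc m) f \<longleftrightarrow> (\<forall>x. f differentiable (at x)) \<and>
    (\<forall>u. frechet_differentiable m (\<lambda>y. frechet_derivative f (at y) u))"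
proof -
  have D0: "frechet_D [] f = f" for f :: "'a \<Rightarrow> real" by auto
  show ?thesis
  proof safe
    assume *: "frechet_differentiable (Suc m) f"
    then have "frechet_D [] f differentiable (at x)" for x
      unfolding frechet_differentiable_def by (metis length_0_conv zero_less_Suc)
    then show "f differentiable (at x)" for x by (simp add: D0)
    show "frechet_differentiable m (\<lambda>y. frechet_derivative f (at y) u)" for u
      unfolding frechet_differentiable_def
    proof safe
      fix Us :: "'a list" and X assume "length Us < m"
      then have "frechet_D (Us @ [u]) f differentiable (at X)"
        using * by (auto simp: frechet_differentiable_def)
      then show "frechet_D Us (\<lambda>y. frechet_derivative f (at y) u) differentiable (at X)"
        by (simp add: frechet_D_snoc)
    qed
  next
    assume *: "\<forall>x. f differentiable (at x)" "\<forall>u. frechet_differentiable m (\<lambda>y. frechet_derivative f (at y) u)"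
    show "frechet_differentiable (Suc m) f"
      unfolding frechet_differentiable_def
    proof safe
      fix Us :: "'a list" and X assume "length Us < Suc m"
      then show "frechet_D Us f differentiable (at X)"
        using * by (cases Us rule: rev_cases) (auto simp: frechet_D_snoc frechet_differentiable_def D0)
    qed
  qed
qed

lemma frechet_differentiable_mono: "frechet_differentiable m f \<Longrightarrow> n \<le> m \<Longrightarrow> frechet_differentiable n f"
  by (auto simp: frechet_differentiable_def)

text \<open>The substitution s = exp(-2t) turns the integral into half of the Beta integral with
  parameters m/2 and 1/2, and Gamma(1/2) = sqrt(pi).\<close>

lemma exp_sqrt_integral:
  assumes "m > (0::nat)"
  defines "f \<equiv> \<lambda>t. exp (- real m * t) / sqrt (1 - exp (- 2 * t))"
  shows "integrable lborel (\<lambda>t. indicator {0<..} t * f t)"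
    and "(\<integral>t. indicator {0<..} t * f t \<partial>lborel) = sqrt pi * Gamma (real m / 2) / (2 * Gamma (real m / 2 + 1 / 2))"
proof -
  define a where "a = real m / 2"
  have a: "a > 0" using assms by (simp add: a_def)
  define b where "b = Beta a (1/2)"
  define k where "k = (\<lambda>s::real. s powr (a - 1) * (1 - s) powr (1/2 - 1))"
  have "(k has_integral b) {0..1}" unfolding k_def b_def using a by (intro has_integral_Beta_real) auto
  then have hi: "(k has_integral b) {0<..<1}" by (simp add: has_integral_Icc_iff_Ioo)
  then have "k absolutely_integrable_on {0<..<1}"
    by (intro nonnegative_absolutely_integrable_1) (auto simp: k_def)
  moreover have "integral {0<..<1} k = b" using hi by (rule integral_unique)
  moreover have img: "(\<lambda>t. exp (- 2 * t)) ` {0<..} = {0<..<1::real}"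
  proof safe
    fix s :: real assume s: "s \<in> {0<..<1}"
    then show "s \<in> (\<lambda>t. exp (- 2 * t)) ` {0<..}" by (intro image_eqI[of _ _ "- ln s / 2"]) auto
  qed auto
  \<comment> \<open>The Beta integrand pulled back, Jacobian included. On the half line it equals
    \<open>2 * f\<close>, which explains the 2 in the denominator of the result.\<close>
  moreover define J where "J = (\<lambda>t. \<bar>- 2 * exp (- 2 * t)\<bar> * k (exp (- 2 * t)))"
  ultimately have *: "J absolutely_integrable_on {0<..} \<and> integral {0<..} J = b"
    unfolding J_def
    by (subst has_absolute_integral_change_of_variables_1'[where g="\<lambda>t. exp (- 2 * t)"])
      (auto intro!: derivative_eq_intros simp: inj_on_def)
  have eq: "J t = 2 * f t" if "t > 0" for t
  proof -
    have "exp (- 2 * t) powr (a - 1) = exp (- real m * t) * exp (2 * t)"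
      by (simp add: powr_def a_def mult_exp_exp algebra_simps)
    then have "exp (- 2 * t) * exp (- 2 * t) powr (a - 1) = exp (- real m * t)"
      by (simp add: mult_exp_exp)
    moreover have "(1 - exp (- 2 * t)) powr (1/2 - 1) = inverse (sqrt (1 - exp (- 2 * t)))"
      using that by (simp add: powr_minus powr_half_sqrt)
    moreover have "J t
        = 2 * ((exp (- 2 * t) * exp (- 2 * t) powr (a - 1)) * (1 - exp (- 2 * t)) powr (1/2 - 1))"
      unfolding k_def J_def by (simp only: abs_mult abs_exp_cancel abs_minus_cancel abs_numeral mult.assoc)
    ultimately show ?thesis by (simp only: f_def divide_inverse)
  qed
  have "(\<lambda>t. 2 * f t) absolutely_integrable_on {0<..}"
    by (rule absolutely_integrable_spike[OF conjunct1[OF *], of "{}"]) (auto simp: eq)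
  then have af: "f absolutely_integrable_on {0<..}"
    using set_integrable_mult_right[of "1/2" lebesgue "{0<..}" "\<lambda>t. 2 * f t"] by simp
  have fm: "(\<lambda>t. indicator {0<..} t * f t) \<in> borel_measurable borel"
    unfolding f_def by measurable
  show int: "integrable lborel (\<lambda>t. indicator {0<..} t * f t)"
    using af fm by (simp add: set_integrable_def integrable_completion)
  have "integral {0<..} (\<lambda>t. 2 * f t) = b"
    using conjunct2[OF *] eq by (metis (no_types, lifting) greaterThan_iff integral_cong)
  then have "integral {0<..} f = b / 2" by simp
  moreover have "integral {0<..} f = (\<integral>t. indicator {0<..} t * f t \<partial>lebesgue)"
    using set_lebesgue_integral_eq_integral(2)[OF af] by (simp add: set_lebesgue_integral_def)
  moreover have "(\<integral>t. indicator {0<..} t * f t \<partial>lebesgue) = (\<integral>t. indicator {0<..} t * f t \<partial>lborel)"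
    using fm by (simp add: integral_completion)
  moreover have "b = Gamma a * sqrt pi / Gamma (a + 1/2)"
    by (simp add: b_def Beta_def Gamma_one_half_real)
  ultimately show "(\<integral>t. indicator {0<..} t * f t \<partial>lborel) = sqrt pi * Gamma (real m / 2) / (2 * Gamma (real m / 2 + 1 / 2))"
    by (simp add: a_def mult.commute)
qed

section \<open>Gaussian smoothing\<close>

text \<open>Every such function is integrable for the Gaussian measure, and continuity supplies
  measurability. The class also contains the linear weights that arise when a derivative is moved to
  the density.\<close>

definition exp_bounded :: "('a::real_normed_vector \<Rightarrow> real) \<Rightarrow> bool" where
  "exp_bounded g \<longleftrightarrow> continuous_on UNIV g \<and>
     (\<exists>C k. 0 \<le> C \<and> 0 \<le> k \<and> (\<forall>x. \<bar>g x\<bar> \<le> C * exp (k * norm x)))"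

lemma exp_boundedI:
  assumes "continuous_on UNIV g" "\<And>x. \<bar>g x\<bar> \<le> C * exp (k * norm x)"
  shows "exp_bounded g"
  unfolding exp_bounded_def
proof (intro conjI exI allI)
  fix x
  have "\<bar>g x\<bar> \<le> C * exp (k * norm x)" by (rule assms)
  also have "\<dots> \<le> \<bar>C\<bar> * exp (\<bar>k\<bar> * norm x)"
    by (intro mult_mono) (auto intro: mult_right_mono)
  finally show "\<bar>g x\<bar> \<le> \<bar>C\<bar> * exp (\<bar>k\<bar> * norm x)" .
qed (use assms in auto)

lemma exp_boundedE:
  assumes "exp_bounded g"
  obtains C k where "0 \<le> C" "0 \<le> k" "\<forall>x. \<bar>g x\<bar> \<le> C * exp (k * norm x)"
  using assms by (auto simp: exp_bounded_def)

lemma exp_bounded_continuous: "exp_bounded g \<Longrightarrow> continuous_on UNIV g"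
  by (simp add: exp_bounded_def)

lemma exp_bounded_measurable [measurable_dest]:
  "exp_bounded g \<Longrightarrow> g \<in> borel_measurable borel"
  by (simp add: exp_bounded_def borel_measurable_continuous_onI)

lemma exp_bounded_const: "exp_bounded (\<lambda>_. c)"
  by (rule exp_boundedI[of _ "\<bar>c\<bar>" 0]) auto

lemma le_exp_self: "x \<le> exp (x :: real)"
  using exp_ge_add_one_self[of x] by linarith

lemma exp_bounded_norm: "exp_bounded norm"
  by (rule exp_boundedI[of _ 1 1]) (auto intro: continuous_intros le_exp_self)

lemma exp_bounded_inner: "exp_bounded (\<lambda>z. v \<bullet> z)"
proof (rule exp_boundedI[of _ "norm v" 1])
  fix x
  have "\<bar>v \<bullet> x\<bar> \<le> norm v * norm x" by (rule Cauchy_Schwarz_ineq2)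
  also have "\<dots> \<le> norm v * exp (1 * norm x)" by (intro mult_left_mono) (auto intro: le_exp_self)
  finally show "\<bar>v \<bullet> x\<bar> \<le> norm v * exp (1 * norm x)" .
qed (intro continuous_intros)

lemma exp_bounded_mult:
  assumes "exp_bounded f" "exp_bounded g"
  shows "exp_bounded (\<lambda>x. f x * g x)"
proof -
  obtain C k where f: "0 \<le> C" "0 \<le> k" "\<forall>x. \<bar>f x\<bar> \<le> C * exp (k * norm x)"
    using assms(1) by (rule exp_boundedE)
  obtain D l where g: "0 \<le> D" "0 \<le> l" "\<forall>x. \<bar>g x\<bar> \<le> D * exp (l * norm x)"
    using assms(2) by (rule exp_boundedE)
  show ?thesis
  proof (rule exp_boundedI[of _ "C * D" "k + l"])
    fix x
    have "\<bar>f x * g x\<bar> \<le> (C * exp (k * norm x)) * (D * exp (l * norm x))"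
      unfolding abs_mult using f g by (intro mult_mono) auto
    also have "\<dots> = C * D * (exp (k * norm x) * exp (l * norm x))" by simp
    finally show "\<bar>f x * g x\<bar> \<le> C * D * exp ((k + l) * norm x)"
      by (simp only: distrib_right exp_add)
  qed (intro continuous_on_mult exp_bounded_continuous assms)
qed

lemma exp_bounded_abs:
  assumes "exp_bounded f" shows "exp_bounded (\<lambda>x. \<bar>f x\<bar>)"
  using assms by (auto simp: exp_bounded_def intro: continuous_on_rabs)

lemma exp_bounded_affine:
  assumes "exp_bounded g" "bounded_linear S"
  shows "exp_bounded (\<lambda>z. g (c + S z))"
proof -
  obtain C k where *: "0 \<le> C" "0 \<le> k" "\<forall>x. \<bar>g x\<bar> \<le> C * exp (k * norm x)"
    using assms(1) by (rule exp_boundedE)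
  obtain K where K: "\<And>z. norm (S z) \<le> norm z * K"
    using bounded_linear.bounded[OF assms(2)] by blast
  show ?thesis
  proof (rule exp_boundedI[of _ "C * exp (k * norm c)" "k * K"])
    fix z
    have "norm (c + S z) \<le> norm c + norm z * K"
      using norm_triangle_ineq[of c "S z"] K[of z] by linarith
    then have "k * norm (c + S z) \<le> k * norm c + k * K * norm z"
      using *(2) by (metis distrib_left mult.assoc mult.commute mult_left_mono)
    then have "C * exp (k * norm (c + S z)) \<le> C * (exp (k * norm c) * exp (k * K * norm z))"
      using *(1) by (intro mult_left_mono) (simp_all only: exp_add[symmetric] exp_le_cancel_iff)
    then show "\<bar>g (c + S z)\<bar> \<le> C * exp (k * norm c) * exp (k * K * norm z)"
      using *(3)[rule_format, of "c + S z"] by simp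
  next
    show "continuous_on UNIV (\<lambda>z. g (c + S z))"
    proof (rule continuous_on_compose2[OF exp_bounded_continuous[OF assms(1)]])
      show "continuous_on UNIV (\<lambda>z. c + S z)"
        by (intro continuous_on_add continuous_on_const linear_continuous_on assms)
    qed simp
  qed
qed

lemma exp_bounded_shift: "exp_bounded g \<Longrightarrow> exp_bounded (\<lambda>z. g (c + z))"
  using exp_bounded_affine[of g "\<lambda>z. z" c] by simp

lemma exp_bounded_integrable:
  fixes g :: "'a::euclidean_space \<Rightarrow> real"
  assumes "exp_bounded g"
  shows "integrable std_gauss g"
proof -
  obtain C k where *: "0 \<le> C" "0 \<le> k" "\<forall>x. \<bar>g x\<bar> \<le> C * exp (k * norm x)"
    using assms by (rule exp_boundedE)
  show ?thesis
  proof (rule Bochner_Integration.integrable_bound)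
    show "integrable (std_gauss :: 'a measure) (\<lambda>z. C * exp (k * norm z))"
      by (intro integrable_mult_right integrable_std_gauss_exp)
    show "AE x in std_gauss. norm (g x) \<le> norm (C * exp (k * norm x))" using * by auto
    show "g \<in> borel_measurable std_gauss" using exp_bounded_measurable[OF assms] by simp
  qed
qed

lemma abs_exp_diff_le: "\<bar>exp s - 1\<bar> \<le> \<bar>s\<bar> * exp \<bar>s\<bar>" for s :: real
proof -
  have "norm (exp s - exp 0) \<le> exp \<bar>s\<bar> * norm (s - 0)"
  proof (rule field_differentiable_bound[of "cball 0 \<bar>s\<bar>" exp exp])
    show "norm (exp z) \<le> exp \<bar>s\<bar>" if "z \<in> cball 0 \<bar>s\<bar>" for z :: real
      using that by (auto simp: dist_real_def)
    show "(exp has_field_derivative exp z) (at z within cball 0 \<bar>s\<bar>)" for z :: real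
      by (auto intro: derivative_eq_intros)
  qed auto
  then show ?thesis by (simp add: mult.commute)
qed

text \<open>By the Cameron--Martin formula, the shift can be moved from \<open>g\<close>, which need not be
  differentiable, onto the smooth Gaussian density.\<close>

lemma gauss_shift_has_derivative:
  fixes g :: "'a::euclidean_space \<Rightarrow> real"
  assumes g: "exp_bounded g"
  shows "((\<lambda>c. \<integral>z. g (c + z) \<partial>std_gauss) has_derivative (\<lambda>u. \<integral>z. g (c + z) * (u \<bullet> z) \<partial>std_gauss)) (at c)"
proof -
  \<comment> \<open>The parameter \<open>d\<close> now occurs only in the smooth exponential factor.
    It suffices to differentiate at \<open>d = 0\<close>; the base point \<open>c\<close> is
    absorbed into the translated function and restored at the end.\<close>
  define F where "F = (\<lambda>d y. g (c + y) * exp (d \<bullet> y - d \<bullet> d / 2))"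
  define B where "B = (\<lambda>y. \<bar>g (c + y)\<bar> * exp (2 * norm y + 2))"
  have g': "exp_bounded (\<lambda>y. g (c + y))" using g by (rule exp_bounded_shift)
  have F: "exp_bounded (F d)" for d
    unfolding F_def
  proof (rule exp_bounded_mult[OF g'], rule exp_boundedI[of _ 1 "norm d"])
    fix y
    have "d \<bullet> y - d \<bullet> d / 2 \<le> norm d * norm y"
      using norm_cauchy_schwarz[of d y] inner_ge_zero[of d] by linarith
    then show "\<bar>exp (d \<bullet> y - d \<bullet> d / 2)\<bar> \<le> 1 * exp (norm d * norm y)" by simp
  qed (intro continuous_intros)
  have "((\<lambda>d. \<integral>y. F d y \<partial>std_gauss) has_derivative (\<lambda>u. \<integral>y. g (c + y) * (u \<bullet> y) \<partial>std_gauss)) (at 0)"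
  proof (rule has_derivative_integral[where r=1 and B=B])
    show "integrable std_gauss (F d)" for d using F by (rule exp_bounded_integrable)
    show "((\<lambda>d. F d y) has_derivative (\<lambda>u. g (c + y) * (u \<bullet> y))) (at 0)" for y
      unfolding F_def by (auto intro!: derivative_eq_intros simp: inner_commute)
    have "exp_bounded (\<lambda>y. exp (2 * norm y + 2) :: real)"
      by (rule exp_boundedI[of _ "exp 2" 2]) (auto simp: exp_add intro!: continuous_intros)
    then have "exp_bounded B"
      unfolding B_def by (intro exp_bounded_mult exp_bounded_abs g')
    then show "integrable std_gauss B" by (rule exp_bounded_integrable)
    fix y d :: 'a assume "d \<in> ball 0 1"
    then have d: "norm d \<le> 1" by simp
    define s where "s = d \<bullet> y - d \<bullet> d / 2"
    have "\<bar>d \<bullet> y\<bar> \<le> norm d * norm y" by (rule Cauchy_Schwarz_ineq2)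
    moreover have "\<bar>d \<bullet> d\<bar> \<le> norm d * 1"
      using mult_left_mono[OF d, of "norm d"] by (simp add: dot_square_norm power2_eq_square)
    ultimately have s: "\<bar>s\<bar> \<le> norm d * (norm y + 1)"
      using inner_ge_zero[of d] unfolding s_def distrib_left by linarith
    also have "\<dots> \<le> 1 * (norm y + 1)" using d by (intro mult_right_mono) auto
    finally have s1: "\<bar>s\<bar> \<le> norm y + 1" by simp
    \<comment> \<open>One factor \<open>exp (norm y + 1)\<close> comes from the exponential and a
      second one absorbs the linear factor \<open>norm y + 1\<close>; their product is the
      exponential in \<open>B\<close>.\<close>
    have "\<bar>exp s - 1\<bar> \<le> \<bar>s\<bar> * exp \<bar>s\<bar>" by (rule abs_exp_diff_le)
    also have "\<dots> \<le> (norm d * (norm y + 1)) * exp (norm y + 1)"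
      using s s1 by (intro mult_mono) auto
    also have "\<dots> \<le> (norm d * exp (norm y + 1)) * exp (norm y + 1)"
      by (intro mult_right_mono mult_left_mono le_exp_self) auto
    also have "\<dots> = exp (2 * norm y + 2) * norm d"
      by (simp add: mult_exp_exp)
    finally have "\<bar>exp s - 1\<bar> \<le> exp (2 * norm y + 2) * norm d" .
    then have "\<bar>g (c + y)\<bar> * \<bar>exp s - 1\<bar> \<le> \<bar>g (c + y)\<bar> * (exp (2 * norm y + 2) * norm d)"
      by (rule mult_left_mono) simp
    moreover have "F d y - F 0 y = g (c + y) * (exp s - 1)" by (simp add: F_def s_def right_diff_distrib)
    ultimately show "\<bar>F d y - F 0 y\<bar> \<le> B y * norm (d - 0)" by (simp add: B_def abs_mult mult.assoc)
  qed simp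
  moreover have "(\<integral>y. F d y \<partial>std_gauss) = (\<integral>z. g (c + d + z) \<partial>std_gauss)" for d
    unfolding F_def using cameron_martin[of "\<lambda>y. g (c + y)" d] exp_bounded_measurable[OF g']
    by (simp add: add.assoc)
  ultimately have "((\<lambda>d. \<integral>z. g (c + d + z) \<partial>std_gauss) has_derivative (\<lambda>u. \<integral>y. g (c + y) * (u \<bullet> y) \<partial>std_gauss)) (at (c - c))"
    by simp
  then have "((\<lambda>x. \<integral>z. g (c + (x - c) + z) \<partial>std_gauss) has_derivative (\<lambda>u. \<integral>y. g (c + y) * (u \<bullet> y) \<partial>std_gauss)) (at c)"
    by (rule has_derivative_compose[rotated, where f="\<lambda>x. x - c" and f'="\<lambda>h. h"]) (auto intro!: derivative_eq_intros)
  then show ?thesis by simp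
qed

text \<open>Writing the weight as the inner product with \<open>c + z\<close> minus the inner
  product with \<open>c\<close> turns the integral into two shifts of functions of exponential
  growth, which are already known to be differentiable in \<open>c\<close>.\<close>

lemma gauss_shift_weighted_differentiable:
  fixes g :: "'a::euclidean_space \<Rightarrow> real"
  assumes g: "exp_bounded g"
  shows "(\<lambda>c. \<integral>z. g (c + z) * (v \<bullet> z) \<partial>std_gauss) differentiable (at c)"
proof -
  have gv: "exp_bounded (\<lambda>y. g y * (v \<bullet> y))" using g exp_bounded_inner by (rule exp_bounded_mult)
  have "(\<lambda>c. (\<integral>z. g (c + z) * (v \<bullet> (c + z)) \<partial>std_gauss) - (v \<bullet> c) * (\<integral>z. g (c + z) \<partial>std_gauss)) differentiable (at c)"
  proof (intro differentiable_diff differentiable_mult)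
    show "(\<lambda>c. \<integral>z. g (c + z) * (v \<bullet> (c + z)) \<partial>std_gauss) differentiable (at c)"
      using gauss_shift_has_derivative[OF gv] by (auto simp: differentiable_def)
    show "(\<lambda>c. \<integral>z. g (c + z) \<partial>std_gauss) differentiable (at c)"
      using gauss_shift_has_derivative[OF g] by (auto simp: differentiable_def)
    show "(\<lambda>c. v \<bullet> c) differentiable (at c)"
      by (auto simp: differentiable_def intro!: derivative_eq_intros)
  qed
  moreover have "(\<integral>z. g (c + z) * (v \<bullet> (c + z)) \<partial>std_gauss) - (v \<bullet> c) * (\<integral>z. g (c + z) \<partial>std_gauss)
     = (\<integral>z. g (c + z) * (v \<bullet> z) \<partial>std_gauss)" for c
  proof -
    have 1: "integrable std_gauss (\<lambda>z. g (c + z) * (v \<bullet> (c + z)))"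
      using exp_bounded_integrable[OF exp_bounded_shift[OF gv]] .
    have 2: "integrable std_gauss (\<lambda>z. g (c + z))"
      using exp_bounded_integrable[OF exp_bounded_shift[OF g]] .
    have "(\<integral>z. g (c + z) * (v \<bullet> (c + z)) \<partial>std_gauss) - (v \<bullet> c) * (\<integral>z. g (c + z) \<partial>std_gauss)
      = (\<integral>z. g (c + z) * (v \<bullet> (c + z)) - (v \<bullet> c) * g (c + z) \<partial>std_gauss)"
      using 1 2 by simp
    also have "\<dots> = (\<integral>z. g (c + z) * (v \<bullet> z) \<partial>std_gauss)"
      by (intro Bochner_Integration.integral_cong) (simp_all add: inner_add_right algebra_simps)
    finally show ?thesis .
  qed
  ultimately show ?thesis by simp
qed

text \<open>The half line is open because the time weights divide by \<open>\<beta> t\<close>, which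
  vanishes at \<open>t = 0\<close>.\<close>

definition half_line :: "real measure" where
  "half_line = restrict_space lborel {0<..}"

lemma space_half_line [simp]: "space half_line = {0<..}"
  by (simp add: half_line_def space_restrict_space)

lemma half_line_measurable [measurable (raw)]:
  "f \<in> borel_measurable borel \<Longrightarrow> f \<in> borel_measurable half_line"
  unfolding half_line_def by (intro measurable_restrict_space1) simp

lemma half_line_integrable_iff:
  "integrable half_line f \<longleftrightarrow> integrable lborel (\<lambda>t. indicator {0<..} t * (f t :: real))"
  unfolding half_line_def by (subst integrable_restrict_space) simp_all

lemma half_line_integral:
  "(\<integral>t. f t \<partial>half_line) = (\<integral>t. indicator {0<..} t * (f t :: real) \<partial>lborel)"
  unfolding half_line_def by (subst integral_restrict_space) simp_all

lemma half_line_exp_sqrt: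
  assumes "m > (0::nat)"
  shows "integrable half_line (\<lambda>t. exp (- real m * t) / sqrt (1 - exp (- 2 * t)))"
    and "(\<integral>t. exp (- real m * t) / sqrt (1 - exp (- 2 * t)) \<partial>half_line)
      = sqrt pi * Gamma (real m / 2) / (2 * Gamma (real m / 2 + 1 / 2))"
  unfolding half_line_integrable_iff half_line_integral by (rule exp_sqrt_integral[OF assms])+

lemma half_line_exp:
  assumes "a > (0::real)"
  shows "integrable half_line (\<lambda>t. exp (- a * t))" "(\<integral>t. exp (- a * t) \<partial>half_line) = 1 / a"
proof -
  have hi: "((\<lambda>t. exp (- a * t)) has_integral 1 / a) {0<..}"
    using has_integral_exp_minus_to_infinity[OF assms, of 0]
    by (subst (asm) has_integral_spike_set_eq[of _ "{0<..}"]) (auto intro: negligible_subset[of "{0}"])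
  then have ai: "(\<lambda>t. exp (- a * t)) absolutely_integrable_on {0<..}"
    by (intro nonnegative_absolutely_integrable_1) auto
  have m: "(\<lambda>t. indicat_real {0<..} t *\<^sub>R exp (- a * t)) \<in> borel_measurable borel" by measurable
  show "integrable half_line (\<lambda>t. exp (- a * t))"
    using ai m unfolding set_integrable_def half_line_integrable_iff real_scaleR_def
    by (simp add: integrable_completion)
  have "(\<integral>t. exp (- a * t) \<partial>half_line) = (\<integral>t. indicat_real {0<..} t *\<^sub>R exp (- a * t) \<partial>lborel)"
    unfolding half_line_integral by simp
  also have "\<dots> = (\<integral>t. indicat_real {0<..} t *\<^sub>R exp (- a * t) \<partial>lebesgue)"
    using m by (simp add: integral_completion)
  also have "\<dots> = integral {0<..} (\<lambda>t. exp (- a * t))"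
    using set_lebesgue_integral_eq_integral(2)[OF ai] by (simp add: set_lebesgue_integral_def)
  finally show "(\<integral>t. exp (- a * t) \<partial>half_line) = 1 / a" using hi by (simp add: integral_unique)
qed

section \<open>The Ornstein--Uhlenbeck semigroup\<close>

text \<open>\<open>S\<close> models the multiplication by the two square roots and \<open>T\<close>
  its right inverse. The moment formula \<open>abs_inner\<close> is an assumption here and is
  discharged in the matrix instance from the independent entries of \<open>Z\<close>.\<close>

locale gaussian_semigroup =
  fixes S T :: "'a::euclidean_space \<Rightarrow> 'a"
  assumes S: "bounded_linear S" and T: "bounded_linear T" and ST: "S (T u) = u"
    and abs_inner: "(\<integral>z. \<bar>v \<bullet> z\<bar> \<partial>std_gauss) = sqrt (2 / pi) * norm (v :: 'a)"
begin

definition \<beta> :: "real \<Rightarrow> real" where "\<beta> t = sqrt (1 - exp (- 2 * t))"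

text \<open>Mehler's formula with a weight: weight 1 gives the semigroup, and the weight given by
  the inner product with \<open>T u\<close> gives its derivative in direction \<open>u\<close> up to
  the factor \<open>exp (- t) / \<beta> t\<close>.\<close>

definition mehler :: "('a \<Rightarrow> real) \<Rightarrow> ('a \<Rightarrow> real) \<Rightarrow> real \<Rightarrow> 'a \<Rightarrow> real" where
  "mehler w g t X = (\<integral>z. g (exp (- t) *\<^sub>R X + \<beta> t *\<^sub>R S z) * w z \<partial>std_gauss)"

text \<open>The index \<open>k\<close> counts derivatives that have already fallen on the test
  function, each contributing exp(-t). The Stein solution is the case \<open>k = 0\<close> with
  \<open>c\<close> the Gaussian mean; a derivative leads to \<open>Suc k\<close> and
  \<open>c = 0\<close>.\<close>

definition stein_op :: "nat \<Rightarrow> real \<Rightarrow> ('a \<Rightarrow> real) \<Rightarrow> 'a \<Rightarrow> real" where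
  "stein_op k c g X = - (\<integral>t. exp (- real k * t) * mehler (\<lambda>_. 1) g t X - c \<partial>half_line)"

text \<open>Convergence is carried as a separate predicate, since the integral in
  \<open>stein_op\<close> would take the default value 0 for a divergent integrand.\<close>

definition stein_integrable :: "nat \<Rightarrow> real \<Rightarrow> ('a \<Rightarrow> real) \<Rightarrow> bool" where
  "stein_integrable k c g \<longleftrightarrow>
    (\<forall>X. integrable half_line (\<lambda>t. exp (- real k * t) * mehler (\<lambda>_. 1) g t X - c))"

abbreviation "flow t X z \<equiv> exp (- t) *\<^sub>R X + \<beta> t *\<^sub>R S z"

abbreviation "weight k t \<equiv> exp (- real k * t) / \<beta> t"

abbreviation "ou \<equiv> mehler (\<lambda>_. 1)"

section \<open>Uniform bounds and first derivatives of Mehler averages\<close>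

lemma \<beta>_pos: "t > 0 \<Longrightarrow> \<beta> t > 0"
  by (simp add: \<beta>_def)

lemma \<beta>_le_1: "t \<ge> 0 \<Longrightarrow> 0 \<le> \<beta> t \<and> \<beta> t \<le> 1"
  by (simp add: \<beta>_def)

lemma one_minus_\<beta>: assumes "t \<ge> 0" shows "1 - \<beta> t \<le> exp (- t)"
proof -
  have e: "exp (- t) \<le> 1" using assms by simp
  have "(1 - exp (- t))\<^sup>2 \<le> 1 - exp (- 2 * t)"
  proof -
    have "exp (- 2 * t) = exp (- t) * exp (- t)" by (simp add: mult_exp_exp)
    moreover have "exp (- t) * exp (- t) \<le> 1 * exp (- t)" using e by (intro mult_right_mono) auto
    ultimately show ?thesis by (simp add: power2_eq_square algebra_simps)
  qed
  then have "1 - exp (- t) \<le> \<beta> t" unfolding \<beta>_def using e by (intro real_le_rsqrt) 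
  then show ?thesis by linarith
qed

lemma norm_S_bound: obtains K where "K \<ge> 0" "\<forall>z. norm (S z) \<le> K * norm z"
proof -
  obtain K where "K > 0" "\<forall>z. norm (S z) \<le> norm z * K"
    using bounded_linear.pos_bounded[OF S] by blast
  then show ?thesis by (intro that[of K]) (auto simp: mult.commute)
qed

lemma S_measurable [measurable]: "S \<in> borel_measurable borel"
  using S by (simp add: borel_measurable_continuous_onI linear_continuous_on)

lemma exp_bounded_mehler_integrand:
  assumes "exp_bounded g" "exp_bounded w"
  shows "exp_bounded (\<lambda>z. g (flow t X z) * w z)"
  by (intro exp_bounded_mult assms exp_bounded_affine[of g] bounded_linear_scaleR_right[THEN bounded_linear_compose] S)

lemma mehler_integrable:
  assumes "exp_bounded g" "exp_bounded w"
  shows "integrable std_gauss (\<lambda>z. g (flow t X z) * w z)"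
  by (intro exp_bounded_integrable exp_bounded_mehler_integrand assms)

lemma norm_mehler_arg:
  assumes "t \<ge> 0" "norm X \<le> R" "\<forall>z. norm (S z) \<le> K * norm z"
  shows "norm (flow t X z) \<le> R + K * norm z"
proof -
  have "norm (flow t X z) \<le> exp (- t) * norm X + \<beta> t * norm (S z)"
    using \<beta>_le_1[OF assms(1)] by (intro norm_triangle_le) auto
  also have "\<dots> \<le> 1 * norm X + 1 * norm (S z)"
    using \<beta>_le_1[OF assms(1)] assms(1) by (intro add_mono mult_right_mono) auto
  finally show ?thesis using assms(2) assms(3)[rule_format, of z] by linarith
qed

text \<open>Both coefficients of the flow are at most 1, so a single integrable majorant serves all
  times \<open>t \<ge> 0\<close> and all points of a ball.\<close>

lemma mehler_dominated:
  assumes g: "exp_bounded g" and w: "exp_bounded w"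
  obtains B where "integrable std_gauss B"
    "\<forall>t\<ge>0. \<forall>X. norm X \<le> R \<longrightarrow> (\<forall>z. \<bar>g (flow t X z) * w z\<bar> \<le> B z)"
proof -
  obtain C k where C: "0 \<le> C" "0 \<le> k" "\<forall>x. \<bar>g x\<bar> \<le> C * exp (k * norm x)"
    using g by (rule exp_boundedE)
  obtain K where K: "K \<ge> 0" "\<forall>z. norm (S z) \<le> K * norm z" by (rule norm_S_bound)
  define B where "B = (\<lambda>z. C * exp (k * (R + K * norm z)) * \<bar>w z\<bar>)"
  have "exp_bounded (\<lambda>z::'a. C * exp (k * (R + K * norm z)))"
    by (rule exp_boundedI[of _ "C * exp (k * R)" "k * K"])
      (auto simp: distrib_left exp_add mult_ac C(1) intro!: continuous_intros)
  then have "exp_bounded B" unfolding B_def by (rule exp_bounded_mult[OF _ exp_bounded_abs[OF w]])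
  then have "integrable std_gauss B" by (rule exp_bounded_integrable)
  moreover have "\<bar>g (flow t X z) * w z\<bar> \<le> B z" if "t \<ge> 0" "norm X \<le> R" for t X z
  proof -
    have "\<bar>g (flow t X z)\<bar> \<le> C * exp (k * norm (flow t X z))"
      using C(3) by blast
    also have "\<dots> \<le> C * exp (k * (R + K * norm z))"
      using norm_mehler_arg[OF that K(2)] C by (intro mult_left_mono) (auto intro: mult_left_mono)
    finally show ?thesis unfolding B_def abs_mult by (intro mult_right_mono) auto
  qed
  ultimately show ?thesis using that by blast
qed

lemma mehler_bounded:
  assumes g: "exp_bounded g" and w: "exp_bounded w"
  obtains C where "C \<ge> 0" "\<forall>t\<ge>0. \<forall>X. norm X \<le> R \<longrightarrow> \<bar>mehler w g t X\<bar> \<le> C"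
proof -
  obtain B where B: "integrable std_gauss B"
    "\<forall>t\<ge>0. \<forall>X. norm X \<le> R \<longrightarrow> (\<forall>z. \<bar>g (flow t X z) * w z\<bar> \<le> B z)"
    using g w by (rule mehler_dominated)
  have "\<bar>mehler w g t X\<bar> \<le> (\<integral>z. B z \<partial>std_gauss)" if "t \<ge> 0" "norm X \<le> R" for t X
    unfolding mehler_def using B that
    by (intro order_trans[OF integral_abs_bound] integral_mono integrable_abs mehler_integrable g w) auto
  then show ?thesis by (intro that[of "\<bar>\<integral>z. B z \<partial>std_gauss\<bar>"]) (auto intro: order_trans[OF _ abs_ge_self])
qed

text \<open>By Cauchy-Schwarz the weight \<open>norm\<close> dominates all linear weights at once;
  the constant is then independent of \<open>v\<close>, as an operator norm bound requires.\<close>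

lemma mehler_inner_bounded:
  assumes g: "exp_bounded g"
  obtains C where "C \<ge> 0" "\<forall>t\<ge>0. \<forall>X. norm X \<le> R \<longrightarrow> (\<forall>v. \<bar>mehler (\<lambda>z. v \<bullet> z) g t X\<bar> \<le> C * norm v)"
proof -
  obtain B where B: "integrable std_gauss B"
    "\<forall>t\<ge>0. \<forall>X. norm X \<le> R \<longrightarrow> (\<forall>z. \<bar>g (flow t X z) * norm z\<bar> \<le> B z)"
    using g exp_bounded_norm by (rule mehler_dominated)
  have "\<bar>mehler (\<lambda>z. v \<bullet> z) g t X\<bar> \<le> (\<integral>z. B z * norm v \<partial>std_gauss)" if "t \<ge> 0" "norm X \<le> R" for t X v
    unfolding mehler_def
  proof (intro order_trans[OF integral_abs_bound] integral_mono integrable_abs mehler_integrable g exp_bounded_inner)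
    show "integrable std_gauss (\<lambda>z. B z * norm v)" using B by simp
    fix z
    have "\<bar>g (flow t X z)\<bar> * \<bar>v \<bullet> z\<bar> \<le> \<bar>g (flow t X z)\<bar> * (norm v * norm z)"
      by (intro mult_left_mono Cauchy_Schwarz_ineq2) auto
    also have "\<dots> = \<bar>g (flow t X z) * norm z\<bar> * norm v" by (simp add: abs_mult)
    also have "\<dots> \<le> B z * norm v" using B that by (intro mult_right_mono) auto
    finally show "\<bar>g (flow t X z) * (v \<bullet> z)\<bar> \<le> B z * norm v" by (simp add: abs_mult)
  qed
  then have "\<bar>mehler (\<lambda>z. v \<bullet> z) g t X\<bar> \<le> \<bar>\<integral>z. B z \<partial>std_gauss\<bar> * norm v" if "t \<ge> 0" "norm X \<le> R" for t X v
  proof -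
    have "\<bar>mehler (\<lambda>z. v \<bullet> z) g t X\<bar> \<le> (\<integral>z. B z \<partial>std_gauss) * norm v"
      using \<open>\<And>v t X. 0 \<le> t \<Longrightarrow> norm X \<le> R \<Longrightarrow> \<bar>mehler (\<lambda>z. v \<bullet> z) g t X\<bar> \<le> (\<integral>z. B z * norm v \<partial>std_gauss)\<close>[OF that]
      by simp
    also have "\<dots> \<le> \<bar>\<integral>z. B z \<partial>std_gauss\<bar> * norm v" by (intro mult_right_mono) auto
    finally show ?thesis .
  qed
  then show ?thesis by (intro that[of "\<bar>\<integral>z. B z \<partial>std_gauss\<bar>"]) auto
qed

lemma mehler_measurable [measurable]:
  assumes g: "exp_bounded g" and w: "exp_bounded w"
  shows "(\<lambda>t. mehler w g t X) \<in> borel_measurable borel"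
proof -
  interpret prob_space "std_gauss :: 'a measure" by (rule prob_space_std_gauss)
  note [measurable] = exp_bounded_measurable[OF g] exp_bounded_measurable[OF w]
  show ?thesis unfolding mehler_def \<beta>_def by measurable
qed

text \<open>Since \<open>S (T X) = X\<close>, the drift term can be pulled inside \<open>S\<close>,
  where it becomes a shift of the Gaussian variable. This is the form to which the differentiated
  Cameron-Martin shift applies.\<close>

lemma mehler_shift_form:
  assumes "t > 0"
  shows "mehler w g t X = (\<integral>z. g (\<beta> t *\<^sub>R S ((exp (- t) / \<beta> t) *\<^sub>R T X + z)) * w z \<partial>std_gauss)"
proof -
  have "\<beta> t *\<^sub>R S ((exp (- t) / \<beta> t) *\<^sub>R T X + z) = flow t X z" for z
    using \<beta>_pos[OF assms] S by (simp add: linear_add linear_cmul bounded_linear.linear ST scaleR_add_right)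
  then show ?thesis by (simp add: mehler_def)
qed

lemma exp_bounded_scaled: "exp_bounded g \<Longrightarrow> exp_bounded (\<lambda>y. g (b *\<^sub>R S y))"
  using exp_bounded_affine[of g "\<lambda>y. b *\<^sub>R S y" 0] bounded_linear_compose[OF bounded_linear_scaleR_right S] by simp

lemma mehler_has_derivative:
  assumes g: "exp_bounded g" and t: "t > 0"
  shows "(ou g t has_derivative (\<lambda>u. exp (- t) / \<beta> t * mehler (\<lambda>z. T u \<bullet> z) g t X)) (at X)"
proof -
  define r where "r = exp (- t) / \<beta> t"
  have "((\<lambda>X. r *\<^sub>R T X) has_derivative (\<lambda>u. r *\<^sub>R T u)) (at X)"
    by (intro derivative_intros bounded_linear_imp_has_derivative T)
  from has_derivative_compose[OF this gauss_shift_has_derivative[OF exp_bounded_scaled[OF g, of "\<beta> t"]]]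
  have 1: "((\<lambda>X. ou g t X) has_derivative
      (\<lambda>u. \<integral>z. g (\<beta> t *\<^sub>R S (r *\<^sub>R T X + z)) * (r *\<^sub>R T u \<bullet> z) \<partial>std_gauss)) (at X)"
    unfolding mehler_shift_form[OF t] r_def by simp
  have 2: "(\<integral>z. g (\<beta> t *\<^sub>R S (r *\<^sub>R T X + z)) * (r *\<^sub>R T u \<bullet> z) \<partial>std_gauss)
      = r * mehler (\<lambda>z. T u \<bullet> z) g t X" for u
    unfolding mehler_shift_form[OF t] r_def[symmetric]
    by (simp add: mult.left_commute flip: integral_mult_right_zero)
  show ?thesis using 1 unfolding 2 unfolding r_def .
qed

lemma mehler_inner_differentiable:
  assumes g: "exp_bounded g" and t: "t > 0"
  shows "mehler (\<lambda>z. v \<bullet> z) g t differentiable (at X)"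
proof -
  define r where "r = exp (- t) / \<beta> t"
  have "((\<lambda>X. r *\<^sub>R T X) has_derivative (\<lambda>u. r *\<^sub>R T u)) (at X)"
    by (intro derivative_intros bounded_linear_imp_has_derivative T)
  then have "(\<lambda>X. r *\<^sub>R T X) differentiable (at X)" by (rule differentiableI)
  from differentiable_chain_at[OF this gauss_shift_weighted_differentiable[OF exp_bounded_scaled[OF g, of "\<beta> t"], of v]]
  show ?thesis unfolding mehler_shift_form[OF t] r_def[symmetric] o_def .
qed

lemma exp_div_\<beta>_integrable: "k > 0 \<Longrightarrow> integrable half_line (\<lambda>t. weight k t)"
  using half_line_exp_sqrt(1)[of k] by (simp add: \<beta>_def)

text \<open>The factor \<open>exp (- t) / \<beta> t\<close> has an integrable singularity at 0 and
  decays at infinity, so it can dominate the increments when the time integral is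
  differentiated.\<close>

lemma mehler_local_lipschitz:
  assumes g: "exp_bounded g"
  obtains C where "C \<ge> 0" "\<forall>t>0. \<forall>Y\<in>ball X 1. \<bar>ou g t Y - ou g t X\<bar> \<le> C * (exp (- t) / \<beta> t) * norm (Y - X)"
proof -
  obtain C where C: "C \<ge> 0"
    "\<forall>t\<ge>0. \<forall>Y. norm Y \<le> norm X + 1 \<longrightarrow> (\<forall>v. \<bar>mehler (\<lambda>z. v \<bullet> z) g t Y\<bar> \<le> C * norm v)"
    using g by (rule mehler_inner_bounded)
  obtain K where K: "K > 0" "\<forall>u. norm (T u) \<le> norm u * K"
    using bounded_linear.pos_bounded[OF T] by blast
  have "\<bar>ou g t Y - ou g t X\<bar> \<le> (C * K) * (exp (- t) / \<beta> t) * norm (Y - X)"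
    if t: "t > 0" and Y: "Y \<in> ball X 1" for t Y
  proof -
    have "norm (ou g t Y - ou g t X) \<le> ((C * K) * (exp (- t) / \<beta> t)) * norm (Y - X)"
    proof (rule differentiable_bound[of "ball X 1"])
      fix Z assume "Z \<in> ball X 1"
      then have Z: "norm Z \<le> norm X + 1"
        using norm_triangle_ineq2[of Z X] by (simp add: dist_norm norm_minus_commute)
      show "(ou g t has_derivative (\<lambda>u. exp (- t) / \<beta> t * mehler (\<lambda>z. T u \<bullet> z) g t Z)) (at Z within ball X 1)"
        using mehler_has_derivative[OF g t] by (rule has_derivative_at_withinI)
      show "onorm (\<lambda>u. exp (- t) / \<beta> t * mehler (\<lambda>z. T u \<bullet> z) g t Z) \<le> (C * K) * (exp (- t) / \<beta> t)"
      proof (rule onorm_le)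
        fix u
        have "\<bar>mehler (\<lambda>z. T u \<bullet> z) g t Z\<bar> \<le> C * norm (T u)" using C(2) t Z by simp
        also have "\<dots> \<le> C * (norm u * K)" using C K by (intro mult_left_mono) auto
        finally have "(exp (- t) / \<beta> t) * \<bar>mehler (\<lambda>z. T u \<bullet> z) g t Z\<bar> \<le> (exp (- t) / \<beta> t) * (C * (norm u * K))"
          using \<beta>_pos[OF t] by (intro mult_left_mono) auto
        then show "norm (exp (- t) / \<beta> t * mehler (\<lambda>z. T u \<bullet> z) g t Z) \<le> C * K * (exp (- t) / \<beta> t) * norm u"
          using \<beta>_pos[OF t] by (simp add: abs_mult mult_ac)
      qed
    qed (use Y in auto)
    then show ?thesis by simp
  qed
  then show ?thesis using C K by (intro that[of "C * K"]) auto
qed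

lemma stein_op_has_derivative:
  assumes g: "exp_bounded g" and int: "stein_integrable k c g"
  shows "(stein_op k c g has_derivative
    (\<lambda>u. - (\<integral>t. weight (Suc k) t * mehler (\<lambda>z. T u \<bullet> z) g t X \<partial>half_line))) (at X)"
proof -
  obtain C where C: "C \<ge> 0" "\<forall>t>0. \<forall>Y\<in>ball X 1.
      \<bar>ou g t Y - ou g t X\<bar> \<le> C * (exp (- t) / \<beta> t) * norm (Y - X)"
    using g by (rule mehler_local_lipschitz)
  have e: "exp (- real k * t) * (exp (- t) / \<beta> t) = weight (Suc k) t" for t
    by (simp add: mult_exp_exp algebra_simps)
  have "((\<lambda>X. \<integral>t. exp (- real k * t) * ou g t X - c \<partial>half_line) has_derivative
    (\<lambda>u. \<integral>t. weight (Suc k) t * mehler (\<lambda>z. T u \<bullet> z) g t X \<partial>half_line)) (at X)"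
  \<comment> \<open>The majorant with index 1 works for every \<open>k\<close>, because
    \<open>exp (- real k * t) \<le> 1\<close>.\<close>
  proof (rule has_derivative_integral[where r=1 and B="\<lambda>t. C * weight 1 t"])
    show "integrable half_line (\<lambda>t. exp (- real k * t) * ou g t Y - c)" for Y
      using int by (simp add: stein_integrable_def)
    show "integrable half_line (\<lambda>t. C * weight 1 t)"
      using exp_div_\<beta>_integrable[of 1] by (intro integrable_mult_right) simp
    fix t assume "t \<in> space half_line"
    then have t: "t > 0" by simp
    have "((\<lambda>Y. exp (- real k * t) * ou g t Y - c) has_derivative
        (\<lambda>u. exp (- real k * t) * (exp (- t) / \<beta> t * mehler (\<lambda>z. T u \<bullet> z) g t X))) (at X)"
      using mehler_has_derivative[OF g t, of X] by (auto intro!: derivative_eq_intros)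
    then show "((\<lambda>Y. exp (- real k * t) * ou g t Y - c) has_derivative
        (\<lambda>u. weight (Suc k) t * mehler (\<lambda>z. T u \<bullet> z) g t X)) (at X)"
      by (simp only: mult.assoc[symmetric] e)
    fix Y assume Y: "Y \<in> ball X 1"
    have "\<bar>exp (- real k * t) * ou g t Y - c - (exp (- real k * t) * ou g t X - c)\<bar>
      = exp (- real k * t) * \<bar>ou g t Y - ou g t X\<bar>"
      by (simp add: abs_mult flip: right_diff_distrib)
    also have "\<dots> \<le> 1 * \<bar>ou g t Y - ou g t X\<bar>"
      using t by (intro mult_right_mono) auto
    also have "\<dots> \<le> C * (exp (- t) / \<beta> t) * norm (Y - X)" using C t Y by simp
    finally show "\<bar>exp (- real k * t) * ou g t Y - c - (exp (- real k * t) * ou g t X - c)\<bar>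
      \<le> C * weight 1 t * norm (Y - X)" by simp
  qed simp
  then show ?thesis unfolding stein_op_def by (rule has_derivative_minus)
qed

end

text \<open>A Hoelder condition whose constant may grow exponentially. Hoelder functions and
  functions with iterated Lipschitz derivatives both satisfy it, and the exponent \<open>a\<close>
  becomes the rate exp(-a t) at which the centred time integrand decays.\<close>

definition holder_growth :: "('a::real_normed_vector \<Rightarrow> real) \<Rightarrow> bool" where
  "holder_growth g \<longleftrightarrow> (\<exists>a C k. 0 < a \<and> a \<le> 1 \<and> 0 \<le> C \<and> 0 \<le> k \<and>
     (\<forall>x y. \<bar>g x - g y\<bar> \<le> C * norm (x - y) powr a * exp (k * (norm x + norm y))))"

lemma powr_le_exp:
  assumes "0 \<le> x" "0 < a" "a \<le> (1::real)"
  shows "x powr a \<le> exp x"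
proof (cases "x \<le> 1")
  case True
  then have "x powr a \<le> 1" using assms by (intro powr_le1) auto
  also have "1 \<le> exp x" using assms by simp
  finally show ?thesis .
next
  case False
  then have "x powr a \<le> x powr 1" using assms by (intro powr_mono) auto
  then show ?thesis using assms le_exp_self[of x] by simp
qed

lemma holder_growth_exp_bounded:
  fixes g :: "'a::real_normed_vector \<Rightarrow> real"
  assumes "holder_growth g"
  shows "exp_bounded g"
proof -
  obtain a C k where *: "0 < a" "a \<le> 1" "0 \<le> C" "0 \<le> k"
    "\<And>x y. \<bar>g x - g y\<bar> \<le> C * norm (x - y) powr a * exp (k * (norm x + norm y))"
    using assms by (auto simp: holder_growth_def)
  show ?thesis
  proof (rule exp_boundedI[of _ "\<bar>g 0\<bar> + C" "k + 1"])
    fix x :: 'a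
    have "C * norm (x - 0) powr a * exp (k * (norm x + norm 0)) \<le> C * exp (norm x) * exp (k * norm x)"
      using * powr_le_exp[of "norm x" a] by (intro mult_mono mult_nonneg_nonneg) auto
    then have "\<bar>g x - g 0\<bar> \<le> C * exp ((k + 1) * norm x)"
      using *(5)[of x 0] by (simp add: mult_exp_exp distrib_right add.commute mult.assoc)
    moreover have "\<bar>g 0\<bar> * 1 \<le> \<bar>g 0\<bar> * exp ((k + 1) * norm x)" using * by (intro mult_left_mono) auto
    ultimately show "\<bar>g x\<bar> \<le> (\<bar>g 0\<bar> + C) * exp ((k + 1) * norm x)" by (simp add: distrib_right)
  next
    have "(g \<longlongrightarrow> g y) (at y)" for y
    proof -
      have "((\<lambda>x. C * norm (x - y) powr a * exp (k * (norm x + norm y))) \<longlongrightarrow>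
          C * norm (y - y) powr a * exp (k * (norm y + norm y))) (at y)"
        using * by (intro tendsto_mult tendsto_powr' tendsto_norm tendsto_exp tendsto_intros) auto
      then have "((\<lambda>x. C * norm (x - y) powr a * exp (k * (norm x + norm y))) \<longlongrightarrow> 0) (at y)" by simp
      then have "((\<lambda>x. g x - g y) \<longlongrightarrow> 0) (at y)"
        by (rule Lim_null_comparison[rotated]) (simp add: *(5))
      then show ?thesis by (rule LIM_zero_cancel)
    qed
    then show "continuous_on UNIV g" by (simp add: continuous_on_def)
  qed
qed

text \<open>A coordinate-free counterpart of \<open>Lip_class\<close>. Recursion on the innermost
  derivative makes every directional derivative a member of the next lower class, to which induction
  applies.\<close>

fun smooth_lipschitz :: "nat \<Rightarrow> ('a::euclidean_space \<Rightarrow> real) \<Rightarrow> bool" where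
  "smooth_lipschitz 0 g \<longleftrightarrow> (\<exists>L. L-lipschitz_on UNIV g)"
| "smooth_lipschitz (Suc p) g \<longleftrightarrow> (\<forall>x. g differentiable (at x)) \<and>
     (\<forall>u. smooth_lipschitz p (\<lambda>x. frechet_derivative g (at x) u))"

text \<open>By induction the directional derivatives grow at most exponentially, and the mean value
  theorem converts this into a Lipschitz condition with exponential weight.\<close>

lemma smooth_lipschitz_holder_growth:
  "smooth_lipschitz p g \<Longrightarrow> holder_growth g"
proof (induction p arbitrary: g)
  case 0
  then obtain L where L: "L-lipschitz_on UNIV g" by auto
  then have "\<bar>g x - g y\<bar> \<le> L * norm (x - y) powr 1 * exp (0 * (norm x + norm y))" for x y
    using lipschitz_onD[OF L, of x y] by (simp add: dist_real_def dist_norm)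
  then show ?case
    unfolding holder_growth_def using lipschitz_on_nonneg[OF L]
    by (intro exI[of _ 1] exI[of _ L] exI[of _ 0]) simp
next
  case (Suc p)
  have d: "g differentiable (at x)" for x using Suc.prems by simp
  have D: "(g has_derivative frechet_derivative g (at x)) (at x)" for x
    using d by (simp add: frechet_derivative_works[symmetric])
  have "exp_bounded (\<lambda>x. frechet_derivative g (at x) b)" for b
    using Suc by (intro holder_growth_exp_bounded Suc.IH) simp
  then have "\<forall>b. \<exists>C k. 0 \<le> C \<and> 0 \<le> k \<and> (\<forall>x. \<bar>frechet_derivative g (at x) b\<bar> \<le> C * exp (k * norm x))"
    by (simp add: exp_bounded_def)
  then obtain C k where Ck: "\<And>b. 0 \<le> C b" "\<And>b. 0 \<le> k b"
    "\<And>b x. \<bar>frechet_derivative g (at x) b\<bar> \<le> C b * exp (k b * norm x)"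
    by metis
  \<comment> \<open>Growth constants are available for each basis direction; summing them over the
    finite basis covers all directions.\<close>
  define C' where "C' = (\<Sum>b\<in>Basis. C b)"
  define k' where "k' = (\<Sum>b\<in>Basis. k b)"
  have C'0: "0 \<le> C'" "0 \<le> k'" using Ck by (auto simp: C'_def k'_def intro!: sum_nonneg)
  have bound: "\<bar>frechet_derivative g (at x) v\<bar> \<le> norm v * (C' * exp (k' * norm x))" for x v
  proof -
    interpret linear "frechet_derivative g (at x)" using D by (rule has_derivative_linear)
    have "frechet_derivative g (at x) v = frechet_derivative g (at x) (\<Sum>b\<in>Basis. (v \<bullet> b) *\<^sub>R b)"
      by (simp only: euclidean_representation)
    also have "\<dots> = (\<Sum>b\<in>Basis. (v \<bullet> b) * frechet_derivative g (at x) b)" by (simp add: sum scaleR)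
    also have "\<bar>\<dots>\<bar> \<le> (\<Sum>b\<in>Basis. \<bar>(v \<bullet> b) * frechet_derivative g (at x) b\<bar>)" by (rule sum_abs)
    also have "\<dots> \<le> (\<Sum>b\<in>Basis. norm v * (C b * exp (k' * norm x)))"
    proof (rule sum_mono)
      fix b :: 'a assume b: "b \<in> Basis"
      have "k b \<le> k'" unfolding k'_def using Ck b by (intro member_le_sum) auto
      then have "C b * exp (k b * norm x) \<le> C b * exp (k' * norm x)"
        using Ck by (intro mult_left_mono) (auto intro: mult_right_mono)
      then have "\<bar>frechet_derivative g (at x) b\<bar> \<le> C b * exp (k' * norm x)"
        using Ck(3)[of x b] by linarith
      then show "\<bar>(v \<bullet> b) * frechet_derivative g (at x) b\<bar> \<le> norm v * (C b * exp (k' * norm x))"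
        unfolding abs_mult using Basis_le_norm[OF b, of v] by (intro mult_mono) auto
    qed
    also have "\<dots> = norm v * (C' * exp (k' * norm x))"
      by (simp add: C'_def sum_distrib_left sum_distrib_right)
    finally show ?thesis .
  qed
  have "\<bar>g x - g y\<bar> \<le> C' * norm (x - y) powr 1 * exp (k' * (norm x + norm y))" for x y
  proof -
    obtain r where r: "0 < r" "r < 1"
      "g (y + 1 *\<^sub>R (x - y)) - g y = 1 * frechet_derivative g (at (y + (r * 1) *\<^sub>R (x - y))) (x - y)"
      using directional_difference[OF d] by metis
    define \<xi> where "\<xi> = y + (r * 1) *\<^sub>R (x - y)"
    have "\<xi> = (1 - r) *\<^sub>R y + r *\<^sub>R x" by (simp add: \<xi>_def algebra_simps)
    then have "norm \<xi> \<le> norm ((1 - r) *\<^sub>R y) + norm (r *\<^sub>R x)" by (simp only: norm_triangle_ineq)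
    also have "\<dots> = (1 - r) * norm y + r * norm x" using r by simp
    also have "\<dots> \<le> 1 * norm y + 1 * norm x" using r by (intro add_mono mult_right_mono) auto
    finally have \<xi>: "norm \<xi> \<le> norm x + norm y" by simp
    have "\<bar>g x - g y\<bar> = \<bar>frechet_derivative g (at \<xi>) (x - y)\<bar>" using r(3) by (simp add: \<xi>_def)
    also have "\<dots> \<le> norm (x - y) * (C' * exp (k' * norm \<xi>))" by (rule bound)
    also have "\<dots> \<le> norm (x - y) * (C' * exp (k' * (norm x + norm y)))"
      using C'0 \<xi> by (intro mult_left_mono) (auto intro: mult_left_mono)
    finally show ?thesis by (simp add: mult_ac)
  qed
  then show ?case
    unfolding holder_growth_def using C'0
    by (intro exI[of _ 1] exI[of _ C'] exI[of _ k']) simp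
qed

lemma smooth_lipschitz_exp_bounded: "smooth_lipschitz p g \<Longrightarrow> exp_bounded g"
  by (intro holder_growth_exp_bounded smooth_lipschitz_holder_growth)

context gaussian_semigroup
begin

text \<open>This is Gaussian integration by parts, obtained from uniqueness of derivatives: the
  average along a line is differentiated once through \<open>g\<close> and once through the
  density.\<close>

lemma mehler_derivative_commute:
  assumes g: "exp_bounded g" and d: "\<And>x. g differentiable (at x)"
    and gu: "exp_bounded (\<lambda>x. frechet_derivative g (at x) u)" and t: "t > 0"
  shows "exp (- t) / \<beta> t * mehler (\<lambda>z. T u \<bullet> z) g t X
    = exp (- t) * ou (\<lambda>x. frechet_derivative g (at x) u) t X"
proof -
  define D where "D = (\<lambda>x. frechet_derivative g (at x) u)"
  define a where "a = exp (- t)"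
  define F where "F = (\<lambda>s z. g (a *\<^sub>R (X + s *\<^sub>R u) + \<beta> t *\<^sub>R S z))"
  have a: "0 < a" "a \<le> 1" using t by (auto simp: a_def)
  have Dg: "(g has_derivative frechet_derivative g (at y)) (at y)" for y
    using d by (simp add: frechet_derivative_works[symmetric])
  obtain C k where Ck: "0 \<le> C" "0 \<le> k" "\<forall>x. \<bar>D x\<bar> \<le> C * exp (k * norm x)"
    using gu unfolding D_def by (rule exp_boundedE)
  obtain K where K: "K \<ge> 0" "\<forall>z. norm (S z) \<le> K * norm z" by (rule norm_S_bound)
  define B where "B = (\<lambda>z::'a. C * exp (k * (norm X + norm u + K * norm z)))"
  have "exp_bounded B"
    unfolding B_def
    by (rule exp_boundedI[of _ "C * exp (k * (norm X + norm u))" "k * K"])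
      (auto simp: distrib_left exp_add mult_ac Ck(1) intro!: continuous_intros)
  then have Bi: "integrable std_gauss B" by (rule exp_bounded_integrable)
  have "((\<lambda>s. \<integral>z. F s z \<partial>std_gauss) has_derivative
      (\<lambda>h. \<integral>z. h * a * D (a *\<^sub>R X + \<beta> t *\<^sub>R S z) \<partial>std_gauss)) (at 0)"
  proof (rule has_derivative_integral[where r=1 and B=B])
    show "integrable std_gauss (F s)" for s
      using mehler_integrable[OF g exp_bounded_const[of 1], of t "X + s *\<^sub>R u"] by (simp add: F_def a_def)
    show "integrable std_gauss B" by (rule Bi)
    fix z :: 'a
    have "((\<lambda>s. a *\<^sub>R (X + s *\<^sub>R u) + \<beta> t *\<^sub>R S z) has_derivative (\<lambda>h. (h * a) *\<^sub>R u)) (at 0)"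
      by (auto intro!: derivative_eq_intros)
    moreover have "(g has_derivative frechet_derivative g (at (a *\<^sub>R X + \<beta> t *\<^sub>R S z)))
        (at (a *\<^sub>R (X + 0 *\<^sub>R u) + \<beta> t *\<^sub>R S z))" using Dg by simp
    ultimately have "((\<lambda>s. F s z) has_derivative (\<lambda>h. frechet_derivative g (at (a *\<^sub>R X + \<beta> t *\<^sub>R S z)) ((h * a) *\<^sub>R u))) (at 0)"
      unfolding F_def by (rule has_derivative_compose)
    then show "((\<lambda>s. F s z) has_derivative (\<lambda>h. h * a * D (a *\<^sub>R X + \<beta> t *\<^sub>R S z))) (at 0)"
      by (simp add: D_def linear_cmul[OF has_derivative_linear[OF Dg]])
    fix s :: real assume "s \<in> ball 0 1"
    then have s: "\<bar>s\<bar> < 1" by simp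
    define y where "y = a *\<^sub>R X + \<beta> t *\<^sub>R S z"
    obtain r where r: "0 < r" "r < 1" "g (y + (s * a) *\<^sub>R u) - g y = s * a * D (y + (r * (s * a)) *\<^sub>R u)"
      using directional_difference[OF d] unfolding D_def by metis
    have "\<bar>r * (s * a)\<bar> \<le> 1 * (1 * 1)" unfolding abs_mult using r s a by (intro mult_mono) auto
    then have "norm ((r * (s * a)) *\<^sub>R u) \<le> 1 * norm u" unfolding norm_scaleR by (intro mult_right_mono) auto
    moreover have "norm y \<le> norm X + K * norm z"
      unfolding y_def a_def using t by (intro norm_mehler_arg K) auto
    ultimately have n: "norm (y + (r * (s * a)) *\<^sub>R u) \<le> norm X + norm u + K * norm z"
      using norm_triangle_ineq[of y "(r * (s * a)) *\<^sub>R u"] by linarith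
    have "\<bar>D (y + (r * (s * a)) *\<^sub>R u)\<bar> \<le> C * exp (k * norm (y + (r * (s * a)) *\<^sub>R u))"
      using Ck(3) by blast
    also have "\<dots> \<le> B z"
      unfolding B_def using n Ck by (intro mult_left_mono) (auto intro: mult_left_mono)
    finally have DB: "\<bar>D (y + (r * (s * a)) *\<^sub>R u)\<bar> \<le> B z" .
    have "F s z - F 0 z = s * a * D (y + (r * (s * a)) *\<^sub>R u)"
      using r(3) by (simp add: F_def y_def algebra_simps)
    then have "\<bar>F s z - F 0 z\<bar> = \<bar>s\<bar> * (a * \<bar>D (y + (r * (s * a)) *\<^sub>R u)\<bar>)"
      using a by (simp add: abs_mult)
    also have "\<dots> \<le> \<bar>s\<bar> * (1 * B z)" using a DB by (intro mult_left_mono mult_mono) auto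
    finally show "\<bar>F s z - F 0 z\<bar> \<le> B z * norm (s - 0)" by (simp add: mult.commute)
  qed simp
  moreover have "(\<lambda>s. \<integral>z. F s z \<partial>std_gauss) = (\<lambda>s. ou g t (X + s *\<^sub>R u))"
    by (simp add: F_def mehler_def a_def)
  ultimately have 1: "((\<lambda>s. ou g t (X + s *\<^sub>R u)) has_derivative
      (\<lambda>h. \<integral>z. h * a * D (a *\<^sub>R X + \<beta> t *\<^sub>R S z) \<partial>std_gauss)) (at 0)"
    by simp
  have "((\<lambda>s. X + s *\<^sub>R u) has_derivative (\<lambda>h. h *\<^sub>R u)) (at 0)" by (auto intro!: derivative_eq_intros)
  moreover have "(ou g t has_derivative (\<lambda>u. exp (- t) / \<beta> t * mehler (\<lambda>z. T u \<bullet> z) g t X)) (at (X + 0 *\<^sub>R u))"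
    using mehler_has_derivative[OF g t] by simp
  ultimately have 2: "((\<lambda>s. ou g t (X + s *\<^sub>R u)) has_derivative
      (\<lambda>h. exp (- t) / \<beta> t * mehler (\<lambda>z. T (h *\<^sub>R u) \<bullet> z) g t X)) (at 0)"
    by (rule has_derivative_compose)
  have "(\<integral>z. 1 * a * D (a *\<^sub>R X + \<beta> t *\<^sub>R S z) \<partial>std_gauss) = exp (- t) / \<beta> t * mehler (\<lambda>z. T (1 *\<^sub>R u) \<bullet> z) g t X"
    using has_derivative_unique[OF 1 2] by (rule fun_cong)
  then show ?thesis by (simp add: mehler_def a_def D_def)
qed

text \<open>A derivative falling on \<open>g\<close> supplies one more exp(-t), which raises the
  index, and removes the constant \<open>c\<close>. Induction on smoothness therefore has to range
  over all \<open>k\<close> and \<open>c\<close>.\<close>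

lemma stein_op_derivative_commute:
  assumes g: "exp_bounded g" and d: "\<And>x. g differentiable (at x)"
    and gu: "exp_bounded (\<lambda>x. frechet_derivative g (at x) u)" and int: "stein_integrable k c g"
  shows "(\<lambda>X. frechet_derivative (stein_op k c g) (at X) u) = stein_op (Suc k) 0 (\<lambda>x. frechet_derivative g (at x) u)"
proof
  fix X
  have "frechet_derivative (stein_op k c g) (at X) u
    = - (\<integral>t. weight (Suc k) t * mehler (\<lambda>z. T u \<bullet> z) g t X \<partial>half_line)"
    using frechet_derivative_at[OF stein_op_has_derivative[OF g int, of X]] by (rule fun_cong[symmetric])
  also have "\<dots> = - (\<integral>t. exp (- real (Suc k) * t) * ou (\<lambda>x. frechet_derivative g (at x) u) t X - 0 \<partial>half_line)"
  proof (intro arg_cong[where f=uminus] Bochner_Integration.integral_cong refl)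
    fix t assume "t \<in> space half_line"
    then have t: "t > 0" by simp
    have e: "exp (- real (Suc k) * t) = exp (- real k * t) * exp (- t)"
      by (simp add: mult_exp_exp algebra_simps)
    have "weight (Suc k) t * mehler (\<lambda>z. T u \<bullet> z) g t X
      = exp (- real k * t) * (exp (- t) / \<beta> t * mehler (\<lambda>z. T u \<bullet> z) g t X)"
      unfolding e by simp
    also have "\<dots> = exp (- real (Suc k) * t) * ou (\<lambda>x. frechet_derivative g (at x) u) t X"
      unfolding mehler_derivative_commute[OF g d gu t] e by simp
    finally show "weight (Suc k) t * mehler (\<lambda>z. T u \<bullet> z) g t X
      = exp (- real (Suc k) * t) * ou (\<lambda>x. frechet_derivative g (at x) u) t X - 0" by simp
  qed
  finally show "frechet_derivative (stein_op k c g) (at X) u = stein_op (Suc k) 0 (\<lambda>x. frechet_derivative g (at x) u) X"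
    by (simp add: stein_op_def)
qed

lemma stein_integrand_measurable:
  assumes "exp_bounded g"
  shows "(\<lambda>t. exp (- real k * t) * ou g t X - c) \<in> borel_measurable half_line"
proof (rule half_line_measurable)
  note [measurable] = mehler_measurable[OF assms exp_bounded_const[of 1], of X]
  show "(\<lambda>t. exp (- real k * t) * ou g t X - c) \<in> borel_measurable borel" by measurable
qed

lemma stein_integrable_Suc:
  assumes g: "exp_bounded g"
  shows "stein_integrable (Suc k) 0 g"
  unfolding stein_integrable_def
proof
  fix X :: 'a
  obtain C where C: "C \<ge> 0" "\<forall>t\<ge>0. \<forall>Y. norm Y \<le> norm X \<longrightarrow> \<bar>ou g t Y\<bar> \<le> C"
    using g exp_bounded_const by (rule mehler_bounded)
  show "integrable half_line (\<lambda>t. exp (- real (Suc k) * t) * ou g t X - 0)"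
  proof (rule Bochner_Integration.integrable_bound)
    show "integrable half_line (\<lambda>t. C * exp (- real (Suc k) * t))"
      by (intro integrable_mult_right half_line_exp) simp
    show "(\<lambda>t. exp (- real (Suc k) * t) * ou g t X - 0) \<in> borel_measurable half_line"
      by (rule stein_integrand_measurable[OF g])
    show "AE t in half_line. norm (exp (- real (Suc k) * t) * ou g t X - 0) \<le> norm (C * exp (- real (Suc k) * t))"
    proof (rule AE_I2)
      fix t assume "t \<in> space half_line"
      then have "exp (- real (Suc k) * t) * \<bar>ou g t X\<bar> \<le> exp (- real (Suc k) * t) * C"
        using C by (intro mult_left_mono) auto
      then show "norm (exp (- real (Suc k) * t) * ou g t X - 0) \<le> norm (C * exp (- real (Suc k) * t))"
        using C(1) by (simp add: abs_mult mult.commute)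
    qed
  qed
qed

text \<open>Both \<open>exp (- t)\<close> and \<open>1 - \<beta> t\<close> are at most exp(-t), so
  the flow approaches \<open>S z\<close> at that rate. The Hoelder condition turns this into exp(-a
  t) times a Gaussian-integrable function of \<open>z\<close>.\<close>

lemma stein_integrable_0:
  assumes "holder_growth g"
  shows "stein_integrable 0 (\<integral>z. g (S z) \<partial>std_gauss) g"
  unfolding stein_integrable_def
proof
  fix X :: 'a
  have g: "exp_bounded g" using assms by (rule holder_growth_exp_bounded)
  obtain a C k where *: "0 < a" "a \<le> 1" "0 \<le> C" "0 \<le> k"
    "\<And>x y. \<bar>g x - g y\<bar> \<le> C * norm (x - y) powr a * exp (k * (norm x + norm y))"
    using assms by (auto simp: holder_growth_def)
  obtain K where K: "K \<ge> 0" "\<forall>z. norm (S z) \<le> K * norm z" by (rule norm_S_bound)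
  define B where "B = (\<lambda>z::'a. C * exp (norm X + K * norm z) * exp (k * (norm X + 2 * (K * norm z))))"
  have "exp_bounded B"
    unfolding B_def
    by (rule exp_boundedI[of _ "C * exp (norm X + k * norm X)" "K + 2 * (k * K)"])
      (auto simp: distrib_left distrib_right exp_add mult_ac *(3) intro!: continuous_intros)
  then have B: "integrable std_gauss B" by (rule exp_bounded_integrable)
  have i1: "integrable std_gauss (\<lambda>z. g (flow t X z))" for t
    using mehler_integrable[OF g exp_bounded_const[of 1], of t X] by simp
  have i2: "integrable std_gauss (\<lambda>z. g (S z))"
    using exp_bounded_integrable[OF exp_bounded_affine[OF g S, of 0]] by simp
  have pw: "\<bar>g (flow t X z) - g (S z)\<bar> \<le> exp (- a * t) * B z" if t: "t > 0" for t z
  proof -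
    have e0: "flow t X z - S z = exp (- t) *\<^sub>R X - (1 - \<beta> t) *\<^sub>R S z"
      by (simp add: algebra_simps)
    have "norm (flow t X z - S z) \<le> exp (- t) * norm X + (1 - \<beta> t) * norm (S z)"
      unfolding e0 using norm_triangle_ineq4[of "exp (- t) *\<^sub>R X" "(1 - \<beta> t) *\<^sub>R S z"] \<beta>_le_1[of t] t by simp
    also have "\<dots> \<le> exp (- t) * norm X + exp (- t) * (K * norm z)"
      using one_minus_\<beta>[of t] \<beta>_le_1[of t] t K by (intro add_left_mono mult_mono) auto
    finally have n: "norm (flow t X z - S z) \<le> exp (- t) * (norm X + K * norm z)"
      by (simp add: distrib_left)
    have "norm (flow t X z - S z) powr a \<le> (exp (- t) * (norm X + K * norm z)) powr a"
      using n * by (intro powr_mono2) auto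
    also have "\<dots> = exp (- a * t) * (norm X + K * norm z) powr a"
      using K by (subst powr_mult) (auto simp: powr_def mult.commute)
    also have "\<dots> \<le> exp (- a * t) * exp (norm X + K * norm z)"
      using K * by (intro mult_left_mono powr_le_exp) auto
    finally have n': "norm (flow t X z - S z) powr a \<le> exp (- a * t) * exp (norm X + K * norm z)" .
    have "norm (flow t X z) + norm (S z) \<le> norm X + 2 * (K * norm z)"
      using norm_mehler_arg[OF less_imp_le[OF t] order_refl K(2), of X z] K(2)[rule_format, of z] by linarith
    then have e: "exp (k * (norm (flow t X z) + norm (S z))) \<le> exp (k * (norm X + 2 * (K * norm z)))"
      using * by (auto intro: mult_left_mono)
    have "\<bar>g (flow t X z) - g (S z)\<bar> \<le>
       C * norm (flow t X z - S z) powr a * exp (k * (norm (flow t X z) + norm (S z)))"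
      by (rule *(5))
    also have "\<dots> \<le> C * (exp (- a * t) * exp (norm X + K * norm z)) * exp (k * (norm X + 2 * (K * norm z)))"
      using n' e * by (intro mult_mono mult_left_mono) auto
    finally show ?thesis by (simp add: B_def mult_ac)
  qed
  show "integrable half_line (\<lambda>t. exp (- real 0 * t) * ou g t X - (\<integral>z. g (S z) \<partial>std_gauss))"
  proof (rule Bochner_Integration.integrable_bound)
    show "integrable half_line (\<lambda>t. (\<integral>z. B z \<partial>std_gauss) * exp (- a * t))"
      using * by (intro integrable_mult_right half_line_exp) simp
    show "(\<lambda>t. exp (- real 0 * t) * ou g t X - (\<integral>z. g (S z) \<partial>std_gauss)) \<in> borel_measurable half_line"
      by (rule stein_integrand_measurable[OF g])
    show "AE t in half_line. norm (exp (- real 0 * t) * ou g t X - (\<integral>z. g (S z) \<partial>std_gauss))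
      \<le> norm ((\<integral>z. B z \<partial>std_gauss) * exp (- a * t))"
    proof (rule AE_I2)
      fix t assume "t \<in> space half_line"
      then have t: "t > 0" by simp
      have "exp (- real 0 * t) * ou g t X - (\<integral>z. g (S z) \<partial>std_gauss)
        = (\<integral>z. g (flow t X z) - g (S z) \<partial>std_gauss)"
        using i1[of t] i2 by (simp add: mehler_def)
      also have "\<bar>\<dots>\<bar> \<le> (\<integral>z. exp (- a * t) * B z \<partial>std_gauss)"
        using i1[of t] i2 B pw[OF t]
        by (intro order_trans[OF integral_abs_bound] integral_mono integrable_abs Bochner_Integration.integrable_diff) auto
      also have "\<dots> \<le> \<bar>(\<integral>z. B z \<partial>std_gauss) * exp (- a * t)\<bar>" by (simp add: mult.commute)
      finally show "norm (exp (- real 0 * t) * ou g t X - (\<integral>z. g (S z) \<partial>std_gauss))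
        \<le> norm ((\<integral>z. B z \<partial>std_gauss) * exp (- a * t))" by simp
    qed
  qed
qed

text \<open>A shift of \<open>X\<close> by \<open>s v\<close> shifts every flow point by exp(-t)
  \<open>s v\<close>, hence the factor exp(-t); only the Lipschitz constant in the direction
  \<open>v\<close> is involved.\<close>

lemma mehler_increment:
  assumes g: "exp_bounded g" and w: "exp_bounded w" and t: "t > 0"
    and L: "\<And>X s. \<bar>g (X + s *\<^sub>R v) - g X\<bar> \<le> L * \<bar>s\<bar>"
  shows "\<bar>mehler w g t (X + s *\<^sub>R v) - mehler w g t X\<bar> \<le> exp (- t) * (L * \<bar>s\<bar>) * (\<integral>z. \<bar>w z\<bar> \<partial>std_gauss)"
proof -
  have "mehler w g t (X + s *\<^sub>R v) - mehler w g t X =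
    (\<integral>z. g (flow t (X + s *\<^sub>R v) z) * w z - g (flow t X z) * w z \<partial>std_gauss)"
    unfolding mehler_def by (intro Bochner_Integration.integral_diff[symmetric] mehler_integrable g w)
  also have "\<bar>\<dots>\<bar> \<le> (\<integral>z. exp (- t) * (L * \<bar>s\<bar>) * \<bar>w z\<bar> \<partial>std_gauss)"
  proof (rule order_trans[OF integral_abs_bound], rule integral_mono)
    show "integrable std_gauss (\<lambda>z. \<bar>g (flow t (X + s *\<^sub>R v) z) * w z - g (flow t X z) * w z\<bar>)"
      by (intro integrable_abs Bochner_Integration.integrable_diff mehler_integrable g w)
    show "integrable std_gauss (\<lambda>z. exp (- t) * (L * \<bar>s\<bar>) * \<bar>w z\<bar>)"
      using exp_bounded_integrable[OF w] by (intro integrable_mult_right integrable_abs)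
    fix z
    have "\<bar>g ((flow t X z) + (exp (- t) * s) *\<^sub>R v) - g (flow t X z)\<bar>
      \<le> L * \<bar>exp (- t) * s\<bar>" by (rule L)
    then have "\<bar>g (flow t (X + s *\<^sub>R v) z) - g (flow t X z)\<bar> * \<bar>w z\<bar>
      \<le> exp (- t) * (L * \<bar>s\<bar>) * \<bar>w z\<bar>"
      by (intro mult_right_mono) (simp_all add: algebra_simps abs_mult)
    then show "\<bar>g (flow t (X + s *\<^sub>R v) z) * w z - g (flow t X z) * w z\<bar>
      \<le> exp (- t) * (L * \<bar>s\<bar>) * \<bar>w z\<bar>"
      by (simp only: abs_mult flip: left_diff_distrib)
  qed
  finally show ?thesis by simp
qed

end

section \<open>Derivatives of the Stein solution\<close>

context gaussian_semigroup
begin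

definition stein_const :: "nat \<Rightarrow> real" where
  "stein_const m = Gamma (real m / 2) / (sqrt 2 * Gamma (real m / 2 + 1 / 2))"

lemma exp_div_\<beta>_integral:
  assumes "m > (0::nat)"
  shows "sqrt (2 / pi) * (\<integral>t. weight m t \<partial>half_line) = stein_const m"
proof -
  have "sqrt (2 / pi) * (\<integral>t. weight m t \<partial>half_line)
      = sqrt (2 / pi) * (sqrt pi * Gamma (real m / 2) / (2 * Gamma (real m / 2 + 1 / 2)))"
    unfolding \<beta>_def half_line_exp_sqrt(2)[OF assms] ..
  also have "\<dots> = (sqrt (2 / pi) * sqrt pi) / 2 * (Gamma (real m / 2) / Gamma (real m / 2 + 1 / 2))"
    by (simp only: times_divide_eq_left times_divide_eq_right divide_divide_eq_left mult_ac)
  also have "sqrt (2 / pi) * sqrt pi = sqrt 2" by (simp flip: real_sqrt_mult)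
  also have "sqrt 2 / 2 = 1 / sqrt (2::real)" by (simp add: field_simps)
  finally show ?thesis by (simp add: stein_const_def)
qed

lemma stein_op_increment:
  assumes g: "exp_bounded g" and int: "stein_integrable k c g"
    and L: "\<And>X s. \<bar>g (X + s *\<^sub>R v) - g X\<bar> \<le> L * \<bar>s\<bar>"
  shows "\<bar>stein_op k c g (X + s *\<^sub>R v) - stein_op k c g X\<bar> \<le> L / real (Suc k) * \<bar>s\<bar>"
proof -
  interpret prob_space "std_gauss :: 'a measure" by (rule prob_space_std_gauss)
  let ?F = "\<lambda>X t. exp (- real k * t) * ou g t X - c"
  have i: "integrable half_line (?F X)" for X using int by (simp add: stein_integrable_def)
  have "\<bar>stein_op k c g (X + s *\<^sub>R v) - stein_op k c g X\<bar> = \<bar>\<integral>t. ?F (X + s *\<^sub>R v) t - ?F X t \<partial>half_line\<bar>"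
    unfolding stein_op_def Bochner_Integration.integral_diff[OF i i] by linarith
  also have "\<dots> \<le> (\<integral>t. L * \<bar>s\<bar> * exp (- real (Suc k) * t) \<partial>half_line)"
  proof (rule order_trans[OF integral_abs_bound], rule integral_mono)
    show "integrable half_line (\<lambda>t. \<bar>?F (X + s *\<^sub>R v) t - ?F X t\<bar>)"
      by (intro integrable_abs Bochner_Integration.integrable_diff i)
    show "integrable half_line (\<lambda>t. L * \<bar>s\<bar> * exp (- real (Suc k) * t))"
      by (intro integrable_mult_right half_line_exp) simp
    fix t assume "t \<in> space half_line"
    then have t: "t > 0" by simp
    have "\<bar>?F (X + s *\<^sub>R v) t - ?F X t\<bar> = exp (- real k * t) * \<bar>ou g t (X + s *\<^sub>R v) - ou g t X\<bar>"
      by (simp add: abs_mult flip: right_diff_distrib)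
    also have "\<dots> \<le> exp (- real k * t) * (exp (- t) * (L * \<bar>s\<bar>) * (\<integral>z. \<bar>1::real\<bar> \<partial>(std_gauss :: 'a measure)))"
      by (rule mult_left_mono[OF mehler_increment[OF g exp_bounded_const t L]]) simp
    also have "\<dots> = L * \<bar>s\<bar> * (exp (- real k * t) * exp (- t))" using prob_space by simp
    also have "exp (- real k * t) * exp (- t) = exp (- real (Suc k) * t)"
      by (simp add: mult_exp_exp algebra_simps)
    finally show "\<bar>?F (X + s *\<^sub>R v) t - ?F X t\<bar> \<le> L * \<bar>s\<bar> * exp (- real (Suc k) * t)" .
  qed
  also have "\<dots> = L * \<bar>s\<bar> * (1 / real (Suc k))"
    using half_line_exp(2)[of "real (Suc k)"] by simp
  finally show ?thesis by (simp add: mult.commute)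
qed

lemma weighted_integrable:
  assumes g: "exp_bounded g" and k: "k > 0"
  shows "integrable half_line (\<lambda>t. weight k t * mehler (\<lambda>z. v \<bullet> z) g t X)"
proof -
  obtain C where C: "C \<ge> 0" "\<forall>t\<ge>0. \<forall>Y. norm Y \<le> norm X \<longrightarrow> \<bar>mehler (\<lambda>z. v \<bullet> z) g t Y\<bar> \<le> C"
    using g exp_bounded_inner by (rule mehler_bounded)
  show ?thesis
  proof (rule Bochner_Integration.integrable_bound)
    show "integrable half_line (\<lambda>t. C * weight k t)"
      by (intro integrable_mult_right exp_div_\<beta>_integrable k)
    show "(\<lambda>t. weight k t * mehler (\<lambda>z. v \<bullet> z) g t X) \<in> borel_measurable half_line"
    proof (rule half_line_measurable)
      note [measurable] = mehler_measurable[OF g exp_bounded_inner[of v], of X]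
      show "(\<lambda>t. weight k t * mehler (\<lambda>z. v \<bullet> z) g t X) \<in> borel_measurable borel"
        unfolding \<beta>_def by measurable
    qed
    show "AE t in half_line. norm (weight k t * mehler (\<lambda>z. v \<bullet> z) g t X) \<le> norm (C * weight k t)"
    proof (rule AE_I2)
      fix t assume "t \<in> space half_line"
      then have t: "t > 0" by simp
      then have "weight k t * \<bar>mehler (\<lambda>z. v \<bullet> z) g t X\<bar> \<le> weight k t * C"
        using C \<beta>_pos[OF t] by (intro mult_left_mono) auto
      then show "norm (weight k t * mehler (\<lambda>z. v \<bullet> z) g t X) \<le> norm (C * weight k t)"
        using C(1) \<beta>_pos[OF t] by (simp add: abs_mult mult.commute)
    qed
  qed
qed

text \<open>The direction \<open>v\<close> is carried by the Gaussian weight and \<open>u\<close> by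
  the increment of \<open>g\<close>. The contraction exp(-t) raises the index of the time weight to
  \<open>Suc k\<close>, and the absolute moment of the Gaussian weight supplies the remaining factor
  of \<open>stein_const\<close>.\<close>

lemma weighted_increment:
  assumes g: "exp_bounded g" and k: "k > 0"
    and L: "\<And>X s. \<bar>g (X + s *\<^sub>R u) - g X\<bar> \<le> L * \<bar>s\<bar>"
  shows "\<bar>(\<integral>t. weight k t * mehler (\<lambda>z. v \<bullet> z) g t (X + s *\<^sub>R u) \<partial>half_line)
      - (\<integral>t. weight k t * mehler (\<lambda>z. v \<bullet> z) g t X \<partial>half_line)\<bar>
    \<le> stein_const (Suc k) * norm v * L * \<bar>s\<bar>"
proof -
  let ?F = "\<lambda>X t. weight k t * mehler (\<lambda>z. v \<bullet> z) g t X"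
  have i: "integrable half_line (?F X)" for X by (rule weighted_integrable[OF g k])
  have "\<bar>(\<integral>t. ?F (X + s *\<^sub>R u) t \<partial>half_line) - (\<integral>t. ?F X t \<partial>half_line)\<bar>
      = \<bar>\<integral>t. ?F (X + s *\<^sub>R u) t - ?F X t \<partial>half_line\<bar>"
    using i[of "X + s *\<^sub>R u"] i[of X] by simp
  also have "\<dots> \<le> (\<integral>t. L * \<bar>s\<bar> * (sqrt (2 / pi) * norm v) * weight (Suc k) t \<partial>half_line)"
  proof (rule order_trans[OF integral_abs_bound], rule integral_mono)
    show "integrable half_line (\<lambda>t. \<bar>?F (X + s *\<^sub>R u) t - ?F X t\<bar>)"
      by (intro integrable_abs Bochner_Integration.integrable_diff i)
    show "integrable half_line (\<lambda>t. L * \<bar>s\<bar> * (sqrt (2 / pi) * norm v) * weight (Suc k) t)"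
      by (intro integrable_mult_right exp_div_\<beta>_integrable) simp
    fix t assume "t \<in> space half_line"
    then have t: "t > 0" by simp
    have "\<bar>?F (X + s *\<^sub>R u) t - ?F X t\<bar>
      = weight k t * \<bar>mehler (\<lambda>z. v \<bullet> z) g t (X + s *\<^sub>R u) - mehler (\<lambda>z. v \<bullet> z) g t X\<bar>"
      using \<beta>_pos[OF t] by (simp add: abs_mult abs_divide flip: right_diff_distrib diff_divide_distrib)
    also have "\<dots> \<le> weight k t * (exp (- t) * (L * \<bar>s\<bar>) * (\<integral>z. \<bar>v \<bullet> z\<bar> \<partial>std_gauss))"
      using \<beta>_pos[OF t] by (intro mult_left_mono mehler_increment[OF g exp_bounded_inner t L]) auto
    also have "\<dots> = L * \<bar>s\<bar> * (sqrt (2 / pi) * norm v) * ((exp (- real k * t) * exp (- t)) / \<beta> t)"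
      unfolding abs_inner by simp
    also have "exp (- real k * t) * exp (- t) = exp (- real (Suc k) * t)"
      by (simp add: mult_exp_exp algebra_simps)
    finally show "\<bar>?F (X + s *\<^sub>R u) t - ?F X t\<bar> \<le> L * \<bar>s\<bar> * (sqrt (2 / pi) * norm v) * weight (Suc k) t" .
  qed
  also have "\<dots> = L * \<bar>s\<bar> * norm v * (sqrt (2 / pi) * (\<integral>t. weight (Suc k) t \<partial>half_line))"
    by (simp only: integral_mult_right_zero mult_ac)
  also have "\<dots> = L * \<bar>s\<bar> * norm v * stein_const (Suc k)"
    by (subst exp_div_\<beta>_integral) simp_all
  finally show ?thesis by (simp add: mult_ac)
qed

text \<open>For each \<open>t > 0\<close> the integrand is smoothed by the density, but bounding its
  derivative that way would cost a second, non-integrable factor \<open>1 / \<beta> t\<close>. The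
  Lipschitz constant of \<open>g\<close> bounds the increments uniformly in \<open>t\<close>, so the
  weight with a single such factor remains a majorant.\<close>

lemma weighted_differentiable:
  assumes g: "exp_bounded g" and k: "k > 0" and L: "L-lipschitz_on UNIV g"
  shows "(\<lambda>X. \<integral>t. weight k t * mehler (\<lambda>z. v \<bullet> z) g t X \<partial>half_line) differentiable (at X)"
proof (rule differentiableI, rule has_derivative_integral(1)[where r=1])
  let ?A = "\<integral>z. \<bar>v \<bullet> z\<bar> \<partial>std_gauss"
  show "integrable half_line (\<lambda>t. weight k t * mehler (\<lambda>z. v \<bullet> z) g t Y)" for Y
    by (rule weighted_integrable[OF g k])
  show "integrable half_line (\<lambda>t. L * ?A * weight k t)"
    by (intro integrable_mult_right exp_div_\<beta>_integrable k)
  fix t assume "t \<in> space half_line"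
  then have t: "t > 0" by simp
  have "(mehler (\<lambda>z. v \<bullet> z) g t has_derivative frechet_derivative (mehler (\<lambda>z. v \<bullet> z) g t) (at X)) (at X)"
    using mehler_inner_differentiable[OF g t] by (simp add: frechet_derivative_works[symmetric])
  then show "((\<lambda>Y. weight k t * mehler (\<lambda>z. v \<bullet> z) g t Y) has_derivative
      (\<lambda>u. weight k t * frechet_derivative (mehler (\<lambda>z. v \<bullet> z) g t) (at X) u)) (at X)"
    by (rule has_derivative_mult_right)
  fix Y
  have "\<bar>g (Z + s *\<^sub>R (Y - X)) - g Z\<bar> \<le> L * norm (Y - X) * \<bar>s\<bar>" for Z s
    using lipschitz_onD[OF L, of "Z + s *\<^sub>R (Y - X)" Z] by (simp add: dist_real_def dist_norm mult_ac)
  from mehler_increment[OF g exp_bounded_inner[of v] t this, of X 1]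
  have "\<bar>mehler (\<lambda>z. v \<bullet> z) g t Y - mehler (\<lambda>z. v \<bullet> z) g t X\<bar> \<le> exp (- t) * (L * norm (Y - X)) * ?A" by simp
  also have "\<dots> \<le> 1 * (L * norm (Y - X)) * ?A"
    using t lipschitz_on_nonneg[OF L] by (intro mult_right_mono) auto
  finally have "weight k t * \<bar>mehler (\<lambda>z. v \<bullet> z) g t Y - mehler (\<lambda>z. v \<bullet> z) g t X\<bar>
      \<le> weight k t * (L * norm (Y - X) * ?A)"
    using \<beta>_pos[OF t] by (intro mult_left_mono) auto
  moreover have "\<bar>weight k t * mehler (\<lambda>z. v \<bullet> z) g t Y - weight k t * mehler (\<lambda>z. v \<bullet> z) g t X\<bar>
    = weight k t * \<bar>mehler (\<lambda>z. v \<bullet> z) g t Y - mehler (\<lambda>z. v \<bullet> z) g t X\<bar>"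
    using \<beta>_pos[OF t] by (simp add: abs_mult abs_divide flip: right_diff_distrib diff_divide_distrib)
  ultimately show "\<bar>weight k t * mehler (\<lambda>z. v \<bullet> z) g t Y - weight k t * mehler (\<lambda>z. v \<bullet> z) g t X\<bar>
    \<le> L * ?A * weight k t * norm (Y - X)" by (simp only: mult_ac)
qed simp

lemma frechet_D_0: "frechet_D [] f = f"
  by (rule ext) simp

lemma frechet_D_1: "frechet_D [u] f = (\<lambda>X. frechet_derivative f (at X) u)"
  by (rule ext) (simp add: frechet_D_0)

lemma stein_op_derivative:
  assumes g: "exp_bounded g" and int: "stein_integrable k c g"
  shows "frechet_D [u] (stein_op k c g)
    = (\<lambda>X. - (\<integral>t. weight (Suc k) t * mehler (\<lambda>z. T u \<bullet> z) g t X \<partial>half_line))"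
  using frechet_derivative_at[OF stein_op_has_derivative[OF g int]]
  by (auto simp: frechet_D_1 fun_eq_iff)

text \<open>The directions in \<open>Vs\<close> fall on \<open>g\<close>, \<open>v\<close> goes to
  the density, and the outermost \<open>u\<close> is estimated by increments of the derivative along
  \<open>Vs\<close>. The analysis takes place in the base case; the induction step only passes the
  innermost direction to \<open>g\<close>. The constant \<open>L\<close> is universally quantified
  along with \<open>u\<close>, so it may be a Lipschitz constant for that one direction.\<close>

lemma stein_op_smooth_lipschitz:
  assumes "smooth_lipschitz p g" "stein_integrable k c g"
  shows "frechet_differentiable (p + 2) (stein_op k c g) \<and>
    (\<forall>Vs u L. length Vs = p \<longrightarrow>
      (\<forall>X s. \<bar>frechet_D Vs g (X + s *\<^sub>R u) - frechet_D Vs g X\<bar> \<le> L * \<bar>s\<bar>) \<longrightarrow>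
      (\<forall>X. \<bar>frechet_D (u # Vs) (stein_op k c g) X\<bar> \<le> L / real (k + p + 1)) \<and>
      (\<forall>X v. \<bar>frechet_D (u # v # Vs) (stein_op k c g) X\<bar> \<le> stein_const (k + p + 2) * norm (T v) * L))"
  using assms
proof (induction p arbitrary: k c g)
  case 0
  note int = 0(2)
  have g: "exp_bounded g" using 0(1) by (rule smooth_lipschitz_exp_bounded)
  obtain K where K: "K-lipschitz_on UNIV g" using 0 by auto
  have d1: "stein_op k c g differentiable (at X)" for X
    using stein_op_has_derivative[OF g int] by (rule differentiableI)
  have D1: "(stein_op k c g has_derivative frechet_derivative (stein_op k c g) (at X)) (at X)" for X
    using d1 by (simp add: frechet_derivative_works[symmetric])
  have d2: "frechet_D [v] (stein_op k c g) differentiable (at X)" for v X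
    unfolding stein_op_derivative[OF g int]
    by (intro differentiable_minus weighted_differentiable[OF g _ K]) simp
  show ?case
  proof (intro conjI allI impI)
    show "frechet_differentiable (0 + 2) (stein_op k c g)"
      unfolding frechet_differentiable_def
    proof safe
      fix Us :: "'a list" and X assume "length Us < 0 + 2"
      then consider "Us = []" | v where "Us = [v]" by (cases Us) auto
      then show "frechet_D Us (stein_op k c g) differentiable (at X)"
        using d1 d2 by cases (simp_all add: frechet_D_0)
    qed
    fix Vs :: "'a list" and u L X
    assume "length Vs = 0" and L': "\<forall>X s. \<bar>frechet_D Vs g (X + s *\<^sub>R u) - frechet_D Vs g X\<bar> \<le> L * \<bar>s\<bar>"
    then have Vs: "Vs = []" by simp
    have L: "\<bar>g (X + s *\<^sub>R u) - g X\<bar> \<le> L * \<bar>s\<bar>" for X s using L' by (simp add: Vs)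
    have "\<bar>frechet_derivative (stein_op k c g) (at X) u\<bar> \<le> L / real (Suc k)"
      by (rule derivative_le_of_increment_le[OF D1, of 1]) (simp, rule stein_op_increment[OF g int L])
    then show "\<bar>frechet_D (u # Vs) (stein_op k c g) X\<bar> \<le> L / real (k + 0 + 1)"
      by (simp add: Vs frechet_D_0)
    fix v
    have D2: "(frechet_D [v] (stein_op k c g) has_derivative frechet_derivative (frechet_D [v] (stein_op k c g)) (at X)) (at X)"
      using d2 by (simp add: frechet_derivative_works[symmetric])
    have "\<bar>frechet_derivative (frechet_D [v] (stein_op k c g)) (at X) u\<bar> \<le> stein_const (Suc (Suc k)) * norm (T v) * L"
    proof (rule derivative_le_of_increment_le[OF D2, of 1])
      fix s
      show "\<bar>frechet_D [v] (stein_op k c g) (X + s *\<^sub>R u) - frechet_D [v] (stein_op k c g) X\<bar>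
        \<le> stein_const (Suc (Suc k)) * norm (T v) * L * \<bar>s\<bar>"
        using weighted_increment[OF g _ L, of "Suc k" "T v" X s]
        unfolding stein_op_derivative[OF g int] by (simp add: abs_minus_commute)
    qed simp
    then show "\<bar>frechet_D (u # v # Vs) (stein_op k c g) X\<bar> \<le> stein_const (k + 0 + 2) * norm (T v) * L"
      by (simp add: Vs)
  qed
next
  case (Suc p)
  note int = Suc.prems(2)
  have g: "exp_bounded g" using Suc.prems(1) by (rule smooth_lipschitz_exp_bounded)
  have d: "g differentiable (at x)" for x using Suc.prems(1) by simp
  define D where "D = (\<lambda>w x. frechet_derivative g (at x) w)"
  have sD: "smooth_lipschitz p (D w)" for w using Suc.prems(1) by (simp add: D_def)
  then have gD: "exp_bounded (D w)" for w by (rule smooth_lipschitz_exp_bounded)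
  have iD: "stein_integrable (Suc k) 0 (D w)" for w by (rule stein_integrable_Suc[OF gD])
  have comm: "(\<lambda>X. frechet_derivative (stein_op k c g) (at X) w) = stein_op (Suc k) 0 (D w)" for w
    unfolding D_def by (rule stein_op_derivative_commute[OF g d gD[unfolded D_def] int])
  note IH = Suc.IH[OF sD iD]
  show ?case
  proof (intro conjI allI impI)
    have "frechet_differentiable (Suc (p + 2)) (stein_op k c g)"
      unfolding frechet_differentiable_Suc comm
      using IH stein_op_has_derivative[OF g int] by (blast intro: differentiableI)
    then show "frechet_differentiable (Suc p + 2) (stein_op k c g)" by simp
    fix Vs :: "'a list" and u L X
    assume len: "length Vs = Suc p" and L: "\<forall>X s. \<bar>frechet_D Vs g (X + s *\<^sub>R u) - frechet_D Vs g X\<bar> \<le> L * \<bar>s\<bar>"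
    \<comment> \<open>The last entry is the innermost derivative: it turns \<open>g\<close> into
      \<open>D w\<close>, the index \<open>k\<close> into \<open>Suc k\<close> and the constant into
      0.\<close>
    obtain Ws w where Vs: "Vs = Ws @ [w]" using len by (cases Vs rule: rev_cases) auto
    have len': "length Ws = p" using len Vs by simp
    have L': "\<forall>X s. \<bar>frechet_D Ws (D w) (X + s *\<^sub>R u) - frechet_D Ws (D w) X\<bar> \<le> L * \<bar>s\<bar>"
      using L by (simp add: Vs frechet_D_snoc D_def)
    have sn: "frechet_D (Us @ [w]) (stein_op k c g) = frechet_D Us (stein_op (Suc k) 0 (D w))" for Us
      by (simp add: frechet_D_snoc comm)
    have sn1: "frechet_D (u # Vs) (stein_op k c g) = frechet_D (u # Ws) (stein_op (Suc k) 0 (D w))"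
      using sn[of "u # Ws"] unfolding Vs append_Cons .
    have sn2: "frechet_D (u # v # Vs) (stein_op k c g) = frechet_D (u # v # Ws) (stein_op (Suc k) 0 (D w))" for v
      using sn[of "u # v # Ws"] unfolding Vs append_Cons .
    have ar: "Suc k + p + 1 = k + Suc p + 1" "Suc k + p + 2 = k + Suc p + 2" by auto
    show "\<bar>frechet_D (u # Vs) (stein_op k c g) X\<bar> \<le> L / real (k + Suc p + 1)"
      unfolding sn1 ar(1)[symmetric] using IH len' L' by blast
    fix v
    show "\<bar>frechet_D (u # v # Vs) (stein_op k c g) X\<bar> \<le> stein_const (k + Suc p + 2) * norm (T v) * L"
      unfolding sn2 ar(2)[symmetric] using IH len' L' by blast
  qed
qed

text \<open>The Gaussian weight has mean zero, so a constant \<open>m\<close> may be subtracted from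
  \<open>h\<close> before absolute values are taken. This is how the centred supremum norm
  enters.\<close>

lemma stein_op_bounded:
  assumes h: "exp_bounded h" and int: "stein_integrable 0 c h" and C: "\<And>X. \<bar>h X - m\<bar> \<le> C"
  shows "\<bar>frechet_D [u] (stein_op 0 c h) X\<bar> \<le> sqrt (pi / 2) * norm (T u) * C"
proof -
  have C0: "C \<ge> 0" using C[of 0] by simp
  have m: "\<bar>mehler (\<lambda>z. T u \<bullet> z) h t X\<bar> \<le> C * (sqrt (2 / pi) * norm (T u))" for t
  proof -
    have i: "integrable std_gauss (\<lambda>z::'a. T u \<bullet> z)" by (rule exp_bounded_integrable[OF exp_bounded_inner])
    have "mehler (\<lambda>z. T u \<bullet> z) h t X = (\<integral>z. h (flow t X z) * (T u \<bullet> z) - m * (T u \<bullet> z) \<partial>std_gauss)"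
      using mehler_integrable[OF h exp_bounded_inner[of "T u"], of t X] i
      by (simp add: mehler_def integral_std_gauss_inner)
    also have "\<bar>\<dots>\<bar> \<le> (\<integral>z. C * \<bar>T u \<bullet> z\<bar> \<partial>std_gauss)"
    proof (rule order_trans[OF integral_abs_bound], rule integral_mono)
      show "integrable std_gauss (\<lambda>z. \<bar>h (flow t X z) * (T u \<bullet> z) - m * (T u \<bullet> z)\<bar>)"
        by (intro integrable_abs Bochner_Integration.integrable_diff mehler_integrable[OF h exp_bounded_inner] integrable_mult_right i)
      show "integrable std_gauss (\<lambda>z. C * \<bar>T u \<bullet> z\<bar>)" by (intro integrable_mult_right integrable_abs i)
      fix z
      have "\<bar>h (flow t X z) - m\<bar> * \<bar>T u \<bullet> z\<bar> \<le> C * \<bar>T u \<bullet> z\<bar>"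
        by (intro mult_right_mono C) simp
      then show "\<bar>h (flow t X z) * (T u \<bullet> z) - m * (T u \<bullet> z)\<bar> \<le> C * \<bar>T u \<bullet> z\<bar>"
        by (simp only: abs_mult flip: left_diff_distrib)
    qed
    also have "\<dots> = C * (sqrt (2 / pi) * norm (T u))" using abs_inner[of "T u"] by simp
    finally show ?thesis .
  qed
  have "\<bar>frechet_D [u] (stein_op 0 c h) X\<bar> = \<bar>\<integral>t. weight 1 t * mehler (\<lambda>z. T u \<bullet> z) h t X \<partial>half_line\<bar>"
    unfolding stein_op_derivative[OF h int] by simp
  also have "\<dots> \<le> (\<integral>t. C * (sqrt (2 / pi) * norm (T u)) * weight 1 t \<partial>half_line)"
  proof (rule order_trans[OF integral_abs_bound], rule integral_mono)
    show "integrable half_line (\<lambda>t. \<bar>weight 1 t * mehler (\<lambda>z. T u \<bullet> z) h t X\<bar>)"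
      by (intro integrable_abs weighted_integrable[OF h]) simp
    show "integrable half_line (\<lambda>t. C * (sqrt (2 / pi) * norm (T u)) * weight 1 t)"
      by (intro integrable_mult_right exp_div_\<beta>_integrable) simp
    fix t assume "t \<in> space half_line"
    then have t: "t > 0" by simp
    have "weight 1 t * \<bar>mehler (\<lambda>z. T u \<bullet> z) h t X\<bar> \<le> weight 1 t * (C * (sqrt (2 / pi) * norm (T u)))"
      using \<beta>_pos[OF t] by (intro mult_left_mono m) auto
    then show "\<bar>weight 1 t * mehler (\<lambda>z. T u \<bullet> z) h t X\<bar> \<le> C * (sqrt (2 / pi) * norm (T u)) * weight 1 t"
      using \<beta>_pos[OF t] by (simp add: abs_mult mult_ac)
  qed
  also have "\<dots> = C * norm (T u) * (sqrt (2 / pi) * (\<integral>t. weight 1 t \<partial>half_line))"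
    by (simp only: integral_mult_right_zero mult_ac)
  also have "\<dots> = C * norm (T u) * stein_const 1"
    by (subst exp_div_\<beta>_integral) simp_all
  \<comment> \<open>Here Gamma(1/2) = sqrt(pi) and Gamma(1) = 1.\<close>
  also have "stein_const 1 = sqrt (pi / 2)"
    by (simp add: stein_const_def Gamma_one_half_real real_sqrt_divide)
  finally show "\<bar>frechet_D [u] (stein_op 0 c h) X\<bar> \<le> sqrt (pi / 2) * norm (T u) * C"
    by (simp add: mult_ac)
qed

end

section \<open>Function classes\<close>

lemma smooth_lipschitz_add:
  "smooth_lipschitz p f \<Longrightarrow> smooth_lipschitz p g \<Longrightarrow> smooth_lipschitz p (\<lambda>x. f x + g x)"
proof (induction p arbitrary: f g)
  case 0
  then obtain K L where "K-lipschitz_on UNIV f" "L-lipschitz_on UNIV g" by auto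
  then show ?case using lipschitz_on_add by (auto intro!: exI)
next
  case (Suc p)
  have d: "f differentiable (at x)" "g differentiable (at x)" for x using Suc.prems by auto
  have "frechet_derivative (\<lambda>x. f x + g x) (at x) u
    = frechet_derivative f (at x) u + frechet_derivative g (at x) u" for x u
    using has_derivative_add[OF frechet_derivative_works[THEN iffD1, OF d(1)] frechet_derivative_works[THEN iffD1, OF d(2)], THEN frechet_derivative_at, of x]
    by (simp add: fun_eq_iff)
  then show ?case using Suc d by simp
qed

lemma smooth_lipschitz_cmult:
  "smooth_lipschitz p f \<Longrightarrow> smooth_lipschitz p (\<lambda>x. c * f x)"
proof (induction p arbitrary: f)
  case 0
  then obtain K where "K-lipschitz_on UNIV f" by auto
  then show ?case using lipschitz_on_cmult_real by (auto intro!: exI)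
next
  case (Suc p)
  have d: "f differentiable (at x)" for x using Suc.prems by auto
  have "frechet_derivative (\<lambda>x. c * f x) (at x) u = c * frechet_derivative f (at x) u" for x u
    using has_derivative_mult_right[OF frechet_derivative_works[THEN iffD1, OF d], THEN frechet_derivative_at, of c x]
    by (simp add: fun_eq_iff)
  then show ?case using Suc d by simp
qed

lemma smooth_lipschitz_sum:
  assumes "\<And>i. i \<in> I \<Longrightarrow> smooth_lipschitz p (f i)"
  shows "smooth_lipschitz p (\<lambda>x. \<Sum>i\<in>I. f i x)"
proof -
  have zero: "smooth_lipschitz p (\<lambda>_. 0)"
    by (induction p) (auto intro: lipschitz_intros)
  show ?thesis using assms
    by (induction I rule: infinite_finite_induct) (auto intro: smooth_lipschitz_add zero)
qed

text \<open>The coordinates of the displacement are switched on one at a time. \<open>P A u\<close>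
  is the displacement with the coordinates in \<open>A\<close>, each further coordinate is handled
  by the mean value theorem, and induction over \<open>A\<close> telescopes the
  contributions.\<close>

lemma has_derivative_of_continuous_partials:
  fixes g :: "'a::euclidean_space \<Rightarrow> real"
  assumes d: "\<And>b x. b \<in> Basis \<Longrightarrow> ((\<lambda>t. g (x + t *\<^sub>R b)) has_real_derivative D b x) (at 0)"
    and c: "\<And>b. b \<in> Basis \<Longrightarrow> isCont (D b) x"
  shows "(g has_derivative (\<lambda>v. \<Sum>b\<in>Basis. (v \<bullet> b) * D b x)) (at x)"
proof -
  define P where "P = (\<lambda>A (u::'a). \<Sum>b\<in>A. (u \<bullet> b) *\<^sub>R b)"
  have Pn: "norm (P A u) \<le> real (card A) * norm u" if "A \<subseteq> Basis" for A u
  proof -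
    have "norm (P A u) \<le> (\<Sum>b\<in>A. norm ((u \<bullet> b) *\<^sub>R b))" unfolding P_def by (rule norm_sum)
    also have "\<dots> \<le> (\<Sum>b\<in>A. norm u)" using that by (intro sum_mono) (auto simp: Basis_le_norm subset_iff)
    finally show ?thesis by simp
  qed
  have step: "((\<lambda>u. g (x + P A u + (u \<bullet> a) *\<^sub>R a) - g (x + P A u)) has_derivative (\<lambda>u. (u \<bullet> a) * D a x)) (at 0)"
    if A: "A \<subseteq> Basis" and a: "a \<in> Basis" for A a
    unfolding has_derivative_at_alt
  proof (intro conjI allI impI)
    show "bounded_linear (\<lambda>u. (u \<bullet> a) * D a x)"
      by (intro bounded_linear_mult_left[THEN bounded_linear_compose] bounded_linear_inner_left)
    fix e :: real assume "e > 0"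
    then obtain \<delta> where \<delta>: "\<delta> > 0" "\<And>y. norm (y - x) < \<delta> \<Longrightarrow> \<bar>D a y - D a x\<bar> < e"
      using c[OF a] unfolding continuous_at_eps_delta dist_norm real_norm_def by meson
    \<comment> \<open>The intermediate point of the mean value theorem lies within
      \<open>M * norm u\<close> of \<open>x\<close>.\<close>
    define M where "M = real (card A) + 1"
    have M: "M > 0" by (simp add: M_def add_nonneg_pos)
    show "\<exists>d>0. \<forall>u. norm (u - 0) < d \<longrightarrow>
      norm (g (x + P A u + (u \<bullet> a) *\<^sub>R a) - g (x + P A u) - (g (x + P A 0 + (0 \<bullet> a) *\<^sub>R a) - g (x + P A 0)) - ((u - 0) \<bullet> a) * D a x) \<le> e * norm (u - 0)"
    proof (intro exI conjI allI impI)
      show "\<delta> / M > 0" using \<delta> M by simp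
      fix u :: 'a assume u: "norm (u - 0) < \<delta> / M"
      define y where "y = x + P A u"
      define h where "h = u \<bullet> a"
      define \<phi> where "\<phi> = (\<lambda>s. g (y + (s * h) *\<^sub>R a))"
      have h: "\<bar>h\<bar> \<le> norm u" unfolding h_def using Basis_le_norm[OF a] .
      have "(\<phi> has_real_derivative h * D a (y + (s * h) *\<^sub>R a)) (at s)" for s
      proof -
        have "((\<lambda>s'. (s' - s) * h) has_real_derivative h) (at s)" by (auto intro!: derivative_eq_intros)
        moreover have "((\<lambda>t. g (y + (s * h) *\<^sub>R a + t *\<^sub>R a)) has_real_derivative D a (y + (s * h) *\<^sub>R a)) (at ((s - s) * h))"
          using d[OF a] by simp
        ultimately have "((\<lambda>s'. g (y + (s * h) *\<^sub>R a + ((s' - s) * h) *\<^sub>R a)) has_real_derivative D a (y + (s * h) *\<^sub>R a) * h) (at s)"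
          by (rule DERIV_chain2[rotated])
        then show ?thesis by (simp add: \<phi>_def algebra_simps)
      qed
      then obtain r where r: "0 < r" "r < 1" "\<phi> 1 - \<phi> 0 = (1 - 0) * (h * D a (y + (r * h) *\<^sub>R a))"
        using MVT2[of 0 1 \<phi> "\<lambda>s. h * D a (y + (s * h) *\<^sub>R a)"] by auto
      have "norm (y + (r * h) *\<^sub>R a - x) \<le> norm (P A u) + norm ((r * h) *\<^sub>R a)"
        unfolding y_def by (metis add_diff_cancel_left' add.assoc norm_triangle_ineq)
      also have "\<dots> \<le> real (card A) * norm u + 1 * norm u"
      proof (rule add_mono[OF Pn[OF A]])
        have "norm ((r * h) *\<^sub>R a) = r * \<bar>h\<bar>" using r a by (simp add: abs_mult)
        also have "\<dots> \<le> 1 * norm u" using r h by (intro mult_mono) auto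
        finally show "norm ((r * h) *\<^sub>R a) \<le> 1 * norm u" .
      qed
      also have "\<dots> = M * norm u" by (simp add: M_def distrib_right)
      also have "\<dots> < \<delta>" using u M by (simp add: field_simps)
      finally have De: "\<bar>D a (y + (r * h) *\<^sub>R a) - D a x\<bar> \<le> e" using \<delta>(2) by fastforce
      have "g (y + h *\<^sub>R a) - g y - h * D a x = h * (D a (y + (r * h) *\<^sub>R a) - D a x)"
        using r(3) by (simp add: \<phi>_def right_diff_distrib)
      then have "\<bar>g (y + h *\<^sub>R a) - g y - h * D a x\<bar> \<le> norm u * e"
        unfolding abs_mult using h De by (simp add: abs_mult mult_mono)
      then show "norm (g (x + P A u + (u \<bullet> a) *\<^sub>R a) - g (x + P A u) - (g (x + P A 0 + (0 \<bullet> a) *\<^sub>R a) - g (x + P A 0)) - ((u - 0) \<bullet> a) * D a x) \<le> e * norm (u - 0)"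
        by (simp add: y_def h_def mult.commute)
    qed
  qed
  have "finite A \<Longrightarrow> A \<subseteq> Basis \<Longrightarrow> ((\<lambda>u. g (x + P A u)) has_derivative (\<lambda>u. \<Sum>b\<in>A. (u \<bullet> b) * D b x)) (at 0)" for A
  proof (induction A rule: finite_induct)
    case empty
    then show ?case by (simp add: P_def)
  next
    case (insert a A)
    have "((\<lambda>u. (g (x + P A u + (u \<bullet> a) *\<^sub>R a) - g (x + P A u)) + g (x + P A u)) has_derivative
      (\<lambda>u. (u \<bullet> a) * D a x + (\<Sum>b\<in>A. (u \<bullet> b) * D b x))) (at 0)"
      using insert by (intro has_derivative_add step) auto
    then show ?case using insert.hyps by (simp add: P_def algebra_simps)
  qed
  from this[of Basis] have 1: "((\<lambda>u. g (x + u)) has_derivative (\<lambda>u. \<Sum>b\<in>Basis. (u \<bullet> b) * D b x)) (at (x - x))"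
    by (simp add: P_def euclidean_representation)
  have 2: "((\<lambda>y. y - x) has_derivative (\<lambda>h. h)) (at x)" by (auto intro!: derivative_eq_intros)
  show ?thesis using has_derivative_compose[OF 2 1] by simp
qed

lemma smooth_lipschitz_frechet_differentiable:
  "smooth_lipschitz p g \<Longrightarrow> frechet_differentiable p g"
  by (induction p arbitrary: g) (auto simp: frechet_differentiable_Suc, simp add: frechet_differentiable_def)

lemma smooth_lipschitz_frechet_D:
  "smooth_lipschitz p g \<Longrightarrow> length Us = p \<Longrightarrow> \<exists>L. L-lipschitz_on UNIV (frechet_D Us g)"
proof (induction p arbitrary: g Us)
  case 0
  have "frechet_D [] g = g" by (rule ext) simp
  then show ?case using 0 by auto
next
  case (Suc p)
  then obtain Vs u where Us: "Us = Vs @ [u]" by (cases Us rule: rev_cases) auto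
  show ?case unfolding Us frechet_D_snoc using Suc.prems Us by (intro Suc.IH) auto
qed

lemma nabla_frechet_derivative:
  assumes "f differentiable (at X)"
  shows "has_nabla i j f X" "nabla i j f X = frechet_derivative f (at X) (unit_mat i j)"
proof -
  have "(f has_derivative frechet_derivative f (at X)) (at X)"
    using assms by (simp add: frechet_derivative_works[symmetric])
  from directional_quotient_tendsto[OF this, of "unit_mat i j"]
  have "((\<lambda>t. f (X + t *\<^sub>R unit_mat i j)) has_real_derivative frechet_derivative f (at X) (unit_mat i j)) (at 0)"
    by (simp add: DERIV_def)
  then show "has_nabla i j f X" "nabla i j f X = frechet_derivative f (at X) (unit_mat i j)"
    unfolding has_nabla_def nabla_def
    by (auto simp: DERIV_imp_deriv real_differentiable_def)
qed

lemma nablas_Cons: "nablas (p # ps) f = nabla (fst p) (snd p) (nablas ps f)"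
  by (simp add: nablas_def case_prod_unfold)

lemma nablas_Nil: "nablas [] f = f"
  by (simp add: nablas_def)

lemma nablas_snoc: "nablas (ps @ [(i, j)]) f = nablas ps (nabla i j f)"
  by (simp add: nablas_def)

lemma nablas_eq_frechet_D:
  assumes "frechet_differentiable m f" "length ps \<le> m"
  shows "nablas ps f = frechet_D (map (\<lambda>p. unit_mat (fst p) (snd p)) ps) f"
  using assms(2)
proof (induction ps)
  case Nil
  then show ?case by (auto simp: nablas_Nil)
next
  case (Cons p ps)
  then have eq: "nablas ps f = frechet_D (map (\<lambda>p. unit_mat (fst p) (snd p)) ps) f" by simp
  show ?case
  proof
    fix X
    have "frechet_D (map (\<lambda>p. unit_mat (fst p) (snd p)) ps) f differentiable (at X)"
      using assms(1) Cons.prems by (auto simp: frechet_differentiable_def)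
    then show "nablas (p # ps) f X = frechet_D (map (\<lambda>p. unit_mat (fst p) (snd p)) (p # ps)) f X"
      by (simp add: nablas_Cons eq nabla_frechet_derivative)
  qed
qed

lemma frechet_differentiable_partials_exist:
  fixes f :: "real ^ 'd ^ 'n \<Rightarrow> real"
  assumes "frechet_differentiable m f"
  shows "partials_exist m f"
  unfolding partials_exist_def
proof (intro allI impI)
  fix ps :: "('n \<times> 'd) list" and i j X assume len: "length ps < m"
  then have "frechet_D (map (\<lambda>p. unit_mat (fst p) (snd p)) ps) f differentiable (at X)"
    using assms by (auto simp: frechet_differentiable_def)
  then show "has_nabla i j (nablas ps f) X"
    using nablas_eq_frechet_D[OF assms, of ps] len by (simp add: nabla_frechet_derivative)
qed

lemma holder_class_bound:
  assumes "h \<in> holder_class \<alpha>"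
  obtains C where "0 \<le> C" "\<forall>x y. \<bar>h x - h y\<bar> \<le> C * norm (x - y) powr \<alpha>"
proof -
  have "holder_seminorm \<alpha> h \<noteq> \<infinity>" using assms by (simp add: holder_class_def)
  then obtain n :: nat where n: "holder_seminorm \<alpha> h < ereal (real n)"
    unfolding less_PInf_Ex_of_nat by blast
  have "\<bar>h x - h y\<bar> \<le> real n * norm (x - y) powr \<alpha>" for x y
  proof (cases "x = y")
    case False
    have "ereal (\<bar>h x - h y\<bar> / norm (x - y) powr \<alpha>) \<le> holder_seminorm \<alpha> h"
      unfolding holder_seminorm_def using False by (intro SUP_upper2[of "(x, y)"]) auto
    then have "ereal (\<bar>h x - h y\<bar> / norm (x - y) powr \<alpha>) < ereal (real n)" using n by (rule le_less_trans)
    then show ?thesis using False by (simp add: divide_less_eq)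
  qed simp
  then show ?thesis by (intro that[of "real n"]) auto
qed

lemma holder_class_1_lipschitz:
  fixes h :: "'a::real_normed_vector \<Rightarrow> real"
  shows "h \<in> holder_class 1 \<longleftrightarrow> (\<exists>L. L-lipschitz_on UNIV h)"
proof
  assume "h \<in> holder_class 1"
  then obtain C where "0 \<le> C" "\<forall>x y. \<bar>h x - h y\<bar> \<le> C * norm (x - y) powr 1" by (rule holder_class_bound)
  then have "C-lipschitz_on UNIV h" by (auto simp: lipschitz_on_def dist_real_def dist_norm)
  then show "\<exists>L. L-lipschitz_on UNIV h" ..
next
  assume "\<exists>L. L-lipschitz_on UNIV h"
  then obtain L where L: "L-lipschitz_on UNIV h" ..
  have "holder_seminorm 1 h \<le> ereal L"
    unfolding holder_seminorm_def
    using lipschitz_onD[OF L] by (auto intro!: SUP_least simp: dist_real_def dist_norm divide_le_eq)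
  then show "h \<in> holder_class 1" by (auto simp: holder_class_def intro: le_less_trans)
qed

lemma has_derivative_of_continuous_nablas:
  fixes h :: "real ^ 'd ^ 'n \<Rightarrow> real"
  assumes ex: "\<And>i j X. has_nabla i j h X" and c: "\<And>i j. continuous_on UNIV (nabla i j h)"
  shows "(h has_derivative (\<lambda>v. \<Sum>p\<in>UNIV. (v \<bullet> unit_mat (fst p) (snd p)) * nabla (fst p) (snd p) h X)) (at X)"
proof -
  define D where "D = (\<lambda>b X. deriv (\<lambda>t. h (X + t *\<^sub>R b)) 0)"
  have un: "\<exists>i j. b = unit_mat i j" if "b \<in> (Basis :: (real ^ 'd ^ 'n) set)" for b
  proof -
    have "b \<in> range (\<lambda>(i, j). unit_mat i j)"
      using that by (simp only: bij_betw_imp_surj_on[OF unit_mat_bij_Basis])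
    then obtain p where "b = (case p of (i, j) \<Rightarrow> unit_mat i j)" by blast
    then show ?thesis by (cases p) auto
  qed
  have nD: "D (unit_mat i j) = nabla i j h" for i j by (simp add: D_def nabla_def fun_eq_iff)
  have "(h has_derivative (\<lambda>v. \<Sum>b\<in>Basis. (v \<bullet> b) * D b X)) (at X)"
  proof (rule has_derivative_of_continuous_partials)
    fix b :: "real ^ 'd ^ 'n" and x assume "b \<in> Basis"
    then obtain i j where b: "b = unit_mat i j" using un by blast
    show "((\<lambda>t. h (x + t *\<^sub>R b)) has_real_derivative D b x) (at 0)"
      using ex[of i j x] unfolding has_nabla_def D_def b
      by (simp add: DERIV_deriv_iff_real_differentiable)
    show "isCont (D b) X" using c[of i j] unfolding b nD
      by (simp add: continuous_on_eq_continuous_at)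
  qed
  also have "(\<lambda>v. \<Sum>b\<in>Basis. (v \<bullet> b) * D b X) = (\<lambda>v. \<Sum>p\<in>UNIV. (v \<bullet> unit_mat (fst p) (snd p)) * nabla (fst p) (snd p) h X)"
    by (intro ext) (simp add: sum.reindex_bij_betw[OF unit_mat_bij_Basis, symmetric] case_prod_unfold nD)
  finally show ?thesis .
qed

text \<open>The first partial derivatives belong to the class one lower, so by induction they are
  regular and in particular continuous. Hence \<open>h\<close> is Frechet differentiable, and its
  derivative in any direction is a fixed linear combination of them.\<close>

lemma Lip_class_smooth_lipschitz:
  fixes h :: "real ^ 'd ^ 'n \<Rightarrow> real"
  shows "h \<in> Lip_class p \<Longrightarrow> smooth_lipschitz p h"
proof (induction p arbitrary: h)
  case 0
  then have "nablas [] h \<in> holder_class 1" by (auto simp: Lip_class_def)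
  then show ?case by (simp add: nablas_Nil holder_class_1_lipschitz)
next
  case (Suc p)
  have n: "nabla i j h \<in> Lip_class p" for i j
    unfolding Lip_class_def partials_exist_def
  proof (intro CollectI conjI allI impI)
    fix ps :: "('n \<times> 'd) list" and i' j' X assume "length ps < p"
    then have "has_nabla i' j' (nablas (ps @ [(i, j)]) h) X"
      using Suc.prems by (auto simp: Lip_class_def partials_exist_def)
    then show "has_nabla i' j' (nablas ps (nabla i j h)) X" by (simp add: nablas_snoc)
  next
    fix ps :: "('n \<times> 'd) list" assume "length ps = p"
    then have "nablas (ps @ [(i, j)]) h \<in> holder_class 1"
      using Suc.prems by (auto simp: Lip_class_def)
    then show "nablas ps (nabla i j h) \<in> holder_class 1" by (simp add: nablas_snoc)
  qed
  have sl: "smooth_lipschitz p (nabla i j h)" for i j using n by (rule Suc.IH)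
  have "has_nabla i j (nablas [] h) X" for i j X
    using Suc.prems by (auto simp: Lip_class_def partials_exist_def)
  then have ex: "has_nabla i j h X" for i j X by (simp add: nablas_Nil)
  have c: "continuous_on UNIV (nabla i j h)" for i j
    using sl by (intro exp_bounded_continuous smooth_lipschitz_exp_bounded)
  note D = has_derivative_of_continuous_nablas[OF ex c]
  have "smooth_lipschitz p (\<lambda>X. frechet_derivative h (at X) u)" for u
    unfolding frechet_derivative_at[OF D, symmetric]
    by (intro smooth_lipschitz_sum smooth_lipschitz_cmult sl)
  then show ?case using D by (auto intro: differentiableI)
qed

text \<open>Bounded partial derivatives of order \<open>Suc m\<close> bound the full derivative of
  every partial derivative of order \<open>m\<close>, which is therefore Lipschitz.\<close>

lemma Cb_class_Lip_class:
  fixes h :: "real ^ 'd ^ 'n \<Rightarrow> real"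
  assumes h: "h \<in> Cb_class (Suc m)"
  shows "h \<in> Lip_class m"
proof -
  have fd: "frechet_differentiable (Suc m) h" using h by (simp add: Cb_class_def)
  have "nablas ps h \<in> holder_class 1" if len: "length ps = m" for ps
  proof -
    let ?g = "nablas ps h"
    have d: "?g differentiable (at X)" for X
      using nablas_eq_frechet_D[OF fd, of ps] fd len by (auto simp: frechet_differentiable_def)
    have "\<forall>p. \<exists>B. \<forall>X. \<bar>nabla (fst p) (snd p) ?g X\<bar> \<le> B"
    proof
      fix p
      have "bounded (range (nablas (p # ps) h))" using h len by (simp add: Cb_class_def)
      then show "\<exists>B. \<forall>X. \<bar>nabla (fst p) (snd p) ?g X\<bar> \<le> B" by (auto simp: bounded_iff nablas_Cons)
    qed
    then obtain B where B: "\<And>p X. \<bar>nabla (fst p) (snd p) ?g X\<bar> \<le> B p" by metis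
    have B0: "0 \<le> B p" for p using B[of p undefined] by linarith
    have D: "(?g has_derivative frechet_derivative ?g (at X)) (at X)" for X
      using d by (simp add: frechet_derivative_works[symmetric])
    have bd: "\<bar>frechet_derivative ?g (at X) v\<bar> \<le> (\<Sum>p\<in>UNIV. B p) * norm v" for X v
    proof -
      interpret linear "frechet_derivative ?g (at X)" using D by (rule has_derivative_linear)
      have "v = (\<Sum>b\<in>Basis. (v \<bullet> b) *\<^sub>R b)" by (simp add: euclidean_representation)
      also have "\<dots> = (\<Sum>p\<in>UNIV. (v \<bullet> unit_mat (fst p) (snd p)) *\<^sub>R unit_mat (fst p) (snd p))"
        by (simp add: sum.reindex_bij_betw[OF unit_mat_bij_Basis, symmetric] case_prod_unfold)
      finally have "frechet_derivative ?g (at X) v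
        = frechet_derivative ?g (at X) (\<Sum>p\<in>UNIV. (v \<bullet> unit_mat (fst p) (snd p)) *\<^sub>R unit_mat (fst p) (snd p))"
        by (rule arg_cong)
      also have "\<dots> = (\<Sum>p\<in>UNIV. (v \<bullet> unit_mat (fst p) (snd p)) * nabla (fst p) (snd p) ?g X)"
        by (simp add: sum scaleR nabla_frechet_derivative(2)[OF d])
      also have "\<bar>\<dots>\<bar> \<le> (\<Sum>p\<in>UNIV. \<bar>(v \<bullet> unit_mat (fst p) (snd p)) * nabla (fst p) (snd p) ?g X\<bar>)" by (rule sum_abs)
      also have "\<dots> \<le> (\<Sum>p\<in>UNIV. norm v * B p)"
      proof (rule sum_mono)
        fix p
        have "(unit_mat (fst p) (snd p) :: real ^ 'd ^ 'n) \<in> Basis"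
          using unit_mat_bij_Basis by (auto simp: bij_betw_def case_prod_unfold)
        then have "\<bar>v \<bullet> unit_mat (fst p) (snd p)\<bar> \<le> norm v" by (rule Basis_le_norm)
        then show "\<bar>(v \<bullet> unit_mat (fst p) (snd p)) * nabla (fst p) (snd p) ?g X\<bar> \<le> norm v * B p"
          unfolding abs_mult using B by (intro mult_mono) auto
      qed
      finally show ?thesis by (simp only: sum_distrib_left mult.commute[of "sum B UNIV"])
    qed
    have "(\<Sum>p\<in>UNIV. B p)-lipschitz_on UNIV ?g"
    proof (rule lipschitz_onI)
      fix x y
      have "\<bar>?g (y + 1 *\<^sub>R (x - y)) - ?g y\<bar> \<le> ((\<Sum>p\<in>UNIV. B p) * norm (x - y)) * \<bar>1\<bar>"
        by (rule directional_lipschitz[OF d bd])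
      then show "dist (?g x) (?g y) \<le> (\<Sum>p\<in>UNIV. B p) * dist x y" by (simp add: dist_real_def dist_norm)
    qed (simp add: sum_nonneg B0)
    then show ?thesis by (auto simp: holder_class_1_lipschitz)
  qed
  then show ?thesis
    using frechet_differentiable_partials_exist[OF fd] by (auto simp: Lip_class_def partials_exist_def)
qed

lemma holder_class_holder_growth:
  assumes "0 < \<alpha>" "\<alpha> \<le> 1" "h \<in> holder_class \<alpha>"
  shows "holder_growth h"
proof -
  obtain C where "0 \<le> C" "\<forall>x y. \<bar>h x - h y\<bar> \<le> C * norm (x - y) powr \<alpha>"
    using assms(3) by (rule holder_class_bound)
  then show ?thesis
    unfolding holder_growth_def using assms by (intro exI[of _ \<alpha>] exI[of _ C] exI[of _ 0]) simp
qed

section \<open>The matrix normal Stein equation\<close>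

lemma ess_sup_norm_nonneg: "0 \<le> ess_sup_norm (g :: 'a::euclidean_space \<Rightarrow> real)"
proof (rule ccontr)
  assume neg: "\<not> 0 \<le> ess_sup_norm g"
  have "AE X in lebesgue. ereal \<bar>g X\<bar> \<le> ess_sup_norm g"
    unfolding ess_sup_norm_def by (rule esssup_AE)
  then have "AE X in (lebesgue :: 'a measure). False"
  proof eventually_elim
    case (elim X)
    then have "ereal \<bar>g X\<bar> < 0" by (rule le_less_trans) (use neg in simp)
    then show ?case by simp
  qed
  then show False by (simp add: eventually_const_iff ae_filter_eq_bot_iff)
qed

lemma sup_norm_nonneg: "0 \<le> sup_norm g"
  unfolding sup_norm_def by (rule SUP_upper2[of undefined]) auto

lemma unit_vector_list_exists: "\<exists>Us :: 'a::euclidean_space list. length Us = k \<and> (\<forall>U\<in>set Us. norm U = 1)"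
proof -
  obtain b :: 'a where "norm b = 1" using vector_choose_size[of 1] by auto
  then show ?thesis by (intro exI[of _ "replicate k b"]) auto
qed

lemma deriv_norm_upper:
  "length Us = k \<Longrightarrow> \<forall>U\<in>set Us. norm U = 1 \<Longrightarrow> ereal \<bar>frechet_D Us g X\<bar> \<le> deriv_norm k g"
  unfolding deriv_norm_def by (rule SUP_upper2[of X], simp, rule SUP_upper) auto

lemma deriv_norm_nonneg: "0 \<le> deriv_norm k (g :: 'a::euclidean_space \<Rightarrow> real)"
proof -
  obtain Us :: "'a list" where "length Us = k" "\<forall>U\<in>set Us. norm U = 1"
    using unit_vector_list_exists by blast
  from deriv_norm_upper[OF this, of g 0] show ?thesis
    by (rule order_trans[rotated]) simp
qed

text \<open>Reduction to real bounds \<open>L\<close>. If \<open>B\<close> is infinite, positivity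
  of \<open>c\<close> keeps the right-hand side infinite; nonnegativity of \<open>B\<close> excludes
  minus infinity.\<close>

lemma sup_norm_le_mult:
  assumes "0 < c" "0 \<le> B" "\<And>L X. B \<le> ereal L \<Longrightarrow> \<bar>g X\<bar> \<le> c * L"
  shows "sup_norm g \<le> ereal c * B"
proof (cases B)
  case (real r)
  then show ?thesis using assms(3)[of r] by (auto simp: sup_norm_def intro!: SUP_least)
qed (use assms in auto)

lemma deriv_norm_le_mult:
  assumes "0 < c" "0 \<le> B"
    "\<And>L X Us. B \<le> ereal L \<Longrightarrow> length Us = k \<Longrightarrow> \<forall>U\<in>set Us. norm U = 1 \<Longrightarrow> \<bar>frechet_D Us g X\<bar> \<le> c * L"
  shows "deriv_norm k g \<le> ereal c * B"
proof (cases B)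
  case (real r)
  then show ?thesis using assms(3)[of r] by (auto simp: deriv_norm_def intro!: SUP_least)
qed (use assms in auto)

text \<open>The derivative along \<open>qs\<close> is globally Lipschitz, so an essential bound on
  its next partial derivative is a Lipschitz constant in the direction of \<open>q\<close>, as the
  increment hypothesis of the solution bounds demands.\<close>

lemma directional_lipschitz_of_ess_bound:
  fixes h :: "real ^ 'd ^ 'n \<Rightarrow> real"
  assumes h: "smooth_lipschitz (length qs) h" and L: "ess_sup_norm (nablas (q # qs) h) \<le> ereal L"
  defines "V \<equiv> map (\<lambda>p. unit_mat (fst p) (snd p)) qs"
  shows "\<bar>frechet_D V h (X + s *\<^sub>R unit_mat (fst q) (snd q)) - frechet_D V h X\<bar> \<le> L * \<bar>s\<bar>"
proof -
  have eq: "nablas qs h = frechet_D V h"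
    unfolding V_def by (rule nablas_eq_frechet_D[OF smooth_lipschitz_frechet_differentiable[OF h]]) simp
  obtain K where "K-lipschitz_on UNIV (frechet_D V h)"
    using smooth_lipschitz_frechet_D[OF h, of V] by (auto simp: V_def)
  then show ?thesis
    using L unfolding nablas_Cons eq by (rule nabla_ess_bound_imp_lipschitz)
qed

lemma directional_lipschitz_of_deriv_norm:
  assumes h: "frechet_differentiable (Suc (length Vs)) h" and L: "deriv_norm (Suc (length Vs)) h \<le> ereal L"
    and U: "norm U = 1" "\<forall>V\<in>set Vs. norm V = 1"
  shows "\<bar>frechet_D Vs h (X + s *\<^sub>R U) - frechet_D Vs h X\<bar> \<le> L * \<bar>s\<bar>"
proof (rule directional_lipschitz)
  show "frechet_D Vs h differentiable (at y)" for y using h by (simp add: frechet_differentiable_def)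
  show "\<bar>frechet_derivative (frechet_D Vs h) (at y) U\<bar> \<le> L" for y
    using order_trans[OF deriv_norm_upper[of "U # Vs" "Suc (length Vs)" h y] L] U by simp
qed

lemma bounded_linear_sandwich: "bounded_linear (\<lambda>z :: real ^ 'd ^ 'n. A ** z ** B)"
proof (rule linear_conv_bounded_linear[THEN iffD1], rule linearI)
  show "A ** (x + y) ** B = A ** x ** B + A ** y ** B" for x y
    by (simp add: matrix_matrix_mult_def vec_eq_iff sum.distrib distrib_left distrib_right)
  show "A ** (c *\<^sub>R x) ** B = c *\<^sub>R (A ** x ** B)" for c x
    by (simp add: matrix_scalar_ac scalar_matrix_assoc)
qed

locale matrix_normal =
  fixes \<Psi> :: "real ^ 'n ^ 'n" and \<Sigma> :: "real ^ 'd ^ 'd" and M :: "'w measure" and Z :: "'w \<Rightarrow> real ^ 'd ^ 'n"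
  assumes \<Psi>: "sym_pos_def \<Psi>" and \<Sigma>: "sym_pos_def \<Sigma>" and Z: "std_normal_matrix M Z"
begin

abbreviation "sol \<equiv> stein_solution M Z \<Psi> \<Sigma>"

abbreviation "mean \<equiv> normal_mean M Z \<Psi> \<Sigma>"

abbreviation "\<sigma>\<^sub>1 \<equiv> spectral_norm (matrix_inv (mat_sqrt \<Psi>))"

abbreviation "\<sigma>\<^sub>2 \<equiv> spectral_norm (matrix_inv (mat_sqrt \<Sigma>))"

definition whiten :: "real ^ 'd ^ 'n \<Rightarrow> real ^ 'd ^ 'n" where
  "whiten U = matrix_inv (mat_sqrt \<Psi>) ** U ** matrix_inv (mat_sqrt \<Sigma>)"

definition colour :: "real ^ 'd ^ 'n \<Rightarrow> real ^ 'd ^ 'n" where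
  "colour U = mat_sqrt \<Psi> ** U ** mat_sqrt \<Sigma>"

lemma colour_whiten: "colour (whiten U) = U"
proof -
  have "colour (whiten U) = (mat_sqrt \<Psi> ** matrix_inv (mat_sqrt \<Psi>)) ** U ** (matrix_inv (mat_sqrt \<Sigma>) ** mat_sqrt \<Sigma>)"
    by (simp only: colour_def whiten_def matrix_mul_assoc)
  then show ?thesis by (simp add: mat_sqrt_inv[OF \<Psi>] mat_sqrt_inv[OF \<Sigma>])
qed

sublocale gaussian_semigroup colour whiten
proof (rule gaussian_semigroup.intro)
  show "bounded_linear colour" "bounded_linear whiten"
    unfolding colour_def whiten_def by (rule bounded_linear_sandwich)+
qed (simp_all only: colour_whiten std_normal_matrix_abs_inner[OF Z])

lemma integral_coloured:
  fixes f :: "real ^ 'd ^ 'n \<Rightarrow> real"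
  assumes "f \<in> borel_measurable borel"
  shows "(\<integral>\<omega>. f (Z \<omega>) \<partial>M) = (\<integral>z. f z \<partial>std_gauss)"
  using integral_distr[OF std_normal_matrix_distr(1)[OF Z] assms] std_normal_matrix_distr(2)[OF Z] by simp

lemma normal_mean_eq:
  assumes "exp_bounded h"
  shows "mean h = (\<integral>z. h (colour z) \<partial>std_gauss)"
proof -
  note [measurable] = exp_bounded_measurable[OF assms]
  show ?thesis unfolding normal_mean_def colour_def[symmetric] by (rule integral_coloured) measurable
qed

lemma stein_solution_eq:
  assumes h: "exp_bounded h"
  shows "sol h = stein_op 0 (mean h) h"
proof
  fix X
  note [measurable] = exp_bounded_measurable[OF h] mehler_measurable[OF h exp_bounded_const[of 1]]
  have inner: "(\<integral>\<omega>. h (exp (- t) *\<^sub>R X + sqrt (1 - exp (- 2 * t)) *\<^sub>R (mat_sqrt \<Psi> ** Z \<omega> ** mat_sqrt \<Sigma>)) \<partial>M)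
      = ou h t X" for t
    unfolding mehler_def \<beta>_def colour_def[symmetric] mult_1_right
    by (rule integral_coloured) measurable
  define f where "f = (\<lambda>t. ou h t X - mean h)"
  have fm: "f \<in> borel_measurable borel"
    unfolding f_def by measurable
  \<comment> \<open>The solution is defined over the closed half line; the added point 0 has measure
    zero.\<close>
  have "(LINT t:{0..}|lborel. f t) = (LINT t:{0<..}|lborel. f t)"
    unfolding set_lebesgue_integral_def
  proof (rule integral_cong_AE)
    show "AE t in lborel. indicat_real {0..} t *\<^sub>R f t = indicat_real {0<..} t *\<^sub>R f t"
      using AE_lborel_singleton[of 0] by eventually_elim (auto simp: indicator_def)
  qed (use fm in auto)
  then show "sol h X = stein_op 0 (mean h) h X"
    unfolding stein_solution_def inner stein_op_def half_line_integral
    by (simp add: f_def set_lebesgue_integral_def)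
qed

lemma stein_integrable_solution: "holder_growth h \<Longrightarrow> stein_integrable 0 (mean h) h"
  using stein_integrable_0 by (simp add: normal_mean_eq holder_growth_exp_bounded)

lemma norm_whiten_unit_mat:
  "norm (whiten (unit_mat i j)) = sqrt (matrix_inv \<Psi> $ i $ i * matrix_inv \<Sigma> $ j $ j)"
  unfolding whiten_def by (rule norm_sandwich_unit_mat[OF \<Psi> \<Sigma>])

text \<open>\<open>colour\<close> inverts \<open>whiten\<close> from the left, so only 0 is whitened
  to 0. Strict positivity keeps the constants in the bounds nonzero when the norm of the test
  function is infinite.\<close>

lemma norm_whiten_pos: "U \<noteq> 0 \<Longrightarrow> 0 < norm (whiten U)"
proof -
  have "colour 0 = 0" using S by (simp add: linear_simps)
  then show "U \<noteq> 0 \<Longrightarrow> 0 < norm (whiten U)" using colour_whiten[of U] by auto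
qed

lemma norm_whiten_le:
  "norm (whiten U) \<le> \<sigma>\<^sub>1 * \<sigma>\<^sub>2 * norm U"
  unfolding whiten_def by (rule norm_sandwich_le) (rule mat_sqrt_inv[OF \<Sigma>])

lemma spectral_norms_pos:
  "0 < \<sigma>\<^sub>1 * \<sigma>\<^sub>2"
proof -
  obtain U :: "real ^ 'd ^ 'n" where U: "norm U = 1" using vector_choose_size[of 1] by auto
  then have "U \<noteq> 0" by auto
  from less_le_trans[OF norm_whiten_pos[OF this] norm_whiten_le] show ?thesis using U by simp
qed

lemma norm_whiten_unit_mat_pos: "0 < norm (whiten (unit_mat i j))"
proof (rule norm_whiten_pos)
  have "(unit_mat i j :: real ^ 'd ^ 'n) $ i $ j = 1" by (simp add: unit_mat_def axis_def)
  then show "(unit_mat i j :: real ^ 'd ^ 'n) \<noteq> 0" by auto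
qed

lemma stein_const_pos: "m > 0 \<Longrightarrow> 0 < stein_const m"
  unfolding stein_const_def by (intro divide_pos_pos mult_pos_pos Gamma_real_pos) auto

lemma
  assumes h: "smooth_lipschitz p h"
  shows solution_differentiable: "frechet_differentiable (p + 2) (sol h)"
    and solution_bound_same: "length Vs = p \<Longrightarrow>
      \<forall>X s. \<bar>frechet_D Vs h (X + s *\<^sub>R u) - frechet_D Vs h X\<bar> \<le> L * \<bar>s\<bar> \<Longrightarrow>
      \<bar>frechet_D (u # Vs) (sol h) X\<bar> \<le> L / real (Suc p)"
    and solution_bound_gain: "length Vs = p \<Longrightarrow>
      \<forall>X s. \<bar>frechet_D Vs h (X + s *\<^sub>R u) - frechet_D Vs h X\<bar> \<le> L * \<bar>s\<bar> \<Longrightarrow>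
      \<bar>frechet_D (u # v # Vs) (sol h) X\<bar> \<le> stein_const (p + 2) * norm (whiten v) * L"
  using stein_op_smooth_lipschitz[OF h stein_integrable_solution[OF smooth_lipschitz_holder_growth[OF h]]]
  unfolding stein_solution_eq[OF smooth_lipschitz_exp_bounded[OF h]] by simp_all

lemma nablas_solution_le:
  assumes m: "m \<ge> 1" and h: "h \<in> Lip_class (m - 1)"
  shows "partials_exist m (sol h)"
    and "sup_norm (nablas (map (\<lambda>l. (i l, j l)) [1..<Suc m]) (sol h))
      \<le> ereal (1 / real m) * ess_sup_norm (nablas (map (\<lambda>l. (i l, j l)) [1..<Suc m]) h)"
proof -
  define p where "p = m - 1"
  have mp: "m = Suc p" using m by (simp add: p_def)
  have sl: "smooth_lipschitz p h" using h by (simp add: p_def Lip_class_smooth_lipschitz)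
  have fd: "frechet_differentiable m (sol h)"
    using frechet_differentiable_mono[OF solution_differentiable[OF sl]] mp by simp
  then show "partials_exist m (sol h)" by (rule frechet_differentiable_partials_exist)
  define ps where "ps = map (\<lambda>l. (i l, j l)) [1..<Suc m]"
  have "length ps = Suc p" by (simp add: ps_def mp)
  \<comment> \<open>\<open>q\<close> heads the list and is the outermost derivative, the one that
    may exist only almost everywhere for \<open>h\<close>.\<close>
  then obtain q qs where ps: "ps = q # qs" and len: "length qs = p" by (cases ps) auto
  show "sup_norm (nablas ps (sol h)) \<le> ereal (1 / real m) * ess_sup_norm (nablas ps h)"
  proof (rule sup_norm_le_mult)
    fix L X assume L: "ess_sup_norm (nablas ps h) \<le> ereal L"
    have "nablas ps (sol h) X
        = frechet_D (unit_mat (fst q) (snd q) # map (\<lambda>p. unit_mat (fst p) (snd p)) qs) (sol h) X"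
      using nablas_eq_frechet_D[OF fd, of ps] by (simp add: ps len mp)
    moreover have "\<bar>\<dots>\<bar> \<le> L / real (Suc p)"
      using directional_lipschitz_of_ess_bound[of qs h q L] sl L len
      by (intro solution_bound_same[OF sl]) (auto simp: ps)
    ultimately show "\<bar>nablas ps (sol h) X\<bar> \<le> 1 / real m * L" by (simp add: mp)
  qed (use m ess_sup_norm_nonneg in auto)
qed

lemma bounded_solution:
  assumes \<alpha>: "0 < \<alpha>" "\<alpha> \<le> 1" and h: "h \<in> holder_class \<alpha>"
  shows "frechet_differentiable 1 (sol h)"
    and "sup_norm (\<lambda>X. h X - mean h) \<le> ereal L \<Longrightarrow>
      \<bar>frechet_D [u] (sol h) X\<bar> \<le> sqrt (pi / 2) * norm (whiten u) * L"
proof -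
  have hg: "holder_growth h" using holder_class_holder_growth[OF \<alpha> h] .
  note eb = holder_growth_exp_bounded[OF hg]
  show "frechet_differentiable 1 (sol h)"
    using stein_op_has_derivative[OF eb stein_integrable_solution[OF hg]]
    unfolding stein_solution_eq[OF eb]
    by (auto simp: frechet_differentiable_def frechet_D_0 intro: differentiableI)
  assume L: "sup_norm (\<lambda>X. h X - mean h) \<le> ereal L"
  have "\<bar>h X - mean h\<bar> \<le> L" for X
  proof -
    have "ereal \<bar>h X - mean h\<bar> \<le> ereal L"
      using L unfolding sup_norm_def by (rule order_trans[rotated]) (rule SUP_upper, simp)
    then show ?thesis by simp
  qed
  then show "\<bar>frechet_D [u] (sol h) X\<bar> \<le> sqrt (pi / 2) * norm (whiten u) * L"
    unfolding stein_solution_eq[OF eb] by (intro stein_op_bounded[OF eb stein_integrable_solution[OF hg]])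
qed

lemma nabla_bounded_solution_le:
  assumes \<alpha>: "0 < \<alpha>" "\<alpha> \<le> 1" and h: "h \<in> holder_class \<alpha>"
  shows "partials_exist 1 (sol h)"
    and "sup_norm (nabla i j (sol h))
      \<le> ereal (sqrt (pi / 2) * sqrt (matrix_inv \<Psi> $ i $ i * matrix_inv \<Sigma> $ j $ j))
         * sup_norm (\<lambda>X. h X - mean h)"
proof -
  note fd = bounded_solution(1)[OF assms]
  show "partials_exist 1 (sol h)" using fd by (rule frechet_differentiable_partials_exist)
  show "sup_norm (nabla i j (sol h))
      \<le> ereal (sqrt (pi / 2) * sqrt (matrix_inv \<Psi> $ i $ i * matrix_inv \<Sigma> $ j $ j))
         * sup_norm (\<lambda>X. h X - mean h)"
    unfolding norm_whiten_unit_mat[symmetric]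
  proof (rule sup_norm_le_mult)
    fix L X assume L: "sup_norm (\<lambda>X. h X - mean h) \<le> ereal L"
    have "nabla i j (sol h) = frechet_D [unit_mat i j] (sol h)"
      using nablas_eq_frechet_D[OF fd, of "[(i, j)]"] by (simp add: nablas_Cons nablas_Nil)
    then show "\<bar>nabla i j (sol h) X\<bar> \<le> sqrt (pi / 2) * norm (whiten (unit_mat i j)) * L"
      using bounded_solution(2)[OF assms L, of "unit_mat i j" X] by (simp only:)
  qed (use norm_whiten_unit_mat_pos sup_norm_nonneg in auto)
qed

lemma nablas_solution_gain:
  assumes m: "m \<ge> 2" and h: "h \<in> Lip_class (m - 2)"
  shows "partials_exist m (sol h)"
    and "sup_norm (nablas (map (\<lambda>l. (i l, j l)) [1..<Suc m]) (sol h))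
      \<le> ereal (Gamma (real m / 2) / (sqrt 2 * Gamma (real m / 2 + 1 / 2)))
         * Min ((\<lambda>k. ereal (sqrt (matrix_inv \<Psi> $ i k $ i k * matrix_inv \<Sigma> $ j k $ j k))
              * ess_sup_norm (nablas (map (\<lambda>l. (i l, j l)) (filter (\<lambda>l. l \<noteq> k) [1..<Suc m])) h)) ` {1..m})"
      (is "_ \<le> _ * Min (?F ` _)")
proof -
  let ?f = "sol h"
  let ?U = "\<lambda>p :: 'n \<times> 'd. unit_mat (fst p) (snd p) :: real ^ 'd ^ 'n"
  let ?ij = "\<lambda>l. (i l, j l)"
  define p where "p = m - 2"
  have mp: "m = p + 2" using m by (simp add: p_def)
  have sl: "smooth_lipschitz p h" using h by (simp add: p_def Lip_class_smooth_lipschitz)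
  have fd: "frechet_differentiable m ?f" using solution_differentiable[OF sl] mp by simp
  then show "partials_exist m ?f" by (rule frechet_differentiable_partials_exist)
  \<comment> \<open>It is enough to prove the bound for an index at which the minimum is
    attained.\<close>
  have "Min (?F ` {1..m}) \<in> ?F ` {1..m}" using m by (intro Min_in) auto
  then obtain k where k: "k \<in> {1..m}" "Min (?F ` {1..m}) = ?F k" by blast
  from k have "k \<in> set [1..<Suc m]" by (simp only: set_upt) simp
  then obtain As Bs where split: "[1..<Suc m] = As @ k # Bs" by (auto dest: split_list simp only:)
  have "distinct (As @ k # Bs)" unfolding split[symmetric] by simp
  then have filt: "filter (\<lambda>l. l \<noteq> k) [1..<Suc m] = As @ Bs"
  proof -
    have "\<forall>x\<in>set As. x \<noteq> k" "\<forall>x\<in>set Bs. x \<noteq> k" using \<open>distinct (As @ k # Bs)\<close> by auto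
    then show ?thesis unfolding split by (simp add: filter_True)
  qed
  have "length (As @ k # Bs) = m" unfolding split[symmetric] by simp
  then have len: "length (map ?ij (As @ Bs)) = Suc p" by (simp add: mp)
  then obtain q qs where qs: "map ?ij (As @ Bs) = q # qs" "length qs = p"
    unfolding length_Suc_conv by (elim exE conjE) (rule that)
  \<comment> \<open>The direction with index \<open>k\<close> is carried to the front and then
    exchanged with \<open>q\<close>. In second place it receives the Gaussian weight, while
    \<open>q\<close> in front is estimated by increments and \<open>qs\<close> falls on
    \<open>h\<close>; \<open>q\<close> exists because \<open>m \<ge> 2\<close>.\<close>
  have "frechet_D (map (?U \<circ> ?ij) (As @ k # Bs)) ?f = frechet_D (map (?U \<circ> ?ij) As @ unit_mat (i k) (j k) # map (?U \<circ> ?ij) Bs) ?f"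
    by simp
  also have "\<dots> = frechet_D (unit_mat (i k) (j k) # map (?U \<circ> ?ij) As @ map (?U \<circ> ?ij) Bs) ?f"
    by (rule frechet_D_move[OF fd]) (use len mp in simp)
  also have "map (?U \<circ> ?ij) As @ map (?U \<circ> ?ij) Bs = map ?U (map ?ij (As @ Bs))" by simp
  also have "\<dots> = ?U q # map ?U qs" unfolding qs by simp
  also have "frechet_D (unit_mat (i k) (j k) # ?U q # map ?U qs) ?f = frechet_D (?U q # unit_mat (i k) (j k) # map ?U qs) ?f"
    by (rule frechet_D_swap[OF fd]) (use qs mp in simp)
  finally have D: "nablas (map ?ij [1..<Suc m]) ?f = frechet_D (?U q # unit_mat (i k) (j k) # map ?U qs) ?f"
    unfolding split using nablas_eq_frechet_D[OF fd, of "map ?ij (As @ k # Bs)"] \<open>length (As @ k # Bs) = m\<close>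
    by (simp only: length_map order_refl map_map o_def)
  have "sup_norm (nablas (map ?ij [1..<Suc m]) ?f) \<le> ereal (stein_const m * norm (whiten (unit_mat (i k) (j k)))) * ess_sup_norm (nablas (q # qs) h)"
  proof (rule sup_norm_le_mult)
    fix L X assume "ess_sup_norm (nablas (q # qs) h) \<le> ereal L"
    then show "\<bar>nablas (map ?ij [1..<Suc m]) ?f X\<bar> \<le> stein_const m * norm (whiten (unit_mat (i k) (j k))) * L"
      unfolding D using directional_lipschitz_of_ess_bound[of qs h q L] sl qs(2)
      unfolding mp by (intro solution_bound_gain[OF sl]) auto
  qed (use m norm_whiten_unit_mat_pos stein_const_pos ess_sup_norm_nonneg in auto)
  also have "\<dots> = ereal (stein_const m) * ?F k"
    unfolding filt qs norm_whiten_unit_mat by (simp add: mult.assoc flip: times_ereal.simps(1))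
  finally show "sup_norm (nablas (map ?ij [1..<Suc m]) ?f)
      \<le> ereal (Gamma (real m / 2) / (sqrt 2 * Gamma (real m / 2 + 1 / 2))) * Min (?F ` {1..m})"
    unfolding k(2) stein_const_def .
qed

lemma deriv_norm_solution_le:
  assumes m: "m \<ge> 1" and h: "h \<in> Cb_class m"
  shows "frechet_differentiable m (sol h)"
    and "deriv_norm m (sol h) \<le> ereal (1 / real m) * deriv_norm m h"
proof -
  define p where "p = m - 1"
  have mp: "m = Suc p" using m by (simp add: p_def)
  have sl: "smooth_lipschitz p h" using Cb_class_Lip_class[of h p] h mp by (simp add: Lip_class_smooth_lipschitz)
  have hd: "frechet_differentiable (Suc p) h" using h mp by (simp add: Cb_class_def)
  show "frechet_differentiable m (sol h)"
    using frechet_differentiable_mono[OF solution_differentiable[OF sl]] mp by simp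
  show "deriv_norm m (sol h) \<le> ereal (1 / real m) * deriv_norm m h"
  proof (rule deriv_norm_le_mult)
    fix L X and Us :: "(real ^ 'd ^ 'n) list"
    assume L: "deriv_norm m h \<le> ereal L" and Us: "length Us = m" "\<forall>U\<in>set Us. norm U = 1"
    obtain U Vs where UV: "Us = U # Vs" "length Vs = p" using Us mp by (cases Us) auto
    have "\<bar>frechet_D (U # Vs) (sol h) X\<bar> \<le> L / real (Suc p)"
      using directional_lipschitz_of_deriv_norm[of Vs h L U] hd L Us UV mp
      by (intro solution_bound_same[OF sl]) auto
    then show "\<bar>frechet_D Us (sol h) X\<bar> \<le> 1 / real m * L" by (simp add: UV mp)
  qed (use m deriv_norm_nonneg in auto)
qed

lemma deriv_norm_bounded_solution_le:
  assumes \<alpha>: "0 < \<alpha>" "\<alpha> \<le> 1" and h: "h \<in> holder_class \<alpha>"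
  shows "deriv_norm 1 (sol h)
    \<le> ereal (sqrt (pi / 2) * \<sigma>\<^sub>1 * \<sigma>\<^sub>2)
       * sup_norm (\<lambda>X. h X - mean h)"
proof (rule deriv_norm_le_mult)
  show "0 < sqrt (pi / 2) * \<sigma>\<^sub>1 * \<sigma>\<^sub>2"
    using spectral_norms_pos by (simp add: mult.assoc)
  fix L X and Us :: "(real ^ 'd ^ 'n) list"
  assume L: "sup_norm (\<lambda>X. h X - mean h) \<le> ereal L" and "length Us = 1" "\<forall>U\<in>set Us. norm U = 1"
  then obtain U where U: "Us = [U]" "norm U = 1" by (cases Us) auto
  have L0: "0 \<le> L" using order_trans[OF sup_norm_nonneg L] by simp
  have "\<bar>frechet_D Us (sol h) X\<bar> \<le> sqrt (pi / 2) * norm (whiten U) * L"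
    unfolding U by (rule bounded_solution(2)[OF assms L])
  also have "\<dots> \<le> sqrt (pi / 2) * (\<sigma>\<^sub>1 * \<sigma>\<^sub>2) * L"
    using norm_whiten_le[of U] U L0 by (intro mult_right_mono mult_left_mono) auto
  finally show "\<bar>frechet_D Us (sol h) X\<bar>
    \<le> sqrt (pi / 2) * \<sigma>\<^sub>1 * \<sigma>\<^sub>2 * L"
    by (simp only: mult.assoc)
qed (rule sup_norm_nonneg)

lemma deriv_norm_solution_gain:
  assumes m: "m \<ge> 2" and h: "h \<in> Cb_class (m - 1)"
  shows "frechet_differentiable m (sol h)"
    and "deriv_norm m (sol h)
      \<le> ereal (Gamma (real m / 2) / (sqrt 2 * Gamma (real m / 2 + 1 / 2))
           * \<sigma>\<^sub>1 * \<sigma>\<^sub>2)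
         * deriv_norm (m - 1) h"
proof -
  define p where "p = m - 2"
  have mp: "m = p + 2" "m - 1 = Suc p" using m by (auto simp: p_def)
  have sl: "smooth_lipschitz p h" using Cb_class_Lip_class[of h p] h mp by (simp add: Lip_class_smooth_lipschitz)
  have hd: "frechet_differentiable (Suc p) h" using h mp by (simp add: Cb_class_def)
  show "frechet_differentiable m (sol h)"
    using solution_differentiable[OF sl] mp by simp
  show "deriv_norm m (sol h)
      \<le> ereal (Gamma (real m / 2) / (sqrt 2 * Gamma (real m / 2 + 1 / 2))
           * \<sigma>\<^sub>1 * \<sigma>\<^sub>2)
         * deriv_norm (m - 1) h"
    unfolding stein_const_def[symmetric]
  proof (rule deriv_norm_le_mult)
    have c: "0 < stein_const m" using m by (intro stein_const_pos) simp
    then show "0 < stein_const m * \<sigma>\<^sub>1 * \<sigma>\<^sub>2"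
      using spectral_norms_pos by (simp add: mult.assoc)
    fix L X and Us :: "(real ^ 'd ^ 'n) list"
    assume L: "deriv_norm (m - 1) h \<le> ereal L" and Us: "length Us = m" "\<forall>U\<in>set Us. norm U = 1"
    have L0: "0 \<le> L" using order_trans[OF deriv_norm_nonneg L] by simp
    \<comment> \<open>\<open>U\<close> is estimated by increments of the derivative of
      \<open>h\<close> along \<open>Vs\<close>, and \<open>V\<close> receives the Gaussian weight.
      Since \<open>V\<close> is a unit vector, its whitened norm is at most the product of the
      spectral norms.\<close>
    obtain U V Vs where UV: "Us = U # V # Vs" "length Vs = p" using Us mp
      by (cases Us; cases "tl Us") auto
    have "\<bar>frechet_D (U # V # Vs) (sol h) X\<bar> \<le> stein_const (p + 2) * norm (whiten V) * L"
      using directional_lipschitz_of_deriv_norm[of Vs h L U] hd L Us UV mp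
      by (intro solution_bound_gain[OF sl]) auto
    also have "\<dots> \<le> stein_const (p + 2) * (\<sigma>\<^sub>1 * \<sigma>\<^sub>2) * L"
      using norm_whiten_le[of V] Us UV L0 c mp by (intro mult_right_mono mult_left_mono) auto
    finally show "\<bar>frechet_D Us (sol h) X\<bar>
      \<le> stein_const m * \<sigma>\<^sub>1 * \<sigma>\<^sub>2 * L"
      by (simp only: mult.assoc UV mp)
  qed (rule deriv_norm_nonneg)
qed

end

theorem theorem2:
  fixes \<Psi> :: "real ^ 'n ^ 'n" and \<Sigma> :: "real ^ 'd ^ 'd"
    and M :: "'w measure" and Z :: "'w \<Rightarrow> real ^ 'd ^ 'n"
  assumes "sym_pos_def \<Psi>" and "sym_pos_def \<Sigma>" and "std_normal_matrix M Z"
  shows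
    "(\<forall>(h :: real ^ 'd ^ 'n \<Rightarrow> real) (m :: nat) (i :: nat \<Rightarrow> 'n) (j :: nat \<Rightarrow> 'd).
        m \<ge> 1 \<and> h \<in> Lip_class (m - 1) \<longrightarrow>
        partials_exist m (stein_solution M Z \<Psi> \<Sigma> h) \<and>
        sup_norm (nablas (map (\<lambda>l. (i l, j l)) [1..<Suc m]) (stein_solution M Z \<Psi> \<Sigma> h))
          \<le> ereal (1 / real m)
             * ess_sup_norm (nablas (map (\<lambda>l. (i l, j l)) [1..<Suc m]) h))
   \<and> (\<forall>(h :: real ^ 'd ^ 'n \<Rightarrow> real) (\<alpha> :: real) (i :: 'n) (j :: 'd).
        0 < \<alpha> \<and> \<alpha> \<le> 1 \<and> h \<in> holder_class \<alpha> \<and> bounded (range h) \<longrightarrow>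
        partials_exist 1 (stein_solution M Z \<Psi> \<Sigma> h) \<and>
        sup_norm (nabla i j (stein_solution M Z \<Psi> \<Sigma> h))
          \<le> ereal (sqrt (pi / 2) * sqrt (matrix_inv \<Psi> $ i $ i * matrix_inv \<Sigma> $ j $ j))
             * sup_norm (\<lambda>X. h X - normal_mean M Z \<Psi> \<Sigma> h))
   \<and> (\<forall>(h :: real ^ 'd ^ 'n \<Rightarrow> real) (m :: nat) (i :: nat \<Rightarrow> 'n) (j :: nat \<Rightarrow> 'd).
        m \<ge> 2 \<and> h \<in> Lip_class (m - 2) \<longrightarrow>
        partials_exist m (stein_solution M Z \<Psi> \<Sigma> h) \<and>
        sup_norm (nablas (map (\<lambda>l. (i l, j l)) [1..<Suc m]) (stein_solution M Z \<Psi> \<Sigma> h))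
          \<le> ereal (Gamma (real m / 2) / (sqrt 2 * Gamma (real m / 2 + 1 / 2)))
             * Min ((\<lambda>k. ereal (sqrt (matrix_inv \<Psi> $ i k $ i k * matrix_inv \<Sigma> $ j k $ j k))
                  * ess_sup_norm
                      (nablas (map (\<lambda>l. (i l, j l)) (filter (\<lambda>l. l \<noteq> k) [1..<Suc m])) h)) ` {1..m}))
   \<and> (\<forall>(h :: real ^ 'd ^ 'n \<Rightarrow> real) (m :: nat).
        m \<ge> 1 \<and> h \<in> Cb_class m \<longrightarrow>
        frechet_differentiable m (stein_solution M Z \<Psi> \<Sigma> h) \<and>
        deriv_norm m (stein_solution M Z \<Psi> \<Sigma> h) \<le> ereal (1 / real m) * deriv_norm m h)
   \<and> (\<forall>(h :: real ^ 'd ^ 'n \<Rightarrow> real) (\<alpha> :: real).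
        0 < \<alpha> \<and> \<alpha> \<le> 1 \<and> h \<in> holder_class \<alpha> \<and> bounded (range h) \<longrightarrow>
        frechet_differentiable 1 (stein_solution M Z \<Psi> \<Sigma> h) \<and>
        deriv_norm 1 (stein_solution M Z \<Psi> \<Sigma> h)
          \<le> ereal (sqrt (pi / 2) * spectral_norm (matrix_inv (mat_sqrt \<Psi>))
                     * spectral_norm (matrix_inv (mat_sqrt \<Sigma>)))
             * sup_norm (\<lambda>X. h X - normal_mean M Z \<Psi> \<Sigma> h))
   \<and> (\<forall>(h :: real ^ 'd ^ 'n \<Rightarrow> real) (m :: nat).
        m \<ge> 2 \<and> h \<in> Cb_class (m - 1) \<longrightarrow>
        frechet_differentiable m (stein_solution M Z \<Psi> \<Sigma> h) \<and>
        deriv_norm m (stein_solution M Z \<Psi> \<Sigma> h)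
          \<le> ereal (Gamma (real m / 2) / (sqrt 2 * Gamma (real m / 2 + 1 / 2))
                     * spectral_norm (matrix_inv (mat_sqrt \<Psi>))
                     * spectral_norm (matrix_inv (mat_sqrt \<Sigma>)))
             * deriv_norm (m - 1) h)"
proof -
  interpret matrix_normal \<Psi> \<Sigma> M Z using assms by (rule matrix_normal.intro)
  show ?thesis
    by (intro conjI allI impI; elim conjE)
      (erule (1) nablas_solution_le nablas_solution_gain deriv_norm_solution_le deriv_norm_solution_gain | erule (2) nabla_bounded_solution_le bounded_solution(1) deriv_norm_bounded_solution_le)+
qed

end
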